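(* Let $M$ be a loopless matroid on $[n]$ ($n\ge1$) of rank $r$ with lattice of flats $\mathcal L(M)$, and let $G$ be a subgroup of the automorphism group $\mathrm{Aut}(M)$. Then, as virtual representations of $G$, $$\sum_{i=0}^{r-1}(-1)^iA^i(M)_{\mathbb C}\cong_G\begin{cases}0&\text{if $r$ is even},\\ (-1)^{\frac{r-1}{2}}\,\tilde H_{\frac{r-3}{2}}\big(\mathcal L(M)_{\mathrm{Even}(r-1)}\big)&\text{if $r$ is odd}.\end{cases}$$ In particular, the $G$-equivariant Charney--Davis quantity $CD^G(A(M))$ is nonnegative in $R_{\mathbb C}(G)$, i.e. it is (the class of) a genuine representation of $G$.
   Context: An automorphism of $M$ is a permutation of the ground set preserving the rank of every subset; it permutes the flats preserving rank. The Chow ring is the graded $\mathbb{Q}$-algebra (all variables in degree 1) $A(M)=\mathbb{Q}[x_F:F\in\mathcal L(M)\setminus\{\emptyset\}]/(I+J)$, where $I$ is generated by $x_Fx_{F'}$ for incomparable flats $F,F'$, and $J$ by $\sum_{F:\,i\in F}x_F$ for $i\in[n]$; $A^i(M)$ is its degree $i$ part and $A^i(M)_{\mathbb C}=\mathbb C\otimes_{\mathbb Q}A^i(M)$. $G$ acts by $\sigma x_F=x_{\sigma(F)}$. The ring $A(M)$ has top degree $r-1$. $R_{\mathbb C}(G)$ is the representation ring (virtual character ring) of $G$. For a graded $\mathbb C$-algebra $A=\bigoplus_{i=0}^mA^i$ of top degree $m$ with graded $\mathbb CG$-module structure, $\mathrm{Hilb}^G(A,t)=\sum_iA^it^i\in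 R_{\mathbb C}(G)[t]$, and $CD^G(A)=(-1)^{m/2}\mathrm{Hilb}^G(A,-1)$ if $m$ is even, $CD^G(A)=\mathrm{Hilb}^G(A,-1)$ if $m$ is odd; $CD^G(A(M))$ means $CD^G(A(M)_{\mathbb C})$. $\mathrm{Even}(k)=\{2,4,\dots,k\}$ for even $k$ (empty if $k=0$). For a graded poset $P$ of rank $m$ with minimum $\hat0$, maximum $\hat1$ and rank function $\mathrm{rk}_P$, and $S\subseteq[m-1]$, the rank-selected subposet is $P_S=\{x\in P:\mathrm{rk}_P(x)\in S\}\cup\{\hat0,\hat1\}$. $\tilde H_i(P_S)$ is the reduced simplicial homology, with complex coefficients, of the order complex of $P_S\setminus\{\hat0,\hat1\}$, with the induced $G$-action (for $S=\emptyset$, $\tilde H_{-1}$ is the one-dimensional trivial representation). *)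

theory Defs
  imports
    Complex_Main
    "HOL-Library.Poly_Mapping"
    "HOL-Library.Function_Algebras"
    "HOL-Computational_Algebra.Polynomial"
    "HOL-Algebra.QuotRing"
    "Jordan_Normal_Form.Matrix"
begin

section \<open>Matroids\<close>

record 'a matroid =
  ground :: "'a set"
  indeps :: "'a set set"

definition matroid :: "'a matroid \<Rightarrow> bool" where
  "matroid M \<longleftrightarrow>
     finite (ground M) \<and> indeps M \<subseteq> Pow (ground M) \<and> {} \<in> indeps M \<and>
     (\<forall>I J. I \<in> indeps M \<longrightarrow> J \<subseteq> I \<longrightarrow> J \<in> indeps M) \<and>
     (\<forall>I J. I \<in> indeps M \<longrightarrow> J \<in> indeps M \<longrightarrow> card I < card J \<longrightarrow>
        (\<exists>x\<in>J - I. insert x I \<in> indeps M))"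

definition rank :: "'a matroid \<Rightarrow> 'a set \<Rightarrow> nat" where
  "rank M X = Max (card ` {I \<in> indeps M. I \<subseteq> X})"

definition loopless :: "'a matroid \<Rightarrow> bool" where
  "loopless M \<longleftrightarrow> (\<forall>e\<in>ground M. {e} \<in> indeps M)"

definition flats :: "'a matroid \<Rightarrow> 'a set set" where
  "flats M = {F. F \<subseteq> ground M \<and> (\<forall>e\<in>ground M - F. rank M F < rank M (insert e F))}"

definition aut_group :: "'a matroid \<Rightarrow> ('a \<Rightarrow> 'a) monoid" where
  "aut_group M =
     \<lparr>carrier = {\<sigma>. \<sigma> permutes ground M \<and> (\<forall>X\<subseteq>ground M. rank M (\<sigma> ` X) = rank M X)},
      mult = (\<circ>), one = id\<rparr>"


section \<open>The Chow ring\<close>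

text \<open>
  A polynomial with variables indexed by \<open>'v\<close> is a finitely supported function from exponent
  vectors \<open>'v \<Rightarrow>\<^sub>0 nat\<close> to coefficients, with the convolution product of \<open>Poly_Mapping\<close>.
\<close>

type_synonym 'v qpoly = "('v \<Rightarrow>\<^sub>0 nat) \<Rightarrow>\<^sub>0 rat"

definition pvar :: "'v \<Rightarrow> 'v qpoly" where
  "pvar v = Poly_Mapping.single (Poly_Mapping.single v 1) 1"

definition pconst :: "rat \<Rightarrow> 'v qpoly" where
  "pconst q = Poly_Mapping.single 0 q"

definition qpoly_ring :: "'v set \<Rightarrow> 'v qpoly ring" where
  "qpoly_ring V =
     \<lparr>carrier = {p. \<forall>m\<in>Poly_Mapping.keys p. Poly_Mapping.keys m \<subseteq> V},
      mult = (*), one = 1, zero = 0, add = (+)\<rparr>"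

definition homogeneous :: "nat \<Rightarrow> 'v qpoly \<Rightarrow> bool" where
  "homogeneous d p \<longleftrightarrow>
     (\<forall>m\<in>Poly_Mapping.keys p. (\<Sum>v\<in>Poly_Mapping.keys m. Poly_Mapping.lookup m v) = d)"

text \<open>The ring homomorphism sending the variable \<open>v\<close> to the variable \<open>f v\<close>.\<close>

definition rename_vars :: "('v \<Rightarrow> 'w) \<Rightarrow> 'v qpoly \<Rightarrow> 'w qpoly" where
  "rename_vars f p =
     (\<Sum>m\<in>Poly_Mapping.keys p. pconst (Poly_Mapping.lookup p m) *
        (\<Prod>v\<in>Poly_Mapping.keys m. pvar (f v) ^ Poly_Mapping.lookup m v))"

definition chow_poly_ring :: "'a matroid \<Rightarrow> 'a set qpoly ring" where
  "chow_poly_ring M = qpoly_ring (flats M - {{}})"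

definition chow_I :: "'a matroid \<Rightarrow> 'a set qpoly set" where
  "chow_I M = Idl\<^bsub>chow_poly_ring M\<^esub>
     {pvar F * pvar F' | F F'. F \<in> flats M - {{}} \<and> F' \<in> flats M - {{}} \<and> \<not> F \<subseteq> F' \<and> \<not> F' \<subseteq> F}"

definition chow_J :: "'a matroid \<Rightarrow> 'a set qpoly set" where
  "chow_J M = Idl\<^bsub>chow_poly_ring M\<^esub>
     {\<Sum>F\<in>{F \<in> flats M. i \<in> F}. pvar F | i. i \<in> ground M}"

definition chow_ideal :: "'a matroid \<Rightarrow> 'a set qpoly set" where
  "chow_ideal M = chow_I M <+>\<^bsub>chow_poly_ring M\<^esub> chow_J M"

definition chow_ring :: "'a matroid \<Rightarrow> 'a set qpoly set ring" where
  "chow_ring M = chow_poly_ring M Quot chow_ideal M"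

definition chow_class :: "'a matroid \<Rightarrow> 'a set qpoly \<Rightarrow> 'a set qpoly set" where
  "chow_class M p = chow_ideal M +>\<^bsub>chow_poly_ring M\<^esub> p"

definition chow_piece :: "'a matroid \<Rightarrow> nat \<Rightarrow> 'a set qpoly set set" where
  "chow_piece M i = chow_class M ` {p \<in> carrier (chow_poly_ring M). homogeneous i p}"

definition chow_scale :: "'a matroid \<Rightarrow> rat \<Rightarrow> 'a set qpoly set \<Rightarrow> 'a set qpoly set" where
  "chow_scale M q X = chow_class M (pconst q) \<otimes>\<^bsub>chow_ring M\<^esub> X"

text \<open>
  Elements of the Chow ring are cosets; an automorphism acts on a coset elementwise, by
  \<open>x\<^sub>F \<mapsto> x\<^sub>\<sigma>\<^sub>(\<^sub>F\<^sub>)\<close>.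
\<close>

definition chow_act :: "('a \<Rightarrow> 'a) \<Rightarrow> 'a set qpoly set \<Rightarrow> 'a set qpoly set" where
  "chow_act \<sigma> X = rename_vars (\<lambda>F. \<sigma> ` F) ` X"


section \<open>Complex representations and their characters\<close>

text \<open>\<open>'a \<Rightarrow>\<^sub>0 complex\<close> as the complex vector space with basis \<open>'a\<close>.\<close>

definition cscale :: "complex \<Rightarrow> ('a \<Rightarrow>\<^sub>0 complex) \<Rightarrow> ('a \<Rightarrow>\<^sub>0 complex)" where
  "cscale z = Poly_Mapping.map (\<lambda>x. z * x)"

lemma lookup_cscale [simp]: "Poly_Mapping.lookup (cscale z c) x = z * Poly_Mapping.lookup c x"
  unfolding cscale_def by (simp add: Poly_Mapping.map.rep_eq when_def)

interpretation free: vector_space "cscale :: complex \<Rightarrow> ('a \<Rightarrow>\<^sub>0 complex) \<Rightarrow> _"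
  by unfold_locales
     (auto intro!: poly_mapping_eqI simp: Poly_Mapping.lookup_add algebra_simps)

definition lin_ext :: "('a \<Rightarrow> ('b \<Rightarrow>\<^sub>0 complex)) \<Rightarrow> ('a \<Rightarrow>\<^sub>0 complex) \<Rightarrow> ('b \<Rightarrow>\<^sub>0 complex)" where
  "lin_ext f c = (\<Sum>x\<in>Poly_Mapping.keys c. cscale (Poly_Mapping.lookup c x) (f x))"

text \<open>
  A complex representation is presented as a quotient \<open>U / W\<close> of subspaces \<open>W \<subseteq> U\<close> of a free
  vector space: \<open>elems\<close> is \<open>U\<close>, \<open>rels\<close> is \<open>W\<close>, and \<open>act g\<close> is a linear map that preserves both,
  so that it induces a map on \<open>U / W\<close>.
\<close>

record ('g, 'b) cmodule =
  elems :: "('b \<Rightarrow>\<^sub>0 complex) set"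
  rels :: "('b \<Rightarrow>\<^sub>0 complex) set"
  act :: "'g \<Rightarrow> ('b \<Rightarrow>\<^sub>0 complex) \<Rightarrow> ('b \<Rightarrow>\<^sub>0 complex)"

definition coords_mod ::
  "('b \<Rightarrow>\<^sub>0 complex) set \<Rightarrow> ('b \<Rightarrow>\<^sub>0 complex) set \<Rightarrow> ('b \<Rightarrow>\<^sub>0 complex) \<Rightarrow>
   (('b \<Rightarrow>\<^sub>0 complex) \<Rightarrow> complex) \<Rightarrow> bool" where
  "coords_mod W B u c \<longleftrightarrow> (\<forall>b. b \<notin> B \<longrightarrow> c b = 0) \<and> u - (\<Sum>b\<in>B. cscale (c b) b) \<in> W"

text \<open>\<open>B\<close> is a set of representatives of a basis of \<open>U / W\<close>.\<close>

definition basis_mod ::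
  "('b \<Rightarrow>\<^sub>0 complex) set \<Rightarrow> ('b \<Rightarrow>\<^sub>0 complex) set \<Rightarrow> ('b \<Rightarrow>\<^sub>0 complex) set \<Rightarrow> bool" where
  "basis_mod U W B \<longleftrightarrow> finite B \<and> B \<subseteq> U \<and> (\<forall>u\<in>U. \<exists>!c. coords_mod W B u c)"

definition trace_mod ::
  "('b \<Rightarrow>\<^sub>0 complex) set \<Rightarrow> ('b \<Rightarrow>\<^sub>0 complex) set \<Rightarrow>
   (('b \<Rightarrow>\<^sub>0 complex) \<Rightarrow> ('b \<Rightarrow>\<^sub>0 complex)) \<Rightarrow> complex" where
  "trace_mod U W T = (let B = (SOME B. basis_mod U W B) in
     \<Sum>b\<in>B. (THE c. coords_mod W B (T b) c) b)"

text \<open>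
  The representation ring of a finite group is taken to be its ring of virtual characters, with the
  class of a representation being its character. Class functions on the group are extended by
  \<open>0\<close> outside the carrier, and the ring operations are the pointwise ones of \<open>Function_Algebras\<close>.
\<close>

definition character :: "('g, 'm) monoid_scheme \<Rightarrow> ('g, 'b) cmodule \<Rightarrow> 'g \<Rightarrow> complex" where
  "character G V g =
     (if g \<in> carrier G then trace_mod (elems V) (rels V) (act V g) else 0)"

definition GL :: "nat \<Rightarrow> complex mat monoid" where
  "GL d = units_of (ring_mat TYPE(complex) d ())"

text \<open>
  The class functions that are classes of genuine representations, i.e. the nonnegative elements of
  the representation ring; \<open>d = 0\<close> gives the zero representation.
\<close>

definition genuine :: "('g, 'm) monoid_scheme \<Rightarrow> ('g \<Rightarrow> complex) \<Rightarrow> bool" where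
  "genuine G \<chi> \<longleftrightarrow> (\<exists>d. \<exists>\<rho>\<in>hom G (GL d).
     \<chi> = (\<lambda>g. if g \<in> carrier G then \<Sum>i<d. \<rho> g $$ (i, i) else 0))"

text \<open>
  Extension of scalars from the rationals: for a rational vector space with carrier \<open>V\<close>, the
  space \<open>\<complex> \<otimes> V\<close> is the complex vector space on symbols \<open>1 \<otimes> v\<close>, \<open>v \<in> V\<close>, modulo
  \<open>1 \<otimes> (v + w) = 1 \<otimes> v + 1 \<otimes> w\<close> and \<open>1 \<otimes> q v = q (1 \<otimes> v)\<close>, with \<open>g (1 \<otimes> v) = 1 \<otimes> g v\<close>.
\<close>

definition complexify ::
  "'b set \<Rightarrow> ('b \<Rightarrow> 'b \<Rightarrow> 'b) \<Rightarrow> (rat \<Rightarrow> 'b \<Rightarrow> 'b) \<Rightarrow> ('g \<Rightarrow> 'b \<Rightarrow> 'b) \<Rightarrow> ('g, 'b) cmodule" where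
  "complexify V pl sm ac =
     \<lparr>elems = {c. Poly_Mapping.keys c \<subseteq> V},
      rels = free.span
        ({Poly_Mapping.single (pl v w) 1 - Poly_Mapping.single v 1 - Poly_Mapping.single w 1
            | v w. v \<in> V \<and> w \<in> V} \<union>
         {Poly_Mapping.single (sm q v) 1 - Poly_Mapping.single v (of_rat q) | q v. v \<in> V}),
      act = (\<lambda>g. lin_ext (\<lambda>v. Poly_Mapping.single (ac g v) 1))\<rparr>"

definition chow_piece_C :: "'a matroid \<Rightarrow> nat \<Rightarrow> ('a \<Rightarrow> 'a, 'a set qpoly set) cmodule" where
  "chow_piece_C M i =
     complexify (chow_piece M i) (add (chow_ring M)) (chow_scale M) chow_act"

text \<open>\<open>A\<close> lists the graded pieces and \<open>m\<close> is the top degree.\<close>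

definition Hilb ::
  "('g, 'm) monoid_scheme \<Rightarrow> (nat \<Rightarrow> ('g, 'b) cmodule) \<Rightarrow> nat \<Rightarrow> ('g \<Rightarrow> complex) poly" where
  "Hilb G A m = (\<Sum>i=0..m. monom (character G (A i)) i)"

definition CD ::
  "('g, 'm) monoid_scheme \<Rightarrow> (nat \<Rightarrow> ('g, 'b) cmodule) \<Rightarrow> nat \<Rightarrow> 'g \<Rightarrow> complex" where
  "CD G A m = (if even m then (-1) ^ (m div 2) * poly (Hilb G A m) (-1)
               else poly (Hilb G A m) (-1))"


section \<open>Rank selection and reduced homology of order complexes\<close>

definition Even :: "nat \<Rightarrow> nat set" where
  "Even k = {j. even j \<and> 2 \<le> j \<and> j \<le> k}"

definition poset_bounds :: "'a::order set \<Rightarrow> 'a set" where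
  "poset_bounds P = {x \<in> P. (\<forall>y\<in>P. x \<le> y) \<or> (\<forall>y\<in>P. y \<le> x)}"

definition rank_selected :: "'a::order set \<Rightarrow> ('a \<Rightarrow> nat) \<Rightarrow> nat set \<Rightarrow> 'a set" where
  "rank_selected P rk S = {x \<in> P. rk x \<in> S} \<union> poset_bounds P"

text \<open>
  A \<open>k\<close>-simplex of the order complex of \<open>Q\<close> is a chain with \<open>k + 1\<close> elements, oriented by listing
  it in increasing order; the empty chain is the simplex of dimension \<open>-1\<close>.
\<close>

definition simplices :: "'a::order set \<Rightarrow> int \<Rightarrow> 'a list set" where
  "simplices Q k = {xs. set xs \<subseteq> Q \<and> sorted_wrt (<) xs \<and> int (length xs) = k + 1}"

definition boundary :: "('a list \<Rightarrow>\<^sub>0 complex) \<Rightarrow> ('a list \<Rightarrow>\<^sub>0 complex)" where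
  "boundary = lin_ext (\<lambda>xs.
     \<Sum>i<length xs. Poly_Mapping.single (take i xs @ drop (Suc i) xs) ((-1) ^ i))"

text \<open>
  \<open>red_homology P ac k\<close> is the \<open>k\<close>-th reduced homology of the order complex of the proper part of
  the bounded poset \<open>P\<close>, for a group acting on \<open>P\<close> through the order-preserving maps \<open>ac g\<close>.
\<close>

definition red_homology ::
  "'a::order set \<Rightarrow> ('g \<Rightarrow> 'a \<Rightarrow> 'a) \<Rightarrow> int \<Rightarrow> ('g, 'a list) cmodule" where
  "red_homology P ac k = (let Q = P - poset_bounds P in
     \<lparr>elems = {c. Poly_Mapping.keys c \<subseteq> simplices Q k \<and> boundary c = 0},
      rels = boundary ` {c. Poly_Mapping.keys c \<subseteq> simplices Q (k + 1)},
      act = (\<lambda>g. lin_ext (\<lambda>xs. Poly_Mapping.single (map (ac g) xs) 1))\<rparr>)"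

end

theory Submission
  imports Defs
begin

text \<open>
Both sides of the identity are class functions, so it suffices to compare them at each automorphism \<open>\<sigma>\<close>
in the group. Such a \<open>\<sigma>\<close> permutes a monomial basis of the Chow ring as well as the simplices of the order
complex, which turns both sides into signed counts of objects fixed by \<open>\<sigma>\<close>.

The Chow ring has the basis of Feichtner and Yuzvinsky: the monomials
\<open>x\<^sub>F\<^sub>1^m\<^sub>1 \<cdots> x\<^sub>F\<^sub>k^m\<^sub>k\<close> over chains \<open>F\<^sub>1 \<subset> \<cdots> \<subset> F\<^sub>k\<close> of nonempty flats with
\<open>1 \<le> m\<^sub>i < rk F\<^sub>i - rk F\<^sub>i\<^sub>-\<^sub>1\<close>, where \<open>F\<^sub>0\<close> is the empty flat. Automorphisms permute these
monomials, and since they preserve rank, a monomial is fixed exactly if every flat of its chain is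
fixed. Hence the trace of \<open>\<sigma>\<close> on a graded piece counts the fixed monomials of that degree
(\<open>chow_trace\<close>). Summing with the sign of the degree, the exponent of \<open>F\<^sub>i\<close> contributes
\<open>(-1) + 1 - \<cdots>\<close>, which is \<open>-1\<close> if \<open>rk F\<^sub>i - rk F\<^sub>i\<^sub>-\<^sub>1\<close> is even and \<open>0\<close> otherwise. What is left is the
sum of \<open>(-1)^k\<close> over the chains of \<open>k\<close> fixed nonempty flats all of whose ranks are even
(\<open>alternating_trace\<close>).

If \<open>r\<close> is even, the ground set is itself a flat of even rank; adding it to a chain or removing it
cancels everything (\<open>signed_chain_count_even_rank\<close>). If \<open>r\<close> is odd, these chains are the fixed
simplices, of all dimensions from \<open>-1\<close> on, of the order complex of the lattice of flats with its even ranks selected,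
and the sum is a Lefschetz number. This complex has vanishing reduced homology below its top
dimension (\<open>cycle_is_boundary\<close>), so that the Hopf trace formula leaves only the trace on the top
homology (\<open>hopf_trace\<close>). That homology is a representation on a space of cycles, which also gives
the last claim (\<open>genuine_trace\<close>).

The two substantial ingredients are proved as follows.

\<^item> Independence of the basis monomials (\<open>fy_exps_independent\<close>) follows the construction of the wonderful
compactification by iterated blow-ups, one flat \<open>G\<close> at a time. A relation among the monomials is tested by two
maps that mimic geometry: the push-forward to the previous stage, which detects the part not involving
\<open>x\<^sub>G\<close>, and the restriction to the exceptional divisor, a projective bundle over the corresponding variety
for the flats above \<open>G\<close>, which detects the rest. In both steps the relations are
preserved by semimodularity of the rank. That the
monomials span (\<open>fy_exps_spanning\<close>) is a terminating rewriting argument.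

\<^item> Acyclicity is a lexicographic argument in the spirit of EL-shellability. Label a cover \<open>x \<subset> y\<close>
by the least element of \<open>y - x\<close>, and complete a chain to a maximal one greedily. Chains with the same
label word form a Boolean interval, in which one can match each chain with the one obtained by inserting
or removing a fixed rank; other faces have lexicographically smaller words.
\<close>

abbreviation "lookup \<equiv> Poly_Mapping.lookup"
abbreviation "keys \<equiv> Poly_Mapping.keys"
abbreviation "single \<equiv> Poly_Mapping.single"

section \<open>Flats of a loopless matroid\<close>

locale loopless_matroid =
  fixes M :: "'a matroid"
  assumes matroid: "matroid M" and loopless: "loopless M"
begin

abbreviation "E \<equiv> ground M"
abbreviation "rk \<equiv> rank M"
abbreviation "L \<equiv> flats M"

lemma finite_E: "finite E"
  and indep_sub_E: "I \<in> indeps M \<Longrightarrow> I \<subseteq> E"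
  and indep_empty: "{} \<in> indeps M"
  and indep_subset: "I \<in> indeps M \<Longrightarrow> J \<subseteq> I \<Longrightarrow> J \<in> indeps M"
  and indep_augment: "I \<in> indeps M \<Longrightarrow> J \<in> indeps M \<Longrightarrow> card I < card J \<Longrightarrow> \<exists>x\<in>J - I. insert x I \<in> indeps M"
  using matroid unfolding matroid_def by blast+

lemma finite_indep: "I \<in> indeps M \<Longrightarrow> finite I"
  using indep_sub_E finite_E finite_subset by blast

lemma finite_indeps_below: "finite {I \<in> indeps M. I \<subseteq> X}"
  by (rule finite_subset[of _ "Pow E"]) (use indep_sub_E finite_E in auto)

lemma rank_ge: "I \<in> indeps M \<Longrightarrow> I \<subseteq> X \<Longrightarrow> card I \<le> rk X"
  unfolding rank_def by (rule Max_ge) (use finite_indeps_below in auto)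

lemma rank_attained: obtains I where "I \<in> indeps M" "I \<subseteq> X" "card I = rk X"
proof -
  have "rk X \<in> card ` {I \<in> indeps M. I \<subseteq> X}"
    unfolding rank_def by (rule Max_in) (use finite_indeps_below indep_empty in auto)
  then show ?thesis using that by auto
qed

lemma rank_mono: "X \<subseteq> Y \<Longrightarrow> rk X \<le> rk Y"
  by (metis rank_attained rank_ge subset_trans)

text \<open>Augmentation, repeated against a fixed independent set of maximal size in \<open>X\<close>.\<close>
lemma indep_extend:
  assumes "I \<in> indeps M" "I \<subseteq> X"
  obtains J where "J \<in> indeps M" "I \<subseteq> J" "J \<subseteq> X" "card J = rk X"
proof -
  obtain K where K: "K \<in> indeps M" "K \<subseteq> X" "card K = rk X" by (rule rank_attained)
  have "\<exists>J. J \<in> indeps M \<and> I \<subseteq> J \<and> J \<subseteq> X \<and> card J = rk X" using assms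
  proof (induction "rk X - card I" arbitrary: I)
    case 0
    then show ?case using rank_ge[of I X] by auto
  next
    case (Suc n)
    have "card I < card K" using Suc.hyps(2) K by linarith
    then obtain x where x: "x \<in> K - I" "insert x I \<in> indeps M" using indep_augment[of I K] K Suc.prems by blast
    then have "card (insert x I) = Suc (card I)" using finite_indep Suc by auto
    then have "n = rk X - card (insert x I)" using Suc by auto
    from Suc(1)[OF this x(2)] show ?case using x K Suc by auto
  qed
  then show ?thesis using that by blast
qed

text \<open>A basis \<open>I\<close> of \<open>X \<inter> Y\<close> extends to a basis \<open>J\<close> of \<open>X \<union> Y\<close>, and \<open>J \<inter> X\<close> and \<open>J \<inter> Y\<close> together count \<open>J\<close> once and
  \<open>J \<inter> X \<inter> Y \<supseteq> I\<close> a second time.\<close>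
lemma rank_submodular: "rk (X \<union> Y) + rk (X \<inter> Y) \<le> rk X + rk Y"
proof -
  obtain I where I: "I \<in> indeps M" "I \<subseteq> X \<inter> Y" "card I = rk (X \<inter> Y)" by (rule rank_attained)
  obtain J where J: "J \<in> indeps M" "I \<subseteq> J" "J \<subseteq> X \<union> Y" "card J = rk (X \<union> Y)"
    using indep_extend[OF I(1), of "X \<union> Y"] I(2) by blast
  have f: "finite J" using J finite_indep by auto
  have "card (J \<inter> X) + card (J \<inter> Y) = card (J \<inter> X \<union> J \<inter> Y) + card (J \<inter> X \<inter> (J \<inter> Y))"
    by (rule card_Un_Int) (use f in auto)
  moreover have "card (J \<inter> X \<union> J \<inter> Y) = card J" by (rule arg_cong[of _ _ card]) (use J in auto)
  moreover have "card I \<le> card (J \<inter> X \<inter> (J \<inter> Y))" by (rule card_mono) (use f I J in auto)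
  moreover have "card (J \<inter> X) \<le> rk X" "card (J \<inter> Y) \<le> rk Y"
    by (rule rank_ge; use J indep_subset in blast)+
  ultimately show ?thesis using I J by linarith
qed

lemma rank_insert_le: "rk (insert e X) \<le> Suc (rk X)"
proof -
  obtain J where J: "J \<in> indeps M" "J \<subseteq> insert e X" "card J = rk (insert e X)" by (rule rank_attained)
  have "card (J - {e}) \<le> rk X" by (rule rank_ge) (use J indep_subset in blast)+
  moreover have "card J \<le> Suc (card (J - {e}))"
    using card_Diff1_le[of J e] finite_indep[OF J(1)] by (cases "e \<in> J") (auto simp: card_Suc_Diff1)
  ultimately show ?thesis using J by linarith
qed

lemma rank_empty: "rk {} = 0"
  by (metis card.empty rank_attained subset_empty)

definition cl :: "'a set \<Rightarrow> 'a set" where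
  "cl X = {e \<in> E. rk (insert e X) = rk X}"

lemma cl_sub_E: "cl X \<subseteq> E" by (auto simp: cl_def)

lemma subset_cl: "X \<subseteq> E \<Longrightarrow> X \<subseteq> cl X"
  by (auto simp: cl_def insert_absorb)

lemma rank_cl: assumes "X \<subseteq> E" shows "rk (cl X) = rk X"
proof (rule antisym)
  show "rk X \<le> rk (cl X)" by (rule rank_mono[OF subset_cl[OF assms]])
  obtain I where I: "I \<in> indeps M" "I \<subseteq> X" "card I = rk X" by (rule rank_attained)
  obtain J where J: "J \<in> indeps M" "I \<subseteq> J" "J \<subseteq> cl X" "card J = rk (cl X)"
    using indep_extend[OF I(1), of "cl X"] I(2) subset_cl[OF assms] by blast
  show "rk (cl X) \<le> rk X"
  proof (rule ccontr)
    assume "\<not> ?thesis"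
    then have "card I < card J" using I J by simp
    then obtain e where e: "e \<in> J - I" "insert e I \<in> indeps M" using indep_augment I J by blast
    then have "card (insert e I) \<le> rk (insert e X)" using I by (intro rank_ge) auto
    then have "Suc (rk X) \<le> rk (insert e X)" using e I finite_indep by auto
    then show False using e J by (auto simp: cl_def)
  qed
qed

lemma flat_sub_E: "F \<in> L \<Longrightarrow> F \<subseteq> E" by (simp add: flats_def)

lemma finite_flat: "F \<in> L \<Longrightarrow> finite F" using flat_sub_E finite_E finite_subset by blast

lemma finite_flats: "finite L"
  by (rule finite_subset[of _ "Pow E"]) (use flat_sub_E finite_E in auto)

lemma cl_flat: assumes "X \<subseteq> E" shows "cl X \<in> L"
proof -
  have "rk (cl X) < rk (insert e (cl X))" if "e \<in> E - cl X" for e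
  proof -
    have "rk (insert e X) \<noteq> rk X" using that by (auto simp: cl_def)
    then have "rk X < rk (insert e X)" using rank_mono[OF subset_insertI, of X e] by linarith
    also have "\<dots> \<le> rk (insert e (cl X))" by (rule rank_mono) (use subset_cl[OF assms] in auto)
    finally show ?thesis using rank_cl[OF assms] by simp
  qed
  then show ?thesis using cl_sub_E by (auto simp: flats_def)
qed

text \<open>Submodularity for \<open>insert e X\<close> and \<open>F\<close>: an element that does not raise the rank of \<open>X\<close> does not raise
  the rank of any larger set.\<close>
lemma cl_minimal: assumes "F \<in> L" "X \<subseteq> F" shows "cl X \<subseteq> F"
proof
  fix e assume e: "e \<in> cl X"
  show "e \<in> F"
  proof (rule ccontr)
    assume n: "e \<notin> F"
    then have lt: "rk F < rk (insert e F)" using e assms by (auto simp: flats_def cl_def)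
    have "rk (insert e X \<union> F) + rk (insert e X \<inter> F) \<le> rk (insert e X) + rk F" by (rule rank_submodular)
    moreover have "insert e X \<union> F = insert e F" "insert e X \<inter> F = X" using n assms by auto
    ultimately show False using lt e by (simp add: cl_def)
  qed
qed

lemma flat_Int: assumes "F \<in> L" "G \<in> L" shows "F \<inter> G \<in> L"
proof -
  have "cl (F \<inter> G) \<subseteq> F \<inter> G" using cl_minimal assms by auto
  moreover have "F \<inter> G \<subseteq> E" using flat_sub_E assms by auto
  ultimately show ?thesis by (metis cl_flat subset_cl subset_antisym)
qed

lemma flat_rank_less: assumes "F \<in> L" "G \<in> L" "F \<subset> G" shows "rk F < rk G"
proof -
  obtain e where e: "e \<in> G - F" using assms by auto
  then have "rk F < rk (insert e F)" using assms flat_sub_E[of G] by (auto simp: flats_def)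
  also have "\<dots> \<le> rk G" by (rule rank_mono) (use e assms in auto)
  finally show ?thesis .
qed

lemma flat_eqI: assumes "F \<in> L" "G \<in> L" "F \<subseteq> G" "rk F = rk G" shows "F = G"
  using flat_rank_less assms by fastforce

lemma E_flat: "E \<in> L" by (simp add: flats_def)

lemma empty_flat: "{} \<in> L"
proof -
  have "0 < rk {e}" if "e \<in> E" for e
    using rank_ge[of "{e}" "{e}"] loopless that by (auto simp: loopless_def)
  then show ?thesis by (auto simp: flats_def rank_empty)
qed

lemma flat_rank_le: "F \<in> L \<Longrightarrow> rk F \<le> rk E"
  by (rule rank_mono[OF flat_sub_E])

lemma flat_rank_pos: "F \<in> L \<Longrightarrow> F \<noteq> {} \<Longrightarrow> 0 < rk F"
  using flat_rank_less[OF empty_flat] by (metis gr0I less_nat_zero_code psubsetI empty_subsetI)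

lemma rank_cl_insert: assumes "F \<in> L" "e \<in> E" "e \<notin> F" shows "rk (cl (insert e F)) = Suc (rk F)"
proof -
  have "rk (cl (insert e F)) = rk (insert e F)" by (rule rank_cl) (use assms flat_sub_E in auto)
  moreover have "rk F < rk (insert e F)" using assms by (auto simp: flats_def)
  ultimately show ?thesis using rank_insert_le[of e F] by auto
qed

lemma cl_of_flat: "F \<in> L \<Longrightarrow> cl F = F"
  by (meson cl_minimal flat_sub_E order_refl subset_antisym subset_cl)

definition join :: "'a set \<Rightarrow> 'a set \<Rightarrow> 'a set" where "join F G = cl (F \<union> G)"

lemma join_flat: "F \<in> L \<Longrightarrow> G \<in> L \<Longrightarrow> join F G \<in> L"
  unfolding join_def by (rule cl_flat) (use flat_sub_E in auto)

lemma join_upper: assumes "F \<in> L" "G \<in> L" shows "F \<subseteq> join F G" "G \<subseteq> join F G"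
proof -
  have "F \<union> G \<subseteq> cl (F \<union> G)" by (rule subset_cl) (use assms flat_sub_E in auto)
  then show "F \<subseteq> join F G" "G \<subseteq> join F G" by (auto simp: join_def)
qed

lemma join_least: "K \<in> L \<Longrightarrow> F \<subseteq> K \<Longrightarrow> G \<subseteq> K \<Longrightarrow> join F G \<subseteq> K"
  unfolding join_def by (rule cl_minimal) auto

text \<open>Semimodularity of the lattice of flats; the meet of two flats is their intersection.\<close>
lemma rank_join: assumes "F \<in> L" "G \<in> L" shows "rk (join F G) + rk (F \<inter> G) \<le> rk F + rk G"
proof -
  have "rk (join F G) = rk (F \<union> G)"
    unfolding join_def by (rule rank_cl) (use assms flat_sub_E in auto)
  then show ?thesis using rank_submodular[of F G] by simp
qed

lemma automorphism_flat:
  assumes \<sigma>: "\<sigma> permutes E" "\<And>X. X \<subseteq> E \<Longrightarrow> rk (\<sigma> ` X) = rk X" and F: "F \<in> L"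
  shows "\<sigma> ` F \<in> L"
proof -
  have im: "\<sigma> ` E = E" using \<sigma>(1) by (rule permutes_image)
  have FE: "F \<subseteq> E" using F by (rule flat_sub_E)
  have sub: "\<sigma> ` F \<subseteq> E" using image_mono[OF FE, of \<sigma>] im by simp
  have "rk (\<sigma> ` F) < rk (insert e (\<sigma> ` F))" if e: "e \<in> E - \<sigma> ` F" for e
  proof -
    have "e \<in> \<sigma> ` E" using e im by simp
    then obtain d where d: "d \<in> E" "e = \<sigma> d" by (rule imageE)
    have "d \<notin> F" using e d by auto
    then have lt: "rk F < rk (insert d F)" using F d by (auto simp: flats_def)
    have "insert e (\<sigma> ` F) = \<sigma> ` (insert d F)" using d by simp
    also have "rk \<dots> = rk (insert d F)" by (rule \<sigma>(2)) (use d FE in simp)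
    finally show ?thesis using lt \<sigma>(2)[OF FE] by simp
  qed
  then show ?thesis using sub by (simp add: flats_def)
qed

end

section \<open>Traces and genuine characters\<close>

lemma lin_ext_sum_superset:
  assumes "finite A" "keys c \<subseteq> A"
  shows "lin_ext f c = (\<Sum>x\<in>A. cscale (lookup c x) (f x))"
  unfolding lin_ext_def
  by (rule sum.mono_neutral_left) (use assms in \<open>auto simp: in_keys_iff\<close>)

lemma lin_ext_add: "lin_ext f (c + d) = lin_ext f c + lin_ext f d"
proof -
  let ?A = "keys c \<union> keys d"
  have "keys (c + d) \<subseteq> ?A" by (rule Poly_Mapping.keys_add)
  then show ?thesis
    by (simp add: lin_ext_sum_superset[of ?A] Poly_Mapping.lookup_add free.scale_left_distrib sum.distrib)
qed

lemma lin_ext_cscale: "lin_ext f (cscale z c) = cscale z (lin_ext f c)"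
proof -
  have "keys (cscale z c) \<subseteq> keys c" by (auto simp: in_keys_iff)
  then show ?thesis
    by (simp add: lin_ext_sum_superset[of "keys c"] free.scale_sum_right)
qed

lemma lin_ext_single: "lin_ext f (single x z) = cscale z (f x)"
  by (simp add: lin_ext_sum_superset[of "{x}"])

lemma lin_ext_0 [simp]: "lin_ext f 0 = 0"
  by (simp add: lin_ext_def)

lemma lin_ext_uminus: "lin_ext f (- c) = - lin_ext f c"
  by (metis add.right_inverse add_eq_0_iff lin_ext_0 lin_ext_add)

lemma lin_ext_diff: "lin_ext f (c - d) = lin_ext f c - lin_ext f d"
  by (metis add_uminus_conv_diff lin_ext_add lin_ext_uminus)

lemma lin_ext_sum: "lin_ext f (\<Sum>i\<in>I. c i) = (\<Sum>i\<in>I. lin_ext f (c i))"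
  by (induction I rule: infinite_finite_induct) (auto simp: lin_ext_add)

lemma single_conv_cscale: "single x z = cscale z (single x 1)"
  by (auto intro!: poly_mapping_eqI simp: Poly_Mapping.lookup_single when_def)

lemma sum_single_keys: "(\<Sum>x\<in>keys c. single x (lookup c x)) = c"
  by (rule poly_mapping_eqI)
     (simp add: Poly_Mapping.lookup_sum Poly_Mapping.lookup_single when_def in_keys_iff)

lemma basis_mod_coords_unique:
  assumes "basis_mod U W B" "u \<in> U" "coords_mod W B u c" "coords_mod W B u d"
  shows "c = d"
  using assms unfolding basis_mod_def by blast

lemma coords_mod_the:
  assumes "basis_mod U W B" "u \<in> U"
  shows "coords_mod W B u (THE c. coords_mod W B u c)"
  using assms unfolding basis_mod_def by (metis (mono_tags, lifting) theI')

lemma the_coords_mod: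
  assumes "basis_mod U W B" "u \<in> U" "coords_mod W B u c"
  shows "(THE c. coords_mod W B u c) = c"
  using assms basis_mod_coords_unique coords_mod_the by blast

lemma coords_mod_add:
  assumes "free.subspace W" "coords_mod W B u c" "coords_mod W B v d"
  shows "coords_mod W B (u + v) (\<lambda>b. c b + d b)"
proof -
  have e: "u + v - (\<Sum>b\<in>B. cscale (c b + d b) b) =
     (u - (\<Sum>b\<in>B. cscale (c b) b)) + (v - (\<Sum>b\<in>B. cscale (d b) b))"
    by (simp add: free.scale_left_distrib sum.distrib)
  have "(u - (\<Sum>b\<in>B. cscale (c b) b)) + (v - (\<Sum>b\<in>B. cscale (d b) b)) \<in> W"
    using assms by (intro free.subspace_add) (auto simp: coords_mod_def)
  then show ?thesis unfolding coords_mod_def e using assms by (simp add: coords_mod_def)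
qed

lemma coords_mod_cscale:
  assumes "free.subspace W" "coords_mod W B u c"
  shows "coords_mod W B (cscale z u) (\<lambda>b. z * c b)"
proof -
  have "cscale z u - (\<Sum>b\<in>B. cscale (z * c b) b) = cscale z (u - (\<Sum>b\<in>B. cscale (c b) b))"
    by (simp add: free.scale_right_diff_distrib free.scale_sum_right)
  with assms show ?thesis unfolding coords_mod_def by (auto intro: free.subspace_scale)
qed

lemma coords_mod_sum:
  assumes "free.subspace W" "finite I" "\<And>i. i \<in> I \<Longrightarrow> coords_mod W B (u i) (c i)"
  shows "coords_mod W B (\<Sum>i\<in>I. cscale (z i) (u i)) (\<lambda>b. \<Sum>i\<in>I. z i * c i b)"
  using assms(2,3)
proof (induction I rule: finite_induct)
  case empty
  then show ?case using assms(1) by (simp add: coords_mod_def free.subspace_0)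
next
  case (insert i I)
  then show ?case
    using coords_mod_add[OF assms(1) coords_mod_cscale[OF assms(1), of B "u i" "c i" "z i"]] by auto
qed

lemma coords_mod_cong_mod:
  assumes "free.subspace W" "coords_mod W B u c" "v - u \<in> W"
  shows "coords_mod W B v c"
proof -
  have "v - (\<Sum>b\<in>B. cscale (c b) b) = (v - u) + (u - (\<Sum>b\<in>B. cscale (c b) b))" by simp
  moreover have "(v - u) + (u - (\<Sum>b\<in>B. cscale (c b) b)) \<in> W"
    using assms by (intro free.subspace_add) (auto simp: coords_mod_def)
  ultimately show ?thesis using assms by (simp add: coords_mod_def)
qed

text \<open>A linear endomorphism of \<open>U / W\<close>, presented by a map on the ambient free space.\<close>
locale quotient_endo =
  fixes U W :: "('b \<Rightarrow>\<^sub>0 complex) set" and T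
  assumes subspace_U: "free.subspace U" and subspace_W: "free.subspace W"
    and T_add: "\<And>x y. T (x + y) = T x + T y" and T_scale: "\<And>z x. T (cscale z x) = cscale z (T x)"
    and T_U: "\<And>x. x \<in> U \<Longrightarrow> T x \<in> U" and T_W: "\<And>x. x \<in> W \<Longrightarrow> T x \<in> W"
begin

lemma T_0: "T 0 = 0" using T_scale[of 0 0] by simp

lemma T_diff: "T (x - y) = T x - T y"
  by (metis T_add add_diff_cancel_right' diff_add_cancel)

lemma T_sum: "T (\<Sum>i\<in>I. f i) = (\<Sum>i\<in>I. T (f i))"
  by (induction I rule: infinite_finite_induct) (auto simp: T_0 T_add)

text \<open>The trace is \<open>tr (P Q) = tr (Q P)\<close>, for \<open>P\<close> the change of basis and \<open>Q\<close> the coordinates of the images under \<open>T\<close>.\<close>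
lemma trace_basis_independent:
  assumes B: "basis_mod U W B" and B': "basis_mod U W B'"
    and C: "\<And>b. b \<in> B \<Longrightarrow> coords_mod W B (T b) (C b)"
    and C': "\<And>b. b \<in> B' \<Longrightarrow> coords_mod W B' (T b) (C' b)"
  shows "(\<Sum>b\<in>B. C b b) = (\<Sum>b\<in>B'. C' b b)"
proof -
  have fin: "finite B" "finite B'" and sub: "B \<subseteq> U" "B' \<subseteq> U" using B B' by (auto simp: basis_mod_def)
  define P where "P b = (THE c. coords_mod W B' b c)" for b
  have P: "coords_mod W B' b (P b)" if "b \<in> B" for b
    unfolding P_def by (rule coords_mod_the[OF B']) (use that sub in auto)
  define Q where "Q u = (THE c. coords_mod W B u c)" for u
  have Q: "coords_mod W B u (Q u)" if "u \<in> U" for u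
    unfolding Q_def by (rule coords_mod_the[OF B]) (use that sub in auto)
  have 1: "C b = (\<lambda>x. \<Sum>b'\<in>B'. P b b' * Q (T b') x)" if b: "b \<in> B" for b
  proof (rule basis_mod_coords_unique[OF B _ C[OF b]])
    show "T b \<in> U" using b sub T_U by auto
    have "coords_mod W B (\<Sum>b'\<in>B'. cscale (P b b') (T b')) (\<lambda>x. \<Sum>b'\<in>B'. P b b' * Q (T b') x)"
      by (rule coords_mod_sum[OF subspace_W fin(2)]) (use sub T_U Q in auto)
    moreover have "T (b - (\<Sum>b'\<in>B'. cscale (P b b') b')) \<in> W"
      using P[OF b] by (intro T_W) (simp add: coords_mod_def)
    then have "T b - (\<Sum>b'\<in>B'. cscale (P b b') (T b')) \<in> W"
      by (simp add: T_diff T_sum T_scale)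
    ultimately show "coords_mod W B (T b) (\<lambda>x. \<Sum>b'\<in>B'. P b b' * Q (T b') x)"
      by (rule coords_mod_cong_mod[OF subspace_W])
  qed
  have 2: "C' b' = (\<lambda>x. \<Sum>b\<in>B. Q (T b') b * P b x)" if b': "b' \<in> B'" for b'
  proof (rule basis_mod_coords_unique[OF B' _ C'[OF b']])
    show "T b' \<in> U" using b' sub T_U by auto
    then have *: "T b' - (\<Sum>b\<in>B. cscale (Q (T b') b) b) \<in> W" using Q by (simp add: coords_mod_def)
    have "coords_mod W B' (\<Sum>b\<in>B. cscale (Q (T b') b) b) (\<lambda>x. \<Sum>b\<in>B. Q (T b') b * P b x)"
      by (rule coords_mod_sum[OF subspace_W fin(1)]) (use P in auto)
    with * show "coords_mod W B' (T b') (\<lambda>x. \<Sum>b\<in>B. Q (T b') b * P b x)"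
      using coords_mod_cong_mod[OF subspace_W] by blast
  qed
  have "(\<Sum>b\<in>B. C b b) = (\<Sum>b\<in>B. \<Sum>b'\<in>B'. P b b' * Q (T b') b)" using 1 by simp
  also have "\<dots> = (\<Sum>b'\<in>B'. \<Sum>b\<in>B. Q (T b') b * P b b')"
    by (subst sum.swap) (simp add: mult.commute)
  also have "\<dots> = (\<Sum>b'\<in>B'. C' b' b')" using 2 by simp
  finally show ?thesis .
qed

lemma trace_mod_eq:
  assumes B: "basis_mod U W B" and C: "\<And>b. b \<in> B \<Longrightarrow> coords_mod W B (T b) (C b)"
  shows "trace_mod U W T = (\<Sum>b\<in>B. C b b)"
proof -
  define B' where "B' = (SOME B. basis_mod U W B)"
  have B': "basis_mod U W B'" unfolding B'_def using B by (rule someI)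
  then have "B' \<subseteq> U" by (simp add: basis_mod_def)
  have "trace_mod U W T = (\<Sum>b\<in>B'. (THE c. coords_mod W B' (T b) c) b)"
    by (simp add: trace_mod_def B'_def Let_def)
  also have "\<dots> = (\<Sum>b\<in>B. C b b)"
    by (rule trace_basis_independent[OF B' B _ C, symmetric, THEN sym])
       (use coords_mod_the[OF B'] T_U \<open>B' \<subseteq> U\<close> in auto)
  finally show ?thesis .
qed

end

lemma subspace_zero_set: "free.subspace {0}" by (simp add: free.subspace_def)

lemma basis_mod_exists:
  assumes U: "free.subspace U" and A: "finite A" and sub: "\<And>u. u \<in> U \<Longrightarrow> keys u \<subseteq> A"
  shows "\<exists>B. basis_mod U {0} B"
proof -
  obtain B where B: "B \<subseteq> U" "free.independent B" "U \<subseteq> free.span B"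
    using free.basis_exists by metis
  let ?S = "(\<lambda>x. single x (1::complex)) ` A"
  have "B \<subseteq> free.span ?S"
  proof
    fix b assume "b \<in> B"
    then have k: "keys b \<subseteq> A" using B sub by auto
    have "b = (\<Sum>x\<in>keys b. cscale (lookup b x) (single x 1))"
      by (subst sum_single_keys[of b, symmetric]) (simp add: single_conv_cscale[symmetric])
    also have "\<dots> \<in> free.span ?S"
      by (intro free.span_sum free.span_scale free.span_base) (use k in auto)
    finally show "b \<in> free.span ?S" .
  qed
  then have fin: "finite B" using free.independent_span_bound[OF _ B(2)] A by auto
  have "\<exists>!c. coords_mod {0} B u c" if u: "u \<in> U" for u
  proof (rule ex_ex1I)
    obtain c where c: "u = (\<Sum>b\<in>B. cscale (c b) b)"
      using u B(3) unfolding free.span_finite[OF fin] by auto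
    then have "coords_mod {0} B u (\<lambda>b. if b \<in> B then c b else (0::complex))"
      by (auto simp: coords_mod_def intro!: sum.cong)
    then show "\<exists>c. coords_mod {0} B u c" by blast
  next
    fix c d assume cd: "coords_mod {0} B u c" "coords_mod {0} B u d"
    then have "(\<Sum>b\<in>B. cscale (c b - d b) b) = 0"
      by (simp add: coords_mod_def free.scale_left_diff_distrib sum_subtractf)
    then have "\<forall>b\<in>B. c b - d b = 0"
      using free.independentD[OF B(2) fin order_refl, of "\<lambda>b. c b - d b"] by blast
    then have "c b = d b" for b using cd unfolding coords_mod_def by (cases "b \<in> B") simp_all
    then show "c = d" by blast
  qed
  then have "basis_mod U {0} B" using B(1) fin by (simp add: basis_mod_def)
  then show ?thesis by blast
qed

text \<open>A basis of the kernel of \<open>f\<close> together with lifts of a basis of its image is a basis of \<open>U\<close>, and with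
  respect to it \<open>T\<close> is block triangular. This is the only form of additivity that the Hopf trace formula needs.\<close>
lemma trace_kernel_image:
  assumes T: "quotient_endo U {0} T" and T': "quotient_endo (f ` U) {0} T'"
    and f_add: "\<And>x y. f (x + y) = f x + f y" and f_scale: "\<And>z x. f (cscale z x) = cscale z (f x)"
    and comm: "\<And>u. u \<in> U \<Longrightarrow> f (T u) = T' (f u)"
    and B1: "basis_mod {u \<in> U. f u = 0} {0} B1" and B2: "basis_mod (f ` U) {0} B2"
  shows "trace_mod U {0} T = trace_mod {u \<in> U. f u = 0} {0} T + trace_mod (f ` U) {0} T'"
proof -
  interpret T: quotient_endo U "{0}" T by (rule T)
  interpret T': quotient_endo "f ` U" "{0}" T' by (rule T')
  have f0: "f 0 = 0" using f_scale[of 0 0] by simp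
  have f_diff: "f (x - y) = f x - f y" for x y
    by (metis f_add add_diff_cancel_right' diff_add_cancel)
  have f_sum: "f (\<Sum>i\<in>I. g i) = (\<Sum>i\<in>I. f (g i))" for g and I :: "('a \<Rightarrow>\<^sub>0 complex) set"
    by (induction I rule: infinite_finite_induct) (auto simp: f0 f_add)
  have f_sum2: "f (\<Sum>i\<in>I. g i) = (\<Sum>i\<in>I. f (g i))" for g and I :: "('b \<Rightarrow>\<^sub>0 complex) set"
    by (induction I rule: infinite_finite_induct) (auto simp: f0 f_add)
  let ?K = "{u \<in> U. f u = 0}"
  interpret K: quotient_endo ?K "{0}" T
  proof
    show "free.subspace ?K" using T.subspace_U by (auto simp: free.subspace_def f0 f_add f_scale)
    show "free.subspace {0}" by (rule subspace_zero_set)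
    fix x assume "x \<in> ?K" then show "T x \<in> ?K" using comm T.T_U T'.T_0 by auto
  qed (use T.T_add T.T_scale T.T_W in auto)
  have fin: "finite B1" "finite B2" and sub: "B1 \<subseteq> ?K" "B2 \<subseteq> f ` U"
    using B1 B2 by (auto simp: basis_mod_def)
  define l where "l b = (SOME u. u \<in> U \<and> f u = b)" for b
  have l: "l b \<in> U \<and> f (l b) = b" if "b \<in> B2" for b
    unfolding l_def by (rule someI_ex) (use sub(2) that in auto)
  then have l_inj: "inj_on l B2" by (intro inj_onI) metis
  have nz: "b \<noteq> 0" if "b \<in> B2" for b
  proof
    assume "b = 0"
    then have c: "coords_mod {0} B2 0 (\<lambda>x. if x = 0 then 1 else 0)"
      using that fin(2) by (simp add: coords_mod_def sum.neutral)
    have d: "coords_mod {0} B2 0 (\<lambda>x. 0)" by (simp add: coords_mod_def)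
    have "0 \<in> f ` U" using sub that \<open>b = 0\<close> by auto
    from basis_mod_coords_unique[OF B2 this c d] show False by (metis zero_neq_one)
  qed
  have disj: "B1 \<inter> l ` B2 = {}" using sub l nz by fastforce
  then have ni: "l b \<notin> B1" if "b \<in> B2" for b using that by blast
  define B where "B = B1 \<union> l ` B2"
  have split: "(\<Sum>b\<in>B. cscale (c b) b) = (\<Sum>b\<in>B1. cscale (c b) b) + (\<Sum>b\<in>B2. cscale (c (l b)) (l b))" for c
    unfolding B_def using fin disj by (subst sum.union_disjoint) (auto simp: sum.reindex[OF l_inj])
  define c1 where "c1 u = (THE c. coords_mod {0} B1 u c)" for u
  define c2 where "c2 u = (THE c. coords_mod {0} B2 u c)" for u
  have c1: "coords_mod {0} B1 u (c1 u)" if "u \<in> ?K" for u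
    unfolding c1_def by (rule coords_mod_the[OF B1 that])
  have c2: "coords_mod {0} B2 u (c2 u)" if "u \<in> f ` U" for u
    unfolding c2_def by (rule coords_mod_the[OF B2 that])
  define res where "res u = u - (\<Sum>b\<in>B2. cscale (c2 (f u) b) (l b))" for u
  have res: "res u \<in> ?K" if "u \<in> U" for u
  proof -
    have "(\<Sum>b\<in>B2. cscale (c2 (f u) b) (l b)) \<in> U"
      by (intro free.subspace_sum[OF T.subspace_U] free.subspace_scale[OF T.subspace_U]) (use l in auto)
    moreover have "f (res u) = f u - (\<Sum>b\<in>B2. cscale (c2 (f u) b) b)"
      unfolding res_def using l by (simp add: f_diff f_sum2 f_scale)
    moreover have "\<dots> = 0" using c2[of "f u"] that by (simp add: coords_mod_def)
    ultimately show ?thesis using that T.subspace_U unfolding res_def by (simp add: free.subspace_diff)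
  qed
  define cc where "cc u b = (if b \<in> B1 then c1 (res u) b else if b \<in> l ` B2 then c2 (f u) (f b) else 0)" for u b
  have cc: "coords_mod {0} B u (cc u)" if u: "u \<in> U" for u
  proof -
    have "(\<Sum>b\<in>B. cscale (cc u b) b) = (\<Sum>b\<in>B1. cscale (c1 (res u) b) b) + (\<Sum>b\<in>B2. cscale (c2 (f u) b) (l b))"
      unfolding split using ni l by (auto simp: cc_def intro!: sum.cong arg_cong2[where f="(+)"])
    also have "(\<Sum>b\<in>B1. cscale (c1 (res u) b) b) = res u"
      using c1[OF res[OF u]] by (simp add: coords_mod_def)
    finally show ?thesis by (auto simp: coords_mod_def res_def cc_def B_def)
  qed
  have uniq: "c = d" if u: "u \<in> U" and c: "coords_mod {0} B u c" and d: "coords_mod {0} B u d" for u c d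
  proof -
    have c2eq: "coords_mod {0} B2 (f u) (\<lambda>b. if b \<in> B2 then c (l b) else 0)" if "coords_mod {0} B u c" for c
    proof -
      have "u = (\<Sum>b\<in>B1. cscale (c b) b) + (\<Sum>b\<in>B2. cscale (c (l b)) (l b))"
        using that by (simp add: coords_mod_def split)
      from arg_cong[OF this, of f]
      have "f u = (\<Sum>b\<in>B1. cscale (c b) (f b)) + (\<Sum>b\<in>B2. cscale (c (l b)) (f (l b)))"
        by (simp only: f_add f_sum f_sum2 f_scale)
      moreover have "(\<Sum>b\<in>B1. cscale (c b) (f b)) = 0" using sub by (intro sum.neutral) auto
      moreover have "(\<Sum>b\<in>B2. cscale (c (l b)) (f (l b))) = (\<Sum>b\<in>B2. cscale (c (l b)) b)"
        using l by (intro sum.cong) auto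
      ultimately show ?thesis by (simp add: coords_mod_def)
    qed
    have "(\<lambda>b. if b \<in> B2 then c (l b) else 0) = (\<lambda>b. if b \<in> B2 then d (l b) else 0)"
      by (rule basis_mod_coords_unique[OF B2 _ c2eq[OF c] c2eq[OF d]]) (use u in auto)
    then have eq2: "c (l b) = d (l b)" if "b \<in> B2" for b using that by (metis)
    define v where "v = u - (\<Sum>b\<in>B2. cscale (c (l b)) (l b))"
    have vc: "v = (\<Sum>b\<in>B1. cscale (c b) b)" and vd: "v = (\<Sum>b\<in>B1. cscale (d b) b)"
      using c d eq2 by (simp_all add: coords_mod_def split v_def)
    have "v \<in> ?K" unfolding vc
      by (intro free.subspace_sum[OF K.subspace_U] free.subspace_scale[OF K.subspace_U]) (use sub in auto)
    moreover have "coords_mod {0} B1 v (\<lambda>b. if b \<in> B1 then c b else 0)" by (simp add: coords_mod_def vc)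
    moreover have "coords_mod {0} B1 v (\<lambda>b. if b \<in> B1 then d b else 0)" by (simp add: coords_mod_def vd)
    ultimately have "(\<lambda>b. if b \<in> B1 then c b else 0) = (\<lambda>b. if b \<in> B1 then d b else 0)"
      using basis_mod_coords_unique[OF B1] by blast
    then have "c b = d b" if "b \<in> B1" for b using that by (metis)
    then have "c b = d b" for b
      using eq2 c d unfolding coords_mod_def B_def by (cases "b \<in> B1"; cases "b \<in> l ` B2") auto
    then show ?thesis by blast
  qed
  have "B \<subseteq> U" using sub l by (auto simp: B_def)
  then have B: "basis_mod U {0} B" unfolding basis_mod_def using fin cc uniq by (auto simp: B_def)
  have "trace_mod U {0} T = (\<Sum>b\<in>B. cc (T b) b)"
    by (rule T.trace_mod_eq[OF B cc]) (use \<open>B \<subseteq> U\<close> T.T_U in auto)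
  also have "\<dots> = (\<Sum>b\<in>B1. cc (T b) b) + (\<Sum>b\<in>B2. cc (T (l b)) (l b))"
    unfolding B_def using fin disj by (subst sum.union_disjoint) (auto simp: sum.reindex[OF l_inj])
  also have "(\<Sum>b\<in>B1. cc (T b) b) = (\<Sum>b\<in>B1. c1 (T b) b)"
  proof (rule sum.cong)
    fix b assume b: "b \<in> B1"
    then have "f (T b) = 0" using sub K.T_U by auto
    moreover have "c2 0 = (\<lambda>_. 0)"
      unfolding c2_def by (rule the_coords_mod[OF B2]) (use f0 T.subspace_U in \<open>auto simp: coords_mod_def free.subspace_def image_iff intro!: bexI[of _ 0]\<close>)
    ultimately show "cc (T b) b = c1 (T b) b" using b by (simp add: cc_def res_def)
  qed simp
  also have "\<dots> = trace_mod ?K {0} T"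
    by (rule K.trace_mod_eq[OF B1 c1, symmetric]) (use sub K.T_U in auto)
  also have "(\<Sum>b\<in>B2. cc (T (l b)) (l b)) = (\<Sum>b\<in>B2. c2 (T' b) b)"
  proof (rule sum.cong)
    fix b assume b: "b \<in> B2"
    then have "l b \<notin> B1" using disj by auto
    then show "cc (T (l b)) (l b) = c2 (T' b) b" using b l comm by (simp add: cc_def)
  qed simp
  also have "\<dots> = trace_mod (f ` U) {0} T'"
    by (rule T'.trace_mod_eq[OF B2 c2, symmetric]) (use sub T'.T_U in auto)
  finally show ?thesis .
qed

lemma trace_permuted_basis:
  assumes A: "finite A" and p: "\<And>x. x \<in> A \<Longrightarrow> p x \<in> A"
  shows "quotient_endo {c. keys c \<subseteq> A} {0} (lin_ext (\<lambda>x. single (p x) 1))"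
    and "trace_mod {c. keys c \<subseteq> A} {0} (lin_ext (\<lambda>x. single (p x) 1)) = of_nat (card {x \<in> A. p x = x})"
proof -
  let ?U = "{c :: 'a \<Rightarrow>\<^sub>0 complex. keys c \<subseteq> A}"
  let ?T = "lin_ext (\<lambda>x. single (p x) (1::complex))"
  show q: "quotient_endo ?U {0} ?T"
  proof
    show "free.subspace ?U" unfolding free.subspace_def
    proof (intro conjI ballI allI)
      fix x y z assume "x \<in> ?U" "y \<in> ?U"
      then show "x + y \<in> ?U" "cscale z x \<in> ?U" using Poly_Mapping.keys_add[of x y] by (auto simp: in_keys_iff)
    qed simp
    show "?T x \<in> ?U" if "x \<in> ?U" for x
    proof -
      have "keys (?T x) \<subseteq> (\<Union>v\<in>keys x. keys (cscale (lookup x v) (single (p v) 1)))"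
        unfolding lin_ext_def by (rule Poly_Mapping.keys_sum)
      also have "\<dots> \<subseteq> A" using that p by (auto simp: single_conv_cscale[symmetric] split: if_splits)
      finally show ?thesis by simp
    qed
  qed (auto simp: subspace_zero_set lin_ext_add lin_ext_cscale)
  interpret T: quotient_endo ?U "{0}" ?T by (rule q)
  define b where "b x = single x (1::complex)" for x :: 'a
  have inj: "inj_on b A" unfolding b_def by (auto simp: inj_on_def) (metis keys_single singleton_inject zero_neq_one)
  define cf where "cf u y = (if y \<in> b ` A then lookup u (the_inv_into A b y) else 0)" for u :: "'a \<Rightarrow>\<^sub>0 complex" and y
  have cfb: "cf u (b x) = lookup u x" if "x \<in> A" for u x
    using that by (simp add: cf_def the_inv_into_f_f[OF inj])
  have sb: "(\<Sum>y\<in>b ` A. cscale (c y) y) = (\<Sum>x\<in>A. single x (c (b x)))" for c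
    unfolding sum.reindex[OF inj] by (simp add: b_def single_conv_cscale[symmetric])
  have eq: "u = (\<Sum>x\<in>A. single x (c x)) \<longleftrightarrow> (\<forall>x\<in>A. lookup u x = c x)"
    if "u \<in> ?U" for u and c :: "'a \<Rightarrow> complex"
  proof -
    have l: "lookup (\<Sum>x\<in>A. single x (c x)) y = (if y \<in> A then c y else 0)" for y
      using A by (simp add: Poly_Mapping.lookup_sum Poly_Mapping.lookup_single when_def)
    have z: "lookup u y = 0" if "y \<notin> A" for y
      using \<open>u \<in> ?U\<close> that by (auto simp: in_keys_iff)
    show ?thesis
    proof
      assume "u = (\<Sum>x\<in>A. single x (c x))"
      then show "\<forall>x\<in>A. lookup u x = c x" using l by simp
    next
      assume a: "\<forall>x\<in>A. lookup u x = c x"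
      show "u = (\<Sum>x\<in>A. single x (c x))"
        by (rule poly_mapping_eqI) (use a l z in \<open>simp\<close>)
    qed
  qed
  have coords: "coords_mod {0} (b ` A) u (cf u)" if "u \<in> ?U" for u
    unfolding coords_mod_def sb using eq[OF that, of "\<lambda>x. cf u (b x)"] by (simp add: cfb) (simp add: cf_def)
  have basis: "basis_mod ?U {0} (b ` A)" unfolding basis_mod_def
  proof (intro conjI ballI)
    show "finite (b ` A)" using A by simp
    show "b ` A \<subseteq> ?U" by (auto simp: b_def)
    fix u assume u: "u \<in> ?U"
    show "\<exists>!c. coords_mod {0} (b ` A) u c"
    proof (rule ex1I[of _ "cf u"])
      show "coords_mod {0} (b ` A) u (cf u)" by (rule coords[OF u])
      fix c assume c: "coords_mod {0} (b ` A) u c"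
      then have "\<forall>x\<in>A. lookup u x = c (b x)"
        using eq[OF u, of "\<lambda>x. c (b x)"] by (simp add: coords_mod_def sb)
      then show "c = cf u" using c by (auto simp: coords_mod_def cf_def fun_eq_iff the_inv_into_f_f[OF inj])
    qed
  qed
  have "trace_mod ?U {0} ?T = (\<Sum>y\<in>b ` A. cf (?T y) y)"
    by (rule T.trace_mod_eq[OF basis coords]) (use T.T_U basis in \<open>auto simp: basis_mod_def\<close>)
  also have "\<dots> = (\<Sum>x\<in>A. lookup (?T (b x)) x)" by (simp add: sum.reindex[OF inj] cfb)
  also have "\<dots> = (\<Sum>x\<in>A. if p x = x then 1 else 0)"
    by (intro sum.cong refl) (auto simp: b_def lin_ext_single single_conv_cscale[symmetric] Poly_Mapping.lookup_single when_def)
  also have "\<dots> = of_nat (card {x \<in> A. p x = x})" using A by (simp add: sum.If_cases Int_def)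
  finally show "trace_mod ?U {0} ?T = of_nat (card {x \<in> A. p x = x})" .
qed

text \<open>The matrices of \<open>T g\<close> in a fixed basis multiply as the group does; inverses in \<open>G\<close> make them invertible.\<close>
lemma genuine_trace:
  fixes G :: "('g, 'm) monoid_scheme" and T :: "'g \<Rightarrow> ('b \<Rightarrow>\<^sub>0 complex) \<Rightarrow> ('b \<Rightarrow>\<^sub>0 complex)"
  assumes G: "Group.group G" and T: "\<And>g. g \<in> carrier G \<Longrightarrow> quotient_endo U {0} (T g)"
    and T_mult: "\<And>g h u. g \<in> carrier G \<Longrightarrow> h \<in> carrier G \<Longrightarrow> u \<in> U \<Longrightarrow> T (g \<otimes>\<^bsub>G\<^esub> h) u = T g (T h u)"
    and T_one: "\<And>u. u \<in> U \<Longrightarrow> T \<one>\<^bsub>G\<^esub> u = u"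
    and B: "basis_mod U {0} B"
  shows "genuine G (\<lambda>g. if g \<in> carrier G then trace_mod U {0} (T g) else 0)"
proof -
  interpret G: Group.group G by (rule G)
  have finB: "finite B" and BU: "B \<subseteq> U" using B by (auto simp: basis_mod_def)
  define d where "d = card B"
  obtain f where f: "bij_betw f {..<d} B"
    using ex_bij_betw_nat_finite[OF finB] by (auto simp: d_def atLeast0LessThan)
  have fB: "f i \<in> B" if "i < d" for i using f that by (auto simp: bij_betw_def)
  have fU: "f i \<in> U" if "i < d" for i using fB[OF that] BU by auto
  have finj: "f i = f j \<longleftrightarrow> i = j" if "i < d" "j < d" for i j
    using f that by (auto simp: bij_betw_def inj_on_def)
  define c where "c u = (THE c. coords_mod {0} B u c)" for u
  have c: "coords_mod {0} B u (c u)" if "u \<in> U" for u unfolding c_def by (rule coords_mod_the[OF B that])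
  have sumB: "(\<Sum>b\<in>B. h b) = (\<Sum>i<d. h (f i))" for h :: "_ \<Rightarrow> 'z :: comm_monoid_add"
    using sum.reindex_bij_betw[OF f, of h] by simp
  have TU: "T g u \<in> U" if "g \<in> carrier G" "u \<in> U" for g u using quotient_endo.T_U[OF T[OF that(1)]] that by blast
  define \<rho> where "\<rho> g = Matrix.mat d d (\<lambda>(i, j). c (T g (f j)) (f i))" for g
  have \<rho>_carrier: "\<rho> g \<in> carrier_mat d d" for g by (simp add: \<rho>_def)
  have ex: "T g (f j) = (\<Sum>k<d. cscale (c (T g (f j)) (f k)) (f k))" if "g \<in> carrier G" "j < d" for g j
    using c[OF TU[OF that(1), of "f j"]] fB[OF that(2)] BU by (auto simp: coords_mod_def sumB)
  have mult: "\<rho> (g \<otimes>\<^bsub>G\<^esub> h) = \<rho> g * \<rho> h" if gh: "g \<in> carrier G" "h \<in> carrier G" for g h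
  proof (rule eq_matI)
    interpret Tg: quotient_endo U "{0}" "T g" by (rule T[OF gh(1)])
    fix i j assume "i < dim_row (\<rho> g * \<rho> h)" "j < dim_col (\<rho> g * \<rho> h)"
    then have ij: "i < d" "j < d" by (simp_all add: \<rho>_def)
    have fj: "f j \<in> U" using fB[OF ij(2)] BU by auto
    have "T (g \<otimes>\<^bsub>G\<^esub> h) (f j) = T g (T h (f j))" by (rule T_mult[OF gh fj])
    also have "\<dots> = (\<Sum>k<d. cscale (c (T h (f j)) (f k)) (T g (f k)))"
      by (subst ex[OF gh(2) ij(2)]) (simp add: Tg.T_sum Tg.T_scale)
    finally have e: "T (g \<otimes>\<^bsub>G\<^esub> h) (f j) = (\<Sum>k<d. cscale (c (T h (f j)) (f k)) (T g (f k)))" .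
    have "coords_mod {0} B (T (g \<otimes>\<^bsub>G\<^esub> h) (f j)) (\<lambda>b. \<Sum>k<d. c (T h (f j)) (f k) * c (T g (f k)) b)"
      unfolding e by (rule coords_mod_sum[OF subspace_zero_set]) (use c TU gh fU in auto)
    then have "c (T (g \<otimes>\<^bsub>G\<^esub> h) (f j)) = (\<lambda>b. \<Sum>k<d. c (T h (f j)) (f k) * c (T g (f k)) b)"
      unfolding c_def by (intro the_coords_mod[OF B TU]) (use gh fj in auto)
    then show "\<rho> (g \<otimes>\<^bsub>G\<^esub> h) $$ (i, j) = (\<rho> g * \<rho> h) $$ (i, j)"
      using ij by (simp add: \<rho>_def scalar_prod_def atLeast0LessThan mult.commute)
  qed (simp_all add: \<rho>_def)
  have one: "\<rho> \<one>\<^bsub>G\<^esub> = 1\<^sub>m d"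
  proof (rule eq_matI)
    fix i j assume "i < dim_row (1\<^sub>m d :: complex mat)" "j < dim_col (1\<^sub>m d :: complex mat)"
    then have ij: "i < d" "j < d" by simp_all
    have fj: "f j \<in> U" using fB[OF ij(2)] BU by auto
    have "coords_mod {0} B (f j) (\<lambda>b. if b = f j then 1 else 0)"
      using fB[OF ij(2)] finB by (auto simp: coords_mod_def if_distrib[of "\<lambda>z. cscale z _"] cong: if_cong)
    then have "c (f j) = (\<lambda>b. if b = f j then 1 else 0)" unfolding c_def by (rule the_coords_mod[OF B fj])
    then show "\<rho> \<one>\<^bsub>G\<^esub> $$ (i, j) = 1\<^sub>m d $$ (i, j)"
      using ij T_one[OF fj] finj by (auto simp: \<rho>_def)
  qed (simp_all add: \<rho>_def)
  have unit: "\<rho> g \<in> Units (ring_mat TYPE(complex) d ())" if g: "g \<in> carrier G" for g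
    unfolding Units_def ring_mat_def
    using mult[OF g G.inv_closed[OF g]] mult[OF G.inv_closed[OF g] g] one \<rho>_carrier g
    by (auto intro!: bexI[of _ "\<rho> (inv\<^bsub>G\<^esub> g)"])
  have hom: "\<rho> \<in> hom G (GL d)"
  proof (rule homI)
    show "\<rho> g \<in> carrier (GL d)" if "g \<in> carrier G" for g
      using unit[OF that] by (simp add: GL_def units_of_def)
    show "\<rho> (g \<otimes>\<^bsub>G\<^esub> h) = \<rho> g \<otimes>\<^bsub>GL d\<^esub> \<rho> h" if "g \<in> carrier G" "h \<in> carrier G" for g h
      using mult[OF that] by (simp add: GL_def units_of_def ring_mat_def)
  qed
  have tr: "trace_mod U {0} (T g) = (\<Sum>i<d. \<rho> g $$ (i, i))" if g: "g \<in> carrier G" for g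
  proof -
    have "trace_mod U {0} (T g) = (\<Sum>b\<in>B. c (T g b) b)"
      by (rule quotient_endo.trace_mod_eq[OF T[OF g] B c]) (use TU g BU in auto)
    then show ?thesis by (simp add: sumB \<rho>_def)
  qed
  show ?thesis unfolding genuine_def
    by (intro exI[of _ d] bexI[OF _ hom]) (auto simp: tr)
qed

text \<open>The zero-dimensional representation, whose only matrix is the empty one.\<close>
lemma genuine_zero: "genuine G 0"
proof -
  have "(\<lambda>_. 1\<^sub>m 0) \<in> hom G (GL 0)"
    by (rule homI) (auto simp: GL_def units_of_def Units_def ring_mat_def)
  then show ?thesis unfolding genuine_def
    by (intro exI[of _ 0] bexI[of _ "\<lambda>_. 1\<^sub>m 0"]) (auto simp: fun_eq_iff)
qed

section \<open>Extension of scalars and permuted rational bases\<close>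

text \<open>A rational vector space \<open>V\<close>, given by its operations, with a basis \<open>e\<close> and coordinates \<open>\<kappa>\<close>. Its
  complexification is a quotient of the free space on the whole of \<open>V\<close>; this is the setting in which that quotient is
  shown to have the images of \<open>e\<close> as a basis.\<close>
locale rational_basis =
  fixes V :: "'b set" and pl :: "'b \<Rightarrow> 'b \<Rightarrow> 'b" and sm :: "rat \<Rightarrow> 'b \<Rightarrow> 'b"
    and K :: "'k set" and e :: "'k \<Rightarrow> 'b" and \<kappa> :: "'b \<Rightarrow> 'k \<Rightarrow> rat"
  assumes finite_K: "finite K" and e_V: "k \<in> K \<Longrightarrow> e k \<in> V"
    and pl_V: "v \<in> V \<Longrightarrow> w \<in> V \<Longrightarrow> pl v w \<in> V" and sm_V: "v \<in> V \<Longrightarrow> sm q v \<in> V"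
    and \<kappa>_pl: "v \<in> V \<Longrightarrow> w \<in> V \<Longrightarrow> k \<in> K \<Longrightarrow> \<kappa> (pl v w) k = \<kappa> v k + \<kappa> w k"
    and \<kappa>_sm: "v \<in> V \<Longrightarrow> k \<in> K \<Longrightarrow> \<kappa> (sm q v) k = q * \<kappa> v k"
    and \<kappa>_e: "j \<in> K \<Longrightarrow> k \<in> K \<Longrightarrow> \<kappa> (e k) j = (if j = k then 1 else 0)"
    and \<kappa>_inj: "v \<in> V \<Longrightarrow> w \<in> V \<Longrightarrow> (\<And>k. k \<in> K \<Longrightarrow> \<kappa> v k = \<kappa> w k) \<Longrightarrow> v = w"
begin

definition U :: "('b \<Rightarrow>\<^sub>0 complex) set" where "U = {c. keys c \<subseteq> V}"

definition tensor_relations :: "('b \<Rightarrow>\<^sub>0 complex) set" where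
  "tensor_relations = {single (pl v w) 1 - single v 1 - single w 1 | v w. v \<in> V \<and> w \<in> V} \<union>
         {single (sm q v) 1 - single v (of_rat q) | q v. v \<in> V}"

abbreviation "W \<equiv> free.span tensor_relations"

lemma rel_add: "v \<in> V \<Longrightarrow> w \<in> V \<Longrightarrow> single (pl v w) 1 - single v 1 - single w 1 \<in> W"
  by (rule free.span_base) (auto simp: tensor_relations_def)

lemma rel_scale: "v \<in> V \<Longrightarrow> single (sm q v) 1 - single v (of_rat q) \<in> W"
  by (rule free.span_base) (auto simp: tensor_relations_def)

text \<open>The \<open>k\<close>-th coordinate extended linearly to formal combinations of vectors; it vanishes on the relations of the
  tensor product and so gives the dual basis of the quotient.\<close>
definition \<phi> :: "'k \<Rightarrow> ('b \<Rightarrow>\<^sub>0 complex) \<Rightarrow> complex" where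
  "\<phi> k u = (\<Sum>v\<in>keys u. lookup u v * of_rat (\<kappa> v k))"

lemma \<phi>_superset: "finite A \<Longrightarrow> keys u \<subseteq> A \<Longrightarrow> \<phi> k u = (\<Sum>v\<in>A. lookup u v * of_rat (\<kappa> v k))"
  unfolding \<phi>_def by (rule sum.mono_neutral_left) (auto simp: in_keys_iff)

lemma \<phi>_add: "\<phi> k (u + v) = \<phi> k u + \<phi> k v"
proof -
  let ?A = "keys u \<union> keys v"
  have "keys (u + v) \<subseteq> ?A" by (rule Poly_Mapping.keys_add)
  then show ?thesis
    by (simp add: \<phi>_superset[of ?A] Poly_Mapping.lookup_add sum.distrib algebra_simps)
qed

lemma \<phi>_cscale: "\<phi> k (cscale z u) = z * \<phi> k u"
proof -
  have "keys (cscale z u) \<subseteq> keys u" by (auto simp: in_keys_iff)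
  then show ?thesis by (simp add: \<phi>_superset[of "keys u"] sum_distrib_left mult.assoc)
qed

lemma \<phi>_0: "\<phi> k 0 = 0" by (simp add: \<phi>_def)

lemma \<phi>_diff: "\<phi> k (u - v) = \<phi> k u - \<phi> k v"
  by (metis \<phi>_add add_diff_cancel_right' diff_add_cancel)

lemma \<phi>_single: "\<phi> k (single v z) = z * of_rat (\<kappa> v k)"
  by (simp add: \<phi>_superset[of "{v}"])

lemma \<phi>_sum: "\<phi> k (\<Sum>i\<in>I. f i) = (\<Sum>i\<in>I. \<phi> k (f i))"
  by (induction I rule: infinite_finite_induct) (auto simp: \<phi>_0 \<phi>_add)

lemma \<phi>_rel: assumes "k \<in> K" "w \<in> W" shows "\<phi> k w = 0"
  using assms(2)
proof (induction rule: free.span_induct_alt)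
  case base show ?case by (rule \<phi>_0)
next
  case (step c x y)
  have "\<phi> k x = 0" using step(1) assms(1)
    by (auto simp: tensor_relations_def \<phi>_diff \<phi>_single \<kappa>_pl \<kappa>_sm of_rat_add of_rat_mult)
  then show ?case using step by (simp add: \<phi>_add \<phi>_cscale)
qed

lemma e_inj: "inj_on e K"
  using \<kappa>_e by (metis inj_onI zero_neq_one)

definition b :: "'k \<Rightarrow> ('b \<Rightarrow>\<^sub>0 complex)" where "b k = single (e k) 1"

lemma b_inj: "inj_on b K"
  unfolding b_def using e_inj by (auto simp: inj_on_def) (metis keys_single singleton_inject zero_neq_one)

text \<open>Coordinates are removed one at a time: adding the multiple \<open>- \<kappa> v j\<close> of \<open>e j\<close> inside \<open>V\<close> changes the symbol
  of \<open>v\<close>, modulo the relations, by a multiple of the symbol of \<open>e j\<close>. A vector without nonzero coordinates is \<open>0\<close>, and its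
  symbol is killed by the relation for the scalar \<open>0\<close>.\<close>
lemma expand_single:
  assumes "finite J" "J \<subseteq> K" "v \<in> V" "\<And>k. k \<in> K - J \<Longrightarrow> \<kappa> v k = 0"
  shows "single v 1 - (\<Sum>k\<in>J. cscale (of_rat (\<kappa> v k)) (b k)) \<in> W"
  using assms
proof (induction J arbitrary: v rule: finite_induct)
  case (empty v)
  \<comment> \<open>a vector without coordinates is zero\<close>
  have "sm 0 v = v" by (rule \<kappa>_inj) (use empty in \<open>auto simp: sm_V \<kappa>_sm\<close>)
  then show ?case using rel_scale[of v 0] empty by simp
next
  case (insert j J v)
  define q where "q = - \<kappa> v j"
  \<comment> \<open>this vector has lost the coordinate \<open>j\<close>\<close>
  define v' where "v' = pl v (sm q (e j))"
  have j: "j \<in> K" "e j \<in> V" "sm q (e j) \<in> V" using insert e_V sm_V by auto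
  have v': "v' \<in> V" "\<And>k. k \<in> K \<Longrightarrow> \<kappa> v' k = (if k = j then 0 else \<kappa> v k)"
    using j insert.prems pl_V by (auto simp: v'_def \<kappa>_pl \<kappa>_sm \<kappa>_e q_def)
  have IH: "single v' 1 - (\<Sum>k\<in>J. cscale (of_rat (\<kappa> v' k)) (b k)) \<in> W"
    by (rule insert.IH) (use v' insert.prems in auto)
  have s: "(\<Sum>k\<in>J. cscale (of_rat (\<kappa> v' k)) (b k)) = (\<Sum>k\<in>J. cscale (of_rat (\<kappa> v k)) (b k))"
    using insert by (intro sum.cong) (auto simp: v'(2))
  have r1: "single v' 1 - single v 1 - single (sm q (e j)) 1 \<in> W"
    unfolding v'_def by (rule rel_add) (use insert.prems j in auto)
  have r2: "single (sm q (e j)) 1 - single (e j) (of_rat q) \<in> W"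
    by (rule rel_scale[OF j(2)])
  have bj: "cscale (of_rat (\<kappa> v j)) (b j) = - single (e j) (of_rat q)"
    unfolding b_def q_def by (simp add: single_conv_cscale[symmetric] single_uminus[symmetric] of_rat_minus)
  have "single v 1 - (\<Sum>k\<in>insert j J. cscale (of_rat (\<kappa> v k)) (b k)) =
     (single v' 1 - (\<Sum>k\<in>J. cscale (of_rat (\<kappa> v' k)) (b k)))
     - (single v' 1 - single v 1 - single (sm q (e j)) 1)
     - (single (sm q (e j)) 1 - single (e j) (of_rat q))"
    unfolding s using insert by (simp add: bj)
  also have "\<dots> \<in> W" by (intro free.span_diff IH r1 r2)
  finally show ?case .
qed

lemma expand: assumes u: "u \<in> U" shows "u - (\<Sum>k\<in>K. cscale (\<phi> k u) (b k)) \<in> W"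
proof -
  let ?S = "keys u"
  have 1: "u = (\<Sum>v\<in>?S. cscale (lookup u v) (single v 1))"
    by (subst sum_single_keys[of u, symmetric]) (simp add: single_conv_cscale[symmetric])
  have "(\<Sum>k\<in>K. cscale (\<phi> k u) (b k)) = (\<Sum>k\<in>K. \<Sum>v\<in>?S. cscale (lookup u v) (cscale (of_rat (\<kappa> v k)) (b k)))"
    by (simp add: \<phi>_def free.scale_sum_left)
  also have "\<dots> = (\<Sum>v\<in>?S. cscale (lookup u v) (\<Sum>k\<in>K. cscale (of_rat (\<kappa> v k)) (b k)))"
    by (subst sum.swap) (simp add: free.scale_sum_right)
  finally have "u - (\<Sum>k\<in>K. cscale (\<phi> k u) (b k)) =
    (\<Sum>v\<in>?S. cscale (lookup u v) (single v 1 - (\<Sum>k\<in>K. cscale (of_rat (\<kappa> v k)) (b k))))"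
    by (subst (1) 1) (simp add: free.scale_right_diff_distrib sum_subtractf)
  also have "\<dots> \<in> W"
    by (intro free.span_sum free.span_scale expand_single) (use u finite_K in \<open>auto simp: U_def\<close>)
  finally show ?thesis .
qed

definition coord_fun :: "('b \<Rightarrow>\<^sub>0 complex) \<Rightarrow> ('b \<Rightarrow>\<^sub>0 complex) \<Rightarrow> complex" where
  "coord_fun u x = (if x \<in> b ` K then \<phi> (the_inv_into K b x) u else 0)"

lemma coord_fun_b: "k \<in> K \<Longrightarrow> coord_fun u (b k) = \<phi> k u"
  by (simp add: coord_fun_def the_inv_into_f_f[OF b_inj])

lemma sum_b: "(\<Sum>x\<in>b ` K. f x) = (\<Sum>k\<in>K. f (b k))"
  by (simp add: sum.reindex[OF b_inj])

lemma \<phi>_b: "j \<in> K \<Longrightarrow> k \<in> K \<Longrightarrow> \<phi> k (b j) = (if j = k then 1 else 0)"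
  by (simp add: b_def \<phi>_single \<kappa>_e)

lemma coords: "u \<in> U \<Longrightarrow> coords_mod W (b ` K) u (coord_fun u)"
  unfolding coords_mod_def sum_b using expand by (simp add: coord_fun_b) (simp add: coord_fun_def)

lemma basis: "basis_mod U W (b ` K)"
  unfolding basis_mod_def
proof (intro conjI ballI)
  show "finite (b ` K)" using finite_K by simp
  show "b ` K \<subseteq> U" using e_V by (auto simp: b_def U_def)
  fix u assume u: "u \<in> U"
  show "\<exists>!c. coords_mod W (b ` K) u c"
  proof (rule ex1I[of _ "coord_fun u"])
    show "coords_mod W (b ` K) u (coord_fun u)" by (rule coords[OF u])
    fix c assume c: "coords_mod W (b ` K) u c"
    have "c (b k) = coord_fun u (b k)" if k: "k \<in> K" for k
    proof -
      have "\<phi> k (u - (\<Sum>j\<in>K. cscale (c (b j)) (b j))) = 0"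
        by (rule \<phi>_rel[OF k]) (use c in \<open>simp add: coords_mod_def sum_b\<close>)
      then have "\<phi> k u = (\<Sum>j\<in>K. c (b j) * (if j = k then 1 else 0))"
        using k by (simp add: \<phi>_diff \<phi>_sum \<phi>_cscale \<phi>_b)
      also have "\<dots> = (\<Sum>j\<in>K. if j = k then c (b j) else 0)" by (intro sum.cong) auto
      finally show ?thesis using k finite_K by (simp add: coord_fun_b)
    qed
    then show "c = coord_fun u" using c by (auto simp: coords_mod_def coord_fun_def fun_eq_iff)
  qed
qed

text \<open>In the basis formed by the symbols of \<open>e\<close> the map has a permutation matrix.\<close>
lemma trace_permutation:
  assumes a_V: "\<And>v. v \<in> V \<Longrightarrow> a v \<in> V" and a_pl: "\<And>v w. v \<in> V \<Longrightarrow> w \<in> V \<Longrightarrow> a (pl v w) = pl (a v) (a w)"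
    and a_sm: "\<And>q v. v \<in> V \<Longrightarrow> a (sm q v) = sm q (a v)" and a_e: "\<And>k. k \<in> K \<Longrightarrow> a (e k) = e (p k)"
    and p_K: "\<And>k. k \<in> K \<Longrightarrow> p k \<in> K"
  shows "trace_mod U W (lin_ext (\<lambda>v. single (a v) 1)) = of_nat (card {k \<in> K. p k = k})"
proof -
  define T where "T = lin_ext (\<lambda>v. single (a v) (1::complex))"
  have Ts: "T (single v z) = single (a v) z" for v z
    unfolding T_def lin_ext_single by (simp add: single_conv_cscale[symmetric])
  interpret T: quotient_endo U W T
  proof
    show "free.subspace U" unfolding free.subspace_def U_def
    proof (intro conjI ballI allI)
      fix x y z assume "x \<in> {c :: 'b \<Rightarrow>\<^sub>0 complex. keys c \<subseteq> V}" "y \<in> {c :: 'b \<Rightarrow>\<^sub>0 complex. keys c \<subseteq> V}"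
      then show "x + y \<in> {c. keys c \<subseteq> V}" "cscale z x \<in> {c. keys c \<subseteq> V}"
        using Poly_Mapping.keys_add[of x y] by (auto simp: in_keys_iff)
    qed simp
    show "free.subspace W" by (rule free.subspace_span)
    show T_add: "T (x + y) = T x + T y" for x y by (simp add: T_def lin_ext_add)
    show T_scale: "T (cscale z x) = cscale z (T x)" for z x by (simp add: T_def lin_ext_cscale)
    show "T x \<in> U" if "x \<in> U" for x
    proof -
      have "keys (T x) \<subseteq> (\<Union>v\<in>keys x. keys (cscale (lookup x v) (single (a v) 1)))"
        unfolding T_def lin_ext_def by (rule Poly_Mapping.keys_sum)
      also have "\<dots> \<subseteq> V" using that a_V by (auto simp: U_def single_conv_cscale[symmetric] split: if_splits)
      finally show ?thesis by (simp add: U_def)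
    qed
    show "T x \<in> W" if "x \<in> W" for x using that
    proof (induction rule: free.span_induct_alt)
      case base show ?case by (simp add: T_def free.span_zero)
    next
      case (step c x y)
      have "T x \<in> W" using step(1)[unfolded tensor_relations_def]
      proof (elim UnE CollectE exE conjE)
        fix v w assume "x = single (pl v w) 1 - single v 1 - single w 1" "v \<in> V" "w \<in> V"
        then show ?thesis using rel_add[of "a v" "a w"] a_V by (simp add: T_def lin_ext_diff) (simp add: T_def[symmetric] Ts a_pl)
      next
        fix q v assume "x = single (sm q v) 1 - single v (of_rat q)" "v \<in> V"
        then show ?thesis using rel_scale[of "a v" q] a_V by (simp add: T_def lin_ext_diff) (simp add: T_def[symmetric] Ts a_sm)
      qed
      then show ?case using step by (simp add: T_add T_scale free.span_add free.span_scale)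
    qed
  qed
  have Tb: "T (b k) = b (p k)" if "k \<in> K" for k using that by (simp add: b_def Ts a_e)
  have "trace_mod U W T = (\<Sum>x\<in>b ` K. coord_fun (T x) x)"
    by (rule T.trace_mod_eq[OF basis coords]) (use T.T_U basis in \<open>auto simp: basis_mod_def\<close>)
  also have "\<dots> = (\<Sum>k\<in>K. \<phi> k (b (p k)))"
    unfolding sum_b by (intro sum.cong refl) (simp add: coord_fun_b Tb)
  also have "\<dots> = (\<Sum>k\<in>K. if p k = k then 1 else 0)"
    by (intro sum.cong refl) (simp add: \<phi>_b p_K)
  also have "\<dots> = of_nat (card {k \<in> K. p k = k})"
    using finite_K by (simp add: sum.If_cases Int_def)
  finally show ?thesis by (simp add: T_def)
qed

end

section \<open>Rank-selected chains and greedy words\<close>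

lemma sorted_psubset_list_unique:
  fixes xs ys :: "'a::order list"
  assumes "sorted_wrt (<) xs" "sorted_wrt (<) ys" "set xs = set ys"
  shows "xs = ys"
  using assms
proof (induction xs arbitrary: ys)
  case Nil then show ?case by simp
next
  case (Cons x xs)
  then obtain y ys' where ys: "ys = y # ys'" by (cases ys) auto
  have "x = y"
  proof (rule ccontr)
    assume "x \<noteq> y"
    then have "x \<in> set ys'" "y \<in> set xs" using Cons.prems ys by auto
    then have "y < x" "x < y" using Cons.prems ys by auto
    then show False by simp
  qed
  moreover have "x \<notin> set xs" "y \<notin> set ys'" using Cons.prems ys by auto
  ultimately have "set xs = set ys'" using Cons.prems(3) ys by (metis insert_ident list.simps(15))
  then show ?case using Cons.IH[of ys'] Cons.prems ys \<open>x = y\<close> by simp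
qed

text \<open>The linear order on the ground set supplies the edge labels.\<close>
locale ordered_loopless_matroid = loopless_matroid M for M :: "'a::linorder matroid"
begin

text \<open>The first argument is the number of steps, which makes the recursion structural; from \<open>x\<close> to \<open>y\<close> it is
  \<open>rk y - rk x\<close>.\<close>
primrec greedy :: "nat \<Rightarrow> 'a set \<Rightarrow> 'a set \<Rightarrow> 'a list" where
  "greedy 0 x y = []"
| "greedy (Suc n) x y = Min (y - x) # greedy n (cl (insert (Min (y - x)) x)) y"

text \<open>The labels along the lexicographically first maximal chain from \<open>x\<close> to \<open>y\<close>, where the label of a cover
  is the least element that it adds.\<close>
definition greedy_word :: "'a set \<Rightarrow> 'a set \<Rightarrow> 'a list" where
  "greedy_word x y = greedy (rk y - rk x) x y"

lemma length_greedy_word [simp]: "length (greedy_word x y) = rk y - rk x"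
proof -
  have "length (greedy n x y) = n" for n by (induction n arbitrary: x) auto
  then show ?thesis by (simp add: greedy_word_def)
qed

lemma greedy_word_step:
  assumes "x \<in> L" "y \<in> L" "x \<subset> y"
  defines "a \<equiv> Min (y - x)"
  defines "x' \<equiv> cl (insert a x)"
  shows "greedy_word x y = a # greedy_word x' y" "a \<in> y - x" "x' \<in> L" "x' \<subseteq> y" "rk x' = Suc (rk x)" "x \<subseteq> x'" "a \<in> x'"
    "\<And>b. b \<in> y - x \<Longrightarrow> a \<le> b"
proof -
  have f: "finite (y - x)" "y - x \<noteq> {}" using assms finite_flat by auto
  show a: "a \<in> y - x" unfolding a_def using f by (rule Min_in)
  show "\<And>b. b \<in> y - x \<Longrightarrow> a \<le> b" unfolding a_def using f by simp
  have s: "insert a x \<subseteq> E" using a assms flat_sub_E by auto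
  show "x' \<in> L" unfolding x'_def by (rule cl_flat[OF s])
  show "x' \<subseteq> y" unfolding x'_def by (rule cl_minimal) (use a assms in auto)
  show r: "rk x' = Suc (rk x)" unfolding x'_def by (rule rank_cl_insert) (use a s assms in auto)
  show "x \<subseteq> x'" "a \<in> x'" using subset_cl[OF s] by (auto simp: x'_def)
  have "rk x < rk y" using flat_rank_less assms by auto
  then have "rk y - rk x = Suc (rk y - rk x')" using r by auto
  then show "greedy_word x y = a # greedy_word x' y" by (simp add: greedy_word_def a_def x'_def)
qed

lemma greedy_word_refl [simp]: "greedy_word x x = []" by (simp add: greedy_word_def)

lemma greedy_induct [consumes 3, case_names refl step]:
  assumes "x \<in> L" "y \<in> L" "x \<subseteq> y"
  assumes "P y"
  assumes "\<And>x x' a. \<lbrakk>x \<in> L; x \<subset> y; greedy_word x y = a # greedy_word x' y; a \<in> y - x; x' = cl (insert a x); x' \<in> L; x' \<subseteq> y;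
     rk x' = Suc (rk x); x \<subseteq> x'; a \<in> x'; \<And>b. b \<in> y - x \<Longrightarrow> a \<le> b; P x'\<rbrakk> \<Longrightarrow> P x"
  shows "P x"
  using assms(1,3)
proof (induction "rk y - rk x" arbitrary: x rule: less_induct)
  case less
  show ?case
  proof (cases "x = y")
    case True then show ?thesis using assms by simp
  next
    case False
    then have xy: "x \<subset> y" using less by auto
    note g = greedy_word_step[OF less(2) assms(2) xy]
    have "rk x < rk y" using flat_rank_less assms less xy by auto
    then have "P (cl (insert (Min (y - x)) x))" using less(1) g by auto
    then show ?thesis using assms(5)[OF less(2) xy g(1) g(2) refl g(3-8)] by auto
  qed
qed

lemma set_greedy_word:
  assumes "x \<in> L" "y \<in> L" "x \<subseteq> y"
  shows "set (greedy_word x y) \<subseteq> y - x"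
  using assms by (induction rule: greedy_induct) auto

lemma sorted_greedy_word:
  assumes "x \<in> L" "y \<in> L" "x \<subseteq> y"
  shows "sorted_wrt (<) (greedy_word x y)"
  using assms
proof (induction rule: greedy_induct)
  case (step x x' a)
  have "a < b" if "b \<in> set (greedy_word x' y)" for b
    using set_greedy_word[of x' y] assms(2) step that by (metis DiffD1 DiffD2 DiffI order_le_less subsetD)
  then show ?case using step by simp
qed simp

text \<open>The flats on the greedy chain: for them the words of the two halves concatenate to the word of the whole.\<close>
lemma greedy_word_split:
  assumes "x \<in> L" "z \<in> L" "x \<subseteq> z" "j \<le> rk z - rk x"
  shows "\<exists>y\<in>L. x \<subseteq> y \<and> y \<subseteq> z \<and> rk y = rk x + j \<and> greedy_word x z = greedy_word x y @ greedy_word y z"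
  using assms
proof (induction arbitrary: j rule: greedy_induct)
  case refl then show ?case using assms by auto
next
  case (step x x' a)
  show ?case
  proof (cases j)
    case 0 then show ?thesis using step by auto
  next
    case (Suc i)
    then obtain y where y: "y \<in> L" "x' \<subseteq> y" "y \<subseteq> z" "rk y = rk x' + i" "greedy_word x' z = greedy_word x' y @ greedy_word y z"
    proof -
      have "i \<le> rk z - rk x'" using step(8,13) Suc by linarith
      then show ?thesis using step(12)[of i] that by blast
    qed
    have "x \<subset> y" using step y by auto
    note g = greedy_word_step[OF step(1) y(1) this]
    have "Min (y - x) = a"
      by (rule antisym) (use g(2,8) step y in auto)
    then have "greedy_word x y = a # greedy_word x' y" using g(1) step(5) by simp
    then show ?thesis using y step Suc by (intro bexI[of _ y]) auto
  qed
qed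

text \<open>Restricting the order to the finite ground set makes it and its converse well-founded, so that both
  lexicographic extensions admit induction.\<close>
definition letter_less :: "('a \<times> 'a) set" where
  "letter_less = {(a, b). a \<in> E \<and> b \<in> E \<and> a < b}"

lemma wf_letter_less: "wf letter_less" "wf (letter_less\<inverse>)"
proof -
  have fin: "finite letter_less" by (rule finite_subset[of _ "E \<times> E"]) (use finite_E in \<open>auto simp: letter_less_def\<close>)
  have "trans letter_less" "irrefl letter_less" by (auto simp: letter_less_def trans_def irrefl_def)
  then have ac: "acyclic letter_less" by (simp add: acyclic_irrefl)
  show "wf letter_less" by (rule finite_acyclic_wf[OF fin ac])
  show "wf (letter_less\<inverse>)" by (rule finite_acyclic_wf_converse[OF fin ac])
qed

text \<open>The first label of the greedy chain to \<open>z\<close> is the least element of \<open>z - x\<close>, which is at most the least element of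
  \<open>y - x\<close>. If they agree, both chains continue from the same flat; otherwise the words already differ in the right way.\<close>
lemma greedy_word_lex:
  assumes "x \<in> L" "y \<in> L" "z \<in> L" "x \<subseteq> y" "y \<subseteq> z"
  shows "greedy_word x y @ greedy_word y z = greedy_word x z \<or> (greedy_word x z, greedy_word x y @ greedy_word y z) \<in> lex letter_less"
  using assms(1,2,4)
proof (induction rule: greedy_induct)
  case (step x x' b)
  have "x \<subset> z" using step assms by auto
  note g = greedy_word_step[OF step(1) assms(3) this]
  let ?a = "Min (z - x)"
  have le: "?a \<le> b" using g(8)[of b] step assms by auto
  show ?case
  proof (cases "?a = b")
    case True then show ?thesis using step g by auto
  next
    case False
    then have "(?a, b) \<in> letter_less" using le g(2) step(4) flat_sub_E assms by (auto simp: letter_less_def)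
    moreover have "length (greedy_word (cl (insert ?a x)) z) = length (greedy_word x' y @ greedy_word y z)"
      using g(5) step(7) rank_mono[OF step(7)] rank_mono[OF assms(5)] step(8) by simp
    ultimately show ?thesis using g(1) step(3) by simp
  qed
qed simp

text \<open>An increasing label word is the greedy one: the least element \<open>a\<close> of \<open>z - x\<close> must occur already in \<open>y\<close>, since
  otherwise the second half would start with a label at most \<open>a\<close>, below the end of the first half. So the first labels agree, and
  the argument repeats one step further.\<close>
lemma greedy_word_ascent:
  assumes "x \<in> L" "y \<in> L" "z \<in> L" "x \<subset> y" "y \<subset> z" "last (greedy_word x y) < hd (greedy_word y z)"
  shows "greedy_word x y @ greedy_word y z = greedy_word x z"
proof -
  have "x \<noteq> y \<longrightarrow> last (greedy_word x y) < hd (greedy_word y z) \<longrightarrow> greedy_word x y @ greedy_word y z = greedy_word x z"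
    using assms(1,2) assms(4)[THEN psubset_imp_subset]
  proof (induction rule: greedy_induct)
    case (step x x' b)
    show ?case
    proof (intro impI)
      assume lt: "last (greedy_word x y) < hd (greedy_word y z)"
      have xz: "x \<subset> z" using step assms by auto
      note g = greedy_word_step[OF step(1) assms(3) xz]
      note h = greedy_word_step[OF assms(2,3,5)]
      let ?a = "Min (z - x)"
      have ne: "greedy_word x y \<noteq> []" using step by auto
      have "sorted_wrt (<) (greedy_word x y)" using sorted_greedy_word step assms by blast
      then have bl: "b \<le> last (greedy_word x y)" using step(3) by (auto simp: order_le_less)
      have "?a \<in> y"
      proof (rule ccontr)
        assume "?a \<notin> y"
        then have "Min (z - y) \<le> ?a" using h(8) g(2) by auto
        also have "?a \<le> b" using g(8)[of b] step assms by auto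
        finally show False using bl lt h(1) by auto
      qed
      then have eq: "?a = b" using g(2) g(8)[of b] step(4) step(11)[of ?a] assms by (intro antisym) auto
      then have gz: "greedy_word x z = b # greedy_word x' z" using g(1) step(5) by simp
      show "greedy_word x y @ greedy_word y z = greedy_word x z"
      proof (cases "x' = y")
        case True then show ?thesis using gz step(3) by simp
      next
        case False
        then have "x' \<subset> y" using step by auto
        from greedy_word_step(1)[OF step(6) assms(2) this] have "greedy_word x' y \<noteq> []" by simp
        then show ?thesis using step(12) False lt gz step(3) by simp
      qed
    qed
  qed simp
  then show ?thesis using assms by auto
qed

lemma greedy_word_descent:
  assumes "x \<in> L" "y \<in> L" "z \<in> L" "x \<subset> y" "y \<subset> z" "greedy_word x y @ greedy_word y z = greedy_word x z"
  shows "last (greedy_word x y) < hd (greedy_word y z)"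
proof -
  have "sorted_wrt (<) (greedy_word x y @ greedy_word y z)" using sorted_greedy_word assms by auto
  moreover have "greedy_word x y \<noteq> []" "greedy_word y z \<noteq> []" using greedy_word_step(1) assms by auto
  ultimately show ?thesis by (auto simp: sorted_wrt_append)
qed

lemma cl_greedy_word:
  assumes "x \<in> L" "y \<in> L" "x \<subseteq> y"
  shows "cl (x \<union> set (greedy_word x y)) = y"
  using assms
proof (induction rule: greedy_induct)
  case refl then show ?case by (simp add: cl_of_flat assms)
next
  case (step x x' a)
  have sx: "set (greedy_word x y) \<subseteq> y - x" by (rule set_greedy_word[OF step(1) assms(2)]) (use step(2) in auto)
  have sE: "x \<union> set (greedy_word x y) \<subseteq> E" using step(2) sx flat_sub_E[OF assms(2)] by blast
  show ?case
  proof (rule subset_antisym)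
    show "cl (x \<union> set (greedy_word x y)) \<subseteq> y" by (rule cl_minimal) (use assms step sx in auto)
    have "x' \<subseteq> cl (x \<union> set (greedy_word x y))"
      unfolding step(5) by (rule cl_minimal[OF cl_flat[OF sE]]) (use subset_cl[OF sE] step(3) in auto)
    moreover have "set (greedy_word x' y) \<subseteq> cl (x \<union> set (greedy_word x y))" using subset_cl[OF sE] step(3) by auto
    ultimately have "cl (x' \<union> set (greedy_word x' y)) \<subseteq> cl (x \<union> set (greedy_word x y))"
      by (intro cl_minimal[OF cl_flat[OF sE]]) auto
    then show "y \<subseteq> cl (x \<union> set (greedy_word x y))" using step by simp
  qed
qed

end

context ordered_loopless_matroid
begin

text \<open>The label word of the maximal chain that refines the chain \<open>x, y\<^sub>1, y\<^sub>2, \<dots>\<close> greedily between its members.\<close>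
primrec path_word :: "'a set \<Rightarrow> 'a set list \<Rightarrow> 'a list" where
  "path_word x [] = []"
| "path_word x (y # c) = greedy_word x y @ path_word y c"

definition word :: "'a set list \<Rightarrow> 'a list" where "word c = path_word {} (c @ [E])"

lemma path_word_append: "path_word x (us @ vs) = path_word x us @ path_word (last (x # us)) vs"
  by (induction us arbitrary: x) auto

text \<open>A word determines the flats that it passes through, as closures of its initial segments.\<close>
lemma last_path_word_flat:
  assumes "set (x # us) \<subseteq> L" "sorted_wrt (<) (x # us)"
  shows "last (x # us) \<in> L" "x \<subseteq> last (x # us)" "length (path_word x us) = rk (last (x # us)) - rk x"
    "cl (x \<union> set (path_word x us)) = last (x # us)" "set (path_word x us) \<subseteq> last (x # us)"
proof -
  have "last (x # us) \<in> L \<and> x \<subseteq> last (x # us) \<and> length (path_word x us) = rk (last (x # us)) - rk x \<and>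
    cl (x \<union> set (path_word x us)) = last (x # us) \<and> set (path_word x us) \<subseteq> last (x # us)"
    using assms
  proof (induction us arbitrary: x)
    case Nil then show ?case by (simp add: cl_of_flat)
  next
    case (Cons y us)
    define z where "z = last (y # us)"
    have IH: "z \<in> L" "y \<subseteq> z" "length (path_word y us) = rk z - rk y" "cl (y \<union> set (path_word y us)) = z" "set (path_word y us) \<subseteq> z"
      using Cons by (auto simp: z_def)
    have xy: "x \<in> L" "y \<in> L" "x \<subseteq> y" using Cons.prems by auto
    have sg: "set (greedy_word x y) \<subseteq> y - x" by (rule set_greedy_word[OF xy])
    have len: "length (path_word x (y # us)) = rk z - rk x"
      using IH rank_mono[OF xy(3)] rank_mono[OF IH(2)] by simp
    have sE: "x \<union> set (path_word x (y # us)) \<subseteq> E" using IH sg xy flat_sub_E[OF IH(1)] by auto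
    have "cl (x \<union> set (path_word x (y # us))) = z"
    proof (rule subset_antisym)
      show "cl (x \<union> set (path_word x (y # us))) \<subseteq> z" by (rule cl_minimal) (use IH sg xy in auto)
      have "cl (x \<union> set (greedy_word x y)) \<subseteq> cl (x \<union> set (path_word x (y # us)))"
        by (rule cl_minimal[OF cl_flat[OF sE]]) (use subset_cl[OF sE] in auto)
      then have "cl (y \<union> set (path_word y us)) \<subseteq> cl (x \<union> set (path_word x (y # us)))"
        unfolding cl_greedy_word[OF xy] by (intro cl_minimal[OF cl_flat[OF sE]]) (use subset_cl[OF sE] in auto)
      then show "z \<subseteq> cl (x \<union> set (path_word x (y # us)))" using IH by simp
    qed
    moreover have "last (x # y # us) = z" by (simp add: z_def)
    moreover have "set (path_word x (y # us)) \<subseteq> z" using IH sg by auto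
    ultimately show ?case using IH xy len by simp
  qed
  then show "last (x # us) \<in> L" "x \<subseteq> last (x # us)" "length (path_word x us) = rk (last (x # us)) - rk x"
    "cl (x \<union> set (path_word x us)) = last (x # us)" "set (path_word x us) \<subseteq> last (x # us)" by auto
qed

definition proper_chain :: "'a set list \<Rightarrow> bool" where
  "proper_chain c \<longleftrightarrow> set c \<subseteq> L \<and> sorted_wrt (<) ({} # c @ [E])"

lemma proper_chain_remove:
  "proper_chain (us @ y # vs) \<Longrightarrow> proper_chain (us @ vs)"
  by (auto simp: proper_chain_def sorted_wrt_append)

text \<open>Inserting a flat between \<open>us\<close> and \<open>vs\<close> affects only the portion of the word between the neighbours \<open>p\<close> and \<open>q\<close>,
  which are the empty flat and the ground set at the ends of the chain.\<close>
lemma word_local: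
  assumes "proper_chain (us @ vs)"
  obtains p q P R where
    "p \<in> L" "q \<in> L" "p \<subset> q" "length P = rk p" "\<And>F. F \<in> set us \<Longrightarrow> F \<subseteq> p" "\<And>F. F \<in> set vs \<Longrightarrow> q \<subseteq> F"
    "p \<in> insert {} (set us)" "q \<in> insert E (set vs)"
    "word (us @ vs) = P @ greedy_word p q @ R"
    "\<And>y. word (us @ y # vs) = P @ greedy_word p y @ greedy_word y q @ R"
    "cl (set P) = p"
proof -
  define p where "p = last ({} # us)"
  define P where "P = path_word {} us"
  obtain q qs where q: "vs @ [E] = q # qs" by (cases "vs @ [E]") auto
  have c: "set us \<subseteq> L" "set vs \<subseteq> L" "sorted_wrt (<) (({} # us) @ (q # qs))"
    using assms unfolding proper_chain_def by (auto simp: q[symmetric])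
  have s1: "sorted_wrt (<) ({} # us)" using c(3) by (simp only: sorted_wrt_append)
  have s2: "set ({} # us) \<subseteq> L" using c empty_flat by auto
  note l = last_path_word_flat[OF s2 s1]
  have "set (q # qs) = insert E (set vs)" by (simp add: q[symmetric])
  then have qi: "q \<in> insert E (set vs)" "\<And>F. F \<in> set vs \<Longrightarrow> F \<in> set (q # qs)" by auto
  have pi: "p \<in> set ({} # us)" unfolding p_def by (rule last_in_set) simp
  have pq: "p \<subset> q" using c(3) pi unfolding sorted_wrt_append by auto
  show ?thesis
  proof (rule that[of p q P "path_word q qs"])
    show "p \<in> L" using l by (simp add: p_def)
    show "q \<in> L" using qi c E_flat by auto
    show "p \<subset> q" by (rule pq)
    show "length P = rk p" using l(3) by (simp add: p_def P_def rank_empty)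
    show "cl (set P) = p" using l(4) by (simp add: p_def P_def)
    show "F \<subseteq> p" if "F \<in> set us" for F
    proof -
      have "us \<noteq> []" using that by auto
      then obtain us' where us': "us = us' @ [p]" unfolding p_def by (metis append_butlast_last_id last_ConsR)
      then show ?thesis using that s1 by (auto simp: sorted_wrt_append)
    qed
    show "q \<subseteq> F" if "F \<in> set vs" for F
      using qi(2)[OF that] c(3) by (auto simp: sorted_wrt_append)
    show "p \<in> insert {} (set us)" using pi by simp
    show "q \<in> insert E (set vs)" by (rule qi(1))
    show "word (us @ vs) = P @ greedy_word p q @ path_word q qs"
      by (simp add: word_def path_word_append q P_def p_def)
    show "\<And>y. word (us @ y # vs) = P @ greedy_word p y @ greedy_word y q @ path_word q qs"
      by (simp add: word_def path_word_append q P_def p_def)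
  qed
qed

definition ascent :: "'a list \<Rightarrow> nat \<Rightarrow> bool" where
  "ascent w s \<longleftrightarrow> w ! (s - 1) < w ! s"

lemma nth_junction:
  assumes "as \<noteq> []" "bs \<noteq> []" "length P + length as = s"
  shows "(P @ as @ bs @ R) ! (s - 1) = last as" "(P @ as @ bs @ R) ! s = hd bs"
proof -
  obtain as' a where as: "as = as' @ [a]" using assms(1) by (cases as rule: rev_cases) auto
  then have "s - 1 = length (P @ as')" using assms(3) by simp
  then show "(P @ as @ bs @ R) ! (s - 1) = last as"
    using nth_append_length[of "P @ as'" a "bs @ R"] by (simp add: as)
  show "(P @ as @ bs @ R) ! s = hd bs"
    using assms by (auto simp: nth_append hd_conv_nth)
qed

text \<open>Removing a flat keeps the word if the word ascends there and lowers it lexicographically if it descends. The flat is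
  recovered from the word and its rank, hence a chain from its word and its set of ranks.\<close>
lemma word_remove:
  assumes c: "proper_chain (us @ y # vs)"
  shows "word (us @ vs) = word (us @ y # vs) \<longleftrightarrow> ascent (word (us @ y # vs)) (rk y)"
    and "word (us @ vs) = word (us @ y # vs) \<or> (word (us @ vs), word (us @ y # vs)) \<in> lex letter_less"
    and "y = cl (set (take (rk y) (word (us @ y # vs))))"
proof -
  obtain p q P R where w: "p \<in> L" "q \<in> L" "p \<subset> q" "length P = rk p"
    "p \<in> insert {} (set us)" "q \<in> insert E (set vs)"
    "word (us @ vs) = P @ greedy_word p q @ R" "word (us @ y # vs) = P @ greedy_word p y @ greedy_word y q @ R" "cl (set P) = p"
    using word_local[OF proper_chain_remove[OF c]] by metis
  have y: "y \<in> L" using c by (auto simp: proper_chain_def)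
  have "p \<subset> y" "y \<subset> q" using w(5,6) c by (auto simp: proper_chain_def sorted_wrt_append)
  note yy = y this
  then have ne: "greedy_word p y \<noteq> []" "greedy_word y q \<noteq> []" using greedy_word_step(1) w by auto
  have len: "length P + length (greedy_word p y) = rk y" using w flat_rank_less[OF w(1) yy(1,2)] by simp
  have eq: "word (us @ vs) = word (us @ y # vs) \<longleftrightarrow> greedy_word p y @ greedy_word y q = greedy_word p q"
    unfolding w by auto
  also have "\<dots> \<longleftrightarrow> last (greedy_word p y) < hd (greedy_word y q)"
    using greedy_word_ascent[OF w(1) y w(2) yy(2,3)] greedy_word_descent[OF w(1) y w(2) yy(2,3)] by blast
  also have "\<dots> \<longleftrightarrow> ascent (word (us @ y # vs)) (rk y)"
    unfolding ascent_def w using nth_junction[OF ne len] by simp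
  finally show "word (us @ vs) = word (us @ y # vs) \<longleftrightarrow> ascent (word (us @ y # vs)) (rk y)" .
  have "greedy_word p y @ greedy_word y q = greedy_word p q \<or> (greedy_word p q, greedy_word p y @ greedy_word y q) \<in> lex letter_less"
    using greedy_word_lex[OF w(1) y w(2)] yy by auto
  then show "word (us @ vs) = word (us @ y # vs) \<or> (word (us @ vs), word (us @ y # vs)) \<in> lex letter_less"
  proof
    assume "greedy_word p y @ greedy_word y q = greedy_word p q"
    then show ?thesis using eq by blast
  next
    assume "(greedy_word p q, greedy_word p y @ greedy_word y q) \<in> lex letter_less"
    then have "(greedy_word p q @ R, (greedy_word p y @ greedy_word y q) @ R) \<in> lex letter_less" by (rule lex_append_rightI) simp
    then have "(P @ greedy_word p q @ R, P @ (greedy_word p y @ greedy_word y q) @ R) \<in> lex letter_less" by (rule lex_append_leftI)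
    then show ?thesis unfolding w by simp
  qed
  have t: "take (rk y) (word (us @ y # vs)) = P @ greedy_word p y" using len by (simp add: w)
  have py: "p \<subseteq> y" using yy by auto
  have sg: "set (greedy_word p y) \<subseteq> y - p" by (rule set_greedy_word[OF w(1) y py])
  have "set P \<subseteq> p"
  proof -
    have "set P \<subseteq> E"
    proof -
      have "set (P @ greedy_word p q @ R) \<subseteq> E"
        unfolding w(7)[symmetric] word_def using last_path_word_flat(5)[of "{}" "(us @ vs) @ [E]"] proper_chain_remove[OF c] E_flat empty_flat
        by (auto simp: proper_chain_def)
      then show ?thesis by auto
    qed
    then show ?thesis using subset_cl w(9) by blast
  qed
  then have sE: "set P \<union> set (greedy_word p y) \<subseteq> y" using py sg by auto
  have sE': "set P \<union> set (greedy_word p y) \<subseteq> E" using sE flat_sub_E[OF y] by auto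
  have "cl (set P \<union> set (greedy_word p y)) = y"
  proof (rule subset_antisym)
    show "cl (set P \<union> set (greedy_word p y)) \<subseteq> y" by (rule cl_minimal[OF y sE])
    have "cl (set P) \<subseteq> cl (set P \<union> set (greedy_word p y))"
      by (rule cl_minimal[OF cl_flat[OF sE']]) (use subset_cl[OF sE'] in auto)
    then have "cl (p \<union> set (greedy_word p y)) \<subseteq> cl (set P \<union> set (greedy_word p y))"
      by (intro cl_minimal[OF cl_flat[OF sE']]) (use subset_cl[OF sE'] w(9) in auto)
    then show "y \<subseteq> cl (set P \<union> set (greedy_word p y))" using cl_greedy_word[OF w(1) y py] by simp
  qed
  then show "y = cl (set (take (rk y) (word (us @ y # vs))))" by (simp add: t)
qed

text \<open>The flat of rank \<open>s\<close> on the greedy refinement of the chain.\<close>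
lemma insert_preserving_word: "0 < s \<Longrightarrow> s < rk E \<Longrightarrow> proper_chain c \<Longrightarrow> s \<notin> rk ` set c \<Longrightarrow>
  \<exists>us vs y. c = us @ vs \<and> proper_chain (us @ y # vs) \<and> rk y = s \<and> word (us @ y # vs) = word c"
proof -
  assume s: "0 < s" "s < rk E" and c: "proper_chain c" and n: "s \<notin> rk ` set c"
  define us where "us = takeWhile (\<lambda>F. rk F < s) c"
  define vs where "vs = dropWhile (\<lambda>F. rk F < s) c"
  have cuv: "c = us @ vs" by (simp add: us_def vs_def)
  have us: "rk F < s" if "F \<in> set us" for F using that set_takeWhileD unfolding us_def by fast
  have vs: "s < rk F" if F: "F \<in> set vs" for F
  proof -
    have ne: "vs \<noteq> []" using F by auto
    \<comment> \<open>no member of the chain has rank \<open>s\<close>, so the first one whose rank is not below \<open>s\<close> has larger rank\<close>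
    then have "\<not> rk (hd vs) < s" unfolding vs_def by (rule hd_dropWhile)
    moreover have "hd vs \<in> set c" using ne cuv by auto
    ultimately have "s < rk (hd vs)" using n by (metis imageI linorder_neqE_nat)
    moreover have "F = hd vs \<or> hd vs \<subset> F"
    proof -
      obtain v vs' where v: "vs = v # vs'" using ne by (cases vs) auto
      have "sorted_wrt (<) vs" using c unfolding cuv proper_chain_def by (simp add: sorted_wrt_append)
      then show ?thesis using F by (auto simp: v)
    qed
    then have "rk (hd vs) \<le> rk F" using rank_mono by auto
    ultimately show ?thesis by simp
  qed
  obtain p q P R where w: "p \<in> L" "q \<in> L" "p \<subset> q" "\<And>F. F \<in> set us \<Longrightarrow> F \<subseteq> p" "\<And>F. F \<in> set vs \<Longrightarrow> q \<subseteq> F"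
    "p \<in> insert {} (set us)" "q \<in> insert E (set vs)"
    "word (us @ vs) = P @ greedy_word p q @ R" "\<And>y. word (us @ y # vs) = P @ greedy_word p y @ greedy_word y q @ R"
    using word_local[OF c[unfolded cuv]] by metis
  have r: "rk p < s" "s < rk q" using w(6,7) us vs s by (auto simp: rank_empty)
  obtain y where y: "y \<in> L" "p \<subseteq> y" "y \<subseteq> q" "rk y = rk p + (s - rk p)" "greedy_word p q = greedy_word p y @ greedy_word y q"
    using greedy_word_split[OF w(1,2) psubset_imp_subset[OF w(3)], of "s - rk p"] r by fastforce
  then have ry: "rk y = s" using r by simp
  then have py: "p \<subset> y" "y \<subset> q" using y r by auto
  have "F \<subset> y" if "F \<in> set us" for F using w(4)[OF that] py by auto
  moreover have "y \<subset> F" if "F \<in> set vs" for F using w(5)[OF that] py by auto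
  moreover have "{} \<subset> y" "y \<subset> E" using py flat_sub_E[OF w(2)] by auto
  ultimately have "proper_chain (us @ y # vs)"
    using c y(1) unfolding cuv proper_chain_def by (simp add: sorted_wrt_append)
  moreover have "word (us @ y # vs) = word c" by (simp add: cuv w y)
  ultimately show ?thesis using cuv ry by blast
qed

end

section \<open>Acyclicity of rank-selected geometric lattices below the top dimension\<close>

lemma boundary_add: "boundary (c + d) = boundary c + boundary d"
  and boundary_diff: "boundary (c - d) = boundary c - boundary d"
  and boundary_cscale: "boundary (cscale z c) = cscale z (boundary c)"
  and boundary_0: "boundary 0 = 0"
  by (simp_all add: boundary_def lin_ext_add lin_ext_diff lin_ext_cscale)

lemma boundary_single: "boundary (single xs z) =
   (\<Sum>i<length xs. single (take i xs @ drop (Suc i) xs) ((-1) ^ i * z))"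
proof -
  have "cscale z (single (take i xs @ drop (Suc i) xs) ((-1) ^ i)) =
     single (take i xs @ drop (Suc i) xs) ((-1) ^ i * z)" for i
    by (auto intro!: poly_mapping_eqI simp: Poly_Mapping.lookup_single when_def)
  then show ?thesis by (simp add: boundary_def lin_ext_single free.scale_sum_right)
qed

definition face :: "nat \<Rightarrow> 'a list \<Rightarrow> 'a list" where
  "face i xs = take i xs @ drop (Suc i) xs"

lemma boundary_single_face: "boundary (single xs z) =
   (\<Sum>i<length xs. single (face i xs) ((-1) ^ i * z))"
  by (simp add: boundary_single face_def)

lemma length_face: "i < length xs \<Longrightarrow> length (face i xs) = length xs - 1"
  by (auto simp: face_def)

lemma face_split: "i < length xs \<Longrightarrow> xs = take i xs @ xs ! i # drop (Suc i) xs"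
  by (rule id_take_nth_drop)

text \<open>The terms for deleting positions \<open>i > j\<close> cancel against those for deleting \<open>j\<close> first and then \<open>i - 1\<close>.\<close>
lemma boundary_boundary_single: "boundary (boundary (single xs z)) = 0"
proof -
  define n where "n = length xs"
  define t where "t i j = single (face j (face i xs)) ((-1) ^ (i + j) * z)" for i j
  have "boundary (boundary (single xs z)) = (\<Sum>i<n. \<Sum>j<n - 1. t i j)"
    unfolding boundary_single_face[of xs]
    by (simp add: boundary_def lin_ext_sum)
       (auto simp: boundary_def[symmetric] boundary_single_face length_face n_def t_def power_add mult_ac intro!: sum.cong)
  also have "\<dots> = (\<Sum>(i, j)\<in>{..<n} \<times> {..<n - 1}. t i j)" by (simp add: sum.cartesian_product)
  also have "{..<n} \<times> {..<n - 1} = {(i, j). j < i \<and> i < n} \<union> {(i, j). i \<le> j \<and> j < n - 1}" by auto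
  also have "(\<Sum>(i, j)\<in>\<dots>. t i j) = (\<Sum>(i, j)\<in>{(i, j). j < i \<and> i < n}. t i j) + (\<Sum>(i, j)\<in>{(i, j). i \<le> j \<and> j < n - 1}. t i j)"
    by (rule sum.union_disjoint)
       (auto intro: finite_subset[of _ "{..<n} \<times> {..<n}"])
  also have "(\<Sum>(i, j)\<in>{(i, j). j < i \<and> i < n}. t i j) = (\<Sum>(i, j)\<in>{(i, j). i \<le> j \<and> j < n - 1}. - t i j)"
  proof (rule sum.reindex_bij_witness[where i = "\<lambda>(i, j). (Suc j, i)" and j = "\<lambda>(i, j). (j, i - 1)"])
    fix a assume "a \<in> {(i, j). j < i \<and> i < n}"
    then obtain i j where a: "a = (Suc i, j)" "j \<le> i" "Suc i < n" by (cases a; cases "fst a") auto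
    have "face j (face (Suc i) xs) = face i (face j xs)"
      using a by (simp add: face_def n_def min_def drop_take[symmetric] take_drop)
    then have "- t j i = t (Suc i) j"
      by (simp add: t_def single_uminus[symmetric] add.commute)
    then show "(case case a of (i, j) \<Rightarrow> (j, i - 1) of (i, j) \<Rightarrow> - t i j) = (case a of (i, j) \<Rightarrow> t i j)"
      by (simp add: a)
  qed auto
  also have "\<dots> + (\<Sum>(i, j)\<in>{(i, j). i \<le> j \<and> j < n - 1}. t i j) = 0"
    by (simp add: sum.distrib[symmetric] split_beta)
  finally show ?thesis .
qed

lemma boundary_boundary: "boundary (boundary c) = 0"
proof -
  have "boundary (boundary c) = (\<Sum>x\<in>keys c. boundary (boundary (single x (lookup c x))))"
    by (subst (1) sum_single_keys[of c, symmetric]) (simp add: boundary_def lin_ext_sum)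
  then show ?thesis by (simp add: boundary_boundary_single)
qed

lemma lookup_boundary: "lookup (boundary z) f =
   (\<Sum>d\<in>keys z. \<Sum>i<length d. if face i d = f then (-1) ^ i * lookup z d else 0)"
  by (simp add: boundary_def lin_ext_def Poly_Mapping.lookup_sum Poly_Mapping.lookup_single when_def face_def sum_distrib_left if_distrib mult.commute cong: if_cong)

lemma sorted_wrt_less_distinct: "sorted_wrt (<) (c :: 'b::order list) \<Longrightarrow> distinct c"
  by (induction c) auto

context ordered_loopless_matroid
begin

definition selected :: "nat set \<Rightarrow> 'a set set" where
  "selected S = {F \<in> L. rk F \<in> S}"

definition chains :: "nat set \<Rightarrow> nat \<Rightarrow> 'a set list set" where
  "chains S l = {c. set c \<subseteq> selected S \<and> sorted_wrt (<) c \<and> length c = l}"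

text \<open>The index \<open>l\<close> is the number of elements of the chains, so this is the space of simplicial chains of dimension \<open>l - 1\<close>.\<close>
definition chain_space :: "nat set \<Rightarrow> nat \<Rightarrow> ('a set list \<Rightarrow>\<^sub>0 complex) set" where
  "chain_space S l = {c. keys c \<subseteq> chains S l}"

lemma chain_space_subspace: "free.subspace (chain_space S l)"
  unfolding free.subspace_def
proof (intro conjI ballI allI)
  fix x y z assume xy: "x \<in> chain_space S l" "y \<in> chain_space S l"
  then show "x + y \<in> chain_space S l"
    using Poly_Mapping.keys_add[of x y] unfolding chain_space_def by blast
  show "cscale z x \<in> chain_space S l" using xy by (auto simp: chain_space_def in_keys_iff)
qed (simp add: chain_space_def)

lemma chains_proper:
  assumes "S \<subseteq> {1..<rk E}" "c \<in> chains S l"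
    and pos: "0 < rk E"
  shows "proper_chain c"
proof -
  have "{} \<subset> F \<and> F \<subset> E" if "F \<in> set c" for F
  proof -
    have F: "F \<in> L" "rk F \<in> {1..<rk E}" using that assms by (auto simp: chains_def selected_def)
    then have "F \<noteq> {}" "F \<noteq> E" using rank_empty by auto
    then show ?thesis using flat_sub_E[OF F(1)] by blast
  qed
  moreover have "{} \<subset> E" using pos rank_empty by (metis empty_subsetI less_irrefl psubsetI)
  ultimately show ?thesis using assms(2)
    by (auto simp: proper_chain_def chains_def selected_def sorted_wrt_append)
qed

lemma chains_face: assumes "c \<in> chains S l" "i < l" shows "face i c \<in> chains S (l - 1)"
proof -
  define us vs y where uvy: "us = take i c" "vs = drop (Suc i) c" "y = c ! i"
  have "c = us @ y # vs" unfolding uvy by (rule face_split) (use assms in \<open>auto simp: chains_def\<close>)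
  moreover have "face i c = us @ vs" by (simp add: face_def uvy)
  ultimately show ?thesis using assms by (auto simp: chains_def sorted_wrt_append)
qed

lemma chains_split: assumes "c \<in> chains S l" "F \<in> set c"
  obtains us vs where "c = us @ F # vs" "\<And>G. G \<in> set us \<Longrightarrow> G \<subset> F" "\<And>G. G \<in> set vs \<Longrightarrow> F \<subset> G"
proof -
  obtain us vs where c: "c = us @ F # vs" using split_list[OF assms(2)] by blast
  then show ?thesis using assms that[of us vs] by (auto simp: chains_def sorted_wrt_append)
qed

lemma chains_rank_inj: assumes "c \<in> chains S l" "F \<in> set c" "G \<in> set c" "rk F = rk G" shows "F = G"
proof -
  have L: "F \<in> L" "G \<in> L" using assms by (auto simp: chains_def selected_def)
  obtain us vs where c: "c = us @ F # vs" "\<And>G. G \<in> set us \<Longrightarrow> G \<subset> F" "\<And>G. G \<in> set vs \<Longrightarrow> F \<subset> G"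
    using chains_split[OF assms(1,2)] by metis
  have "G \<subset> F \<or> F \<subset> G \<or> F = G" using assms(3) c by auto
  then show ?thesis using flat_rank_less[OF L] flat_rank_less[OF L(2,1)] assms(4) by auto
qed

lemma chains_card: assumes "c \<in> chains S l" "l < card S" shows "\<exists>s\<in>S. s \<notin> rk ` set c"
proof (rule ccontr)
  assume "\<not> ?thesis"
  then have "card S \<le> card (rk ` set c)" by (intro card_mono) auto
  also have "\<dots> \<le> card (set c)" by (rule card_image_le) simp
  also have "\<dots> \<le> length c" by (rule card_length)
  finally show False using assms by (simp add: chains_def)
qed

text \<open>The rank used to match the chains with word \<open>w\<close>: the least selected one at which \<open>w\<close> ascends. Inserting or removing the
  flat of that rank does not change the word.\<close>
definition pivot_rank :: "nat set \<Rightarrow> 'a list \<Rightarrow> nat" where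
  "pivot_rank S w = Min {s \<in> S. ascent w s}"

definition contains_pivot :: "nat set \<Rightarrow> 'a set list \<Rightarrow> bool" where
  "contains_pivot S c \<longleftrightarrow> pivot_rank S (word c) \<in> rk ` set c"

context
  fixes S :: "nat set"
  assumes S: "S \<subseteq> {1..<rk E}" and pos: "0 < rk E"
begin

lemma finite_S: "finite S" using S finite_subset by blast

lemmas chain_proper = chains_proper[OF S _ pos]

lemma insert_rank:
  assumes "c \<in> chains S l" "s \<in> S" "s \<notin> rk ` set c"
  shows "\<exists>us vs y. c = us @ vs \<and> us @ y # vs \<in> chains S (Suc l) \<and> rk y = s \<and> word (us @ y # vs) = word c"
    and "ascent (word c) s"
proof -
  have "0 < s" "s < rk E" using assms S by auto
  from insert_preserving_word[OF this chain_proper[OF assms(1)] assms(3)]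
  obtain us vs y where c: "c = us @ vs" "proper_chain (us @ y # vs)" "rk y = s" "word (us @ y # vs) = word c"
    by blast
  have "us @ y # vs \<in> chains S (Suc l)"
    using c assms(1,2) by (auto simp: chains_def selected_def proper_chain_def sorted_wrt_append)
  then show "\<exists>us vs y. c = us @ vs \<and> us @ y # vs \<in> chains S (Suc l) \<and> rk y = s \<and> word (us @ y # vs) = word c"
    using c by blast
  show "ascent (word c) s" using word_remove(1)[OF c(2)] c by simp
qed

text \<open>A chain that is not of full length misses some selected rank, and at a missing rank the word ascends.\<close>
lemma pivot_rank_ascent: assumes "c \<in> chains S l" "l < card S"
  shows "pivot_rank S (word c) \<in> S" "ascent (word c) (pivot_rank S (word c))"
proof -
  obtain s where "s \<in> S" "s \<notin> rk ` set c" using chains_card[OF assms] by blast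
  then have "{s \<in> S. ascent (word c) s} \<noteq> {}" using insert_rank(2)[OF assms(1)] by blast
  from Min_in[OF _ this] finite_S
  show "pivot_rank S (word c) \<in> S" "ascent (word c) (pivot_rank S (word c))" by (auto simp: pivot_rank_def)
qed

lemma face_word:
  assumes "c \<in> chains S l" "i < l"
  shows "word (face i c) = word c \<longleftrightarrow> ascent (word c) (rk (c ! i))"
    and "word (face i c) = word c \<or> (word (face i c), word c) \<in> lex letter_less"
    and "c ! i = cl (set (take (rk (c ! i)) (word c)))"
proof -
  define us vs y where uvy: "us = take i c" "vs = drop (Suc i) c" "y = c ! i"
  have c: "c = us @ y # vs" unfolding uvy by (rule face_split) (use assms in \<open>auto simp: chains_def\<close>)
  have f: "face i c = us @ vs" by (simp add: face_def uvy)
  have y: "c ! i = y" by (simp add: uvy)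
  have p: "proper_chain (us @ y # vs)" using chain_proper[OF assms(1)] c by simp
  show "word (face i c) = word c \<longleftrightarrow> ascent (word c) (rk (c ! i))"
    "word (face i c) = word c \<or> (word (face i c), word c) \<in> lex letter_less"
    "c ! i = cl (set (take (rk (c ! i)) (word c)))"
    unfolding f y using word_remove[OF p] c by simp_all
qed

text \<open>Induction on the word. If a chain misses its pivot, adding it gives a larger chain with the same word. In the boundary of the
  latter the chain itself occurs, and every other face either still contains the pivot and has the same word, or has a smaller word.\<close>
lemma chain_contains_pivot_mod_boundary:
  assumes "l < card S" "c \<in> chains S l"
  shows "\<exists>b\<in>chain_space S (Suc l). keys (single c 1 - boundary b) \<subseteq> {d \<in> chains S l. contains_pivot S d}"
proof -
  define X where "X = {z. \<exists>b\<in>chain_space S (Suc l). keys (z - boundary b) \<subseteq> {d \<in> chains S l. contains_pivot S d}}"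
  have X_add: "x + y \<in> X" if xy: "x \<in> X" "y \<in> X" for x y
  proof -
    obtain b b' where b: "b \<in> chain_space S (Suc l)" "keys (x - boundary b) \<subseteq> {d \<in> chains S l. contains_pivot S d}"
      "b' \<in> chain_space S (Suc l)" "keys (y - boundary b') \<subseteq> {d \<in> chains S l. contains_pivot S d}"
      using xy by (auto simp: X_def)
    have e: "x + y - boundary (b + b') = (x - boundary b) + (y - boundary b')" by (simp add: boundary_add)
    have "keys (x + y - boundary (b + b')) \<subseteq> {d \<in> chains S l. contains_pivot S d}"
      unfolding e using Poly_Mapping.keys_add[of "x - boundary b" "y - boundary b'"] b by blast
    then show ?thesis unfolding X_def using free.subspace_add[OF chain_space_subspace b(1,3)] by blast
  qed
  have X_scale: "cscale a x \<in> X" if x: "x \<in> X" for x a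
  proof -
    obtain b where b: "b \<in> chain_space S (Suc l)" "keys (x - boundary b) \<subseteq> {d \<in> chains S l. contains_pivot S d}"
      using x by (auto simp: X_def)
    have e: "cscale a x - boundary (cscale a b) = cscale a (x - boundary b)"
      by (simp add: boundary_cscale free.scale_right_diff_distrib)
    have "keys (cscale a x - boundary (cscale a b)) \<subseteq> {d \<in> chains S l. contains_pivot S d}"
      unfolding e using b by (auto simp: in_keys_iff)
    then show ?thesis unfolding X_def using free.subspace_scale[OF chain_space_subspace b(1)] by blast
  qed
  have X_boundary: "boundary b \<in> X" if "b \<in> chain_space S (Suc l)" for b
    unfolding X_def using that by (intro CollectI bexI[of _ b]) auto
  have X_contains_pivot: "single d 1 \<in> X" if "d \<in> chains S l" "contains_pivot S d" for d
    unfolding X_def using that free.subspace_0[OF chain_space_subspace]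
    by (intro CollectI bexI[of _ 0]) (auto simp: boundary_0)
  have "single c 1 \<in> X" using assms(2)
  proof (induction "word c" arbitrary: c rule: wf_induct_rule[OF wf_lex[OF wf_letter_less(1)]])
    case (1 c)
    show ?case
    proof (cases "contains_pivot S c")
      case True then show ?thesis using X_contains_pivot 1 by blast
    next
      case False
      define s where "s = pivot_rank S (word c)"
      have s: "s \<in> S" "ascent (word c) s" "s \<notin> rk ` set c"
        using pivot_rank_ascent[OF 1(2) assms(1)] False by (auto simp: s_def contains_pivot_def)
      obtain us vs y where c: "c = us @ vs" "us @ y # vs \<in> chains S (Suc l)" "rk y = s" "word (us @ y # vs) = word c"
        using insert_rank(1)[OF 1(2) s(1,3)] by blast
      define c' where "c' = us @ y # vs"
      define p where "p = length us"
      have c': "c' \<in> chains S (Suc l)" and len: "length c' = Suc l" and p: "p < Suc l" "c' ! p = y" "face p c' = c"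
        using c by (auto simp: c'_def p_def face_def chains_def)
      have fX: "single (face i c') 1 \<in> X" if i: "i < Suc l" "i \<noteq> p" for i
      proof -
        have fi: "face i c' \<in> chains S l" using chains_face[OF c' i(1)] by simp
        from face_word(2)[OF c' i(1)] show ?thesis
        proof
          assume w: "word (face i c') = word c'"
          have "y \<in> set (face i c')"
          proof (cases "i < p")
            case True
            then have "face i c' = face i us @ y # vs" by (simp add: face_def c'_def p_def)
            then show ?thesis by simp
          next
            case False
            then have "take i c' = us @ take (i - p) (y # vs)" "i - p > 0" using i by (auto simp: c'_def p_def)
            then show ?thesis by (cases "i - p") (auto simp: face_def)
          qed
          then have "rk y \<in> rk ` set (face i c')" by (rule imageI)
          then have "contains_pivot S (face i c')" unfolding contains_pivot_def using w c s_def by (simp add: c'_def)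
          then show ?thesis using X_contains_pivot fi by blast
        next
          assume "(word (face i c'), word c') \<in> lex letter_less"
          then show ?thesis using 1(1)[of "face i c'"] fi c by (simp add: c'_def)
        qed
      qed
      have b: "boundary (single c' ((-1) ^ p)) =
          single c 1 + (\<Sum>i\<in>{..<Suc l} - {p}. cscale ((-1) ^ (i + p)) (single (face i c') 1))"
      proof -
        have "boundary (single c' ((-1) ^ p)) = (\<Sum>i<Suc l. cscale ((-1) ^ (i + p)) (single (face i c') 1))"
          unfolding boundary_single_face len by (simp only: power_add single_conv_cscale[symmetric])
        also have "\<dots> = cscale ((-1) ^ (p + p)) (single (face p c') 1) + (\<Sum>i\<in>{..<Suc l} - {p}. cscale ((-1) ^ (i + p)) (single (face i c') 1))"
          by (rule sum.remove) (use p in auto)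
        finally show ?thesis by (simp add: p)
      qed
      have X_sum: "(\<Sum>i\<in>I. cscale (f i) (single (face i c') 1)) \<in> X"
        if "I \<subseteq> {..<Suc l} - {p}" "finite I" for I and f :: "nat \<Rightarrow> complex"
        using that(2,1)
      proof (induction I rule: finite_induct)
        case empty
        show ?case using X_boundary[OF free.subspace_0[OF chain_space_subspace]] by (simp add: boundary_0)
      next
        case (insert i I)
        then have "single (face i c') 1 \<in> X" using fX by auto
        then show ?case using insert X_add X_scale by auto
      qed
      have "boundary (single c' ((-1) ^ p)) \<in> X"
        by (rule X_boundary) (use c' in \<open>auto simp: chain_space_def\<close>)
      moreover have "cscale (-1) (\<Sum>i\<in>{..<Suc l} - {p}. cscale ((-1) ^ (i + p)) (single (face i c') 1)) \<in> X"
        by (intro X_scale X_sum) auto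
      ultimately have "boundary (single c' ((-1) ^ p)) +
        cscale (-1) (\<Sum>i\<in>{..<Suc l} - {p}. cscale ((-1) ^ (i + p)) (single (face i c') 1)) \<in> X"
        by (rule X_add)
      then show ?thesis unfolding b by (simp add: free.scale_minus_left)
    qed
  qed
  then show ?thesis by (simp add: X_def)
qed

text \<open>Take a chain \<open>d\<close> in the support with lexicographically largest word, and remove its pivot. The resulting face \<open>f\<close> has the same word. Another
  chain of the support with face \<open>f\<close> cannot have a larger word, so it has the same one and contains the same pivot; as \<open>f\<close> does not, the
  chain is \<open>d\<close>. So the coefficient of \<open>f\<close> in the boundary is that of \<open>d\<close> up to sign, and not zero.\<close>
lemma contains_pivot_cycle_zero:
  assumes l: "l < card S" and z: "keys z \<subseteq> {d \<in> chains S l. contains_pivot S d}" "boundary z = 0"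
  shows "z = 0"
proof (rule ccontr)
  assume "z \<noteq> 0"
  then have "word ` keys z \<noteq> {}" by simp
  \<comment> \<open>a word that is minimal for the converse order is lexicographically largest\<close>
  from wfE_min'[OF wf_lex[OF wf_letter_less(2)] this]
  obtain w where w: "w \<in> word ` keys z" "\<And>v. (v, w) \<in> lex (letter_less\<inverse>) \<Longrightarrow> v \<notin> word ` keys z"
    by blast
  from w(1) obtain d where d: "d \<in> keys z" "w = word d" by blast
  have max: "(word d', word d) \<notin> lex (letter_less\<inverse>)" if "d' \<in> keys z" for d'
    using w(2)[of "word d'"] that d(2) by blast
  have max': "(word d, word d') \<notin> lex letter_less" if "d' \<in> keys z" for d'
  proof
    assume "(word d, word d') \<in> lex letter_less"
    then have "(word d', word d) \<in> lex (letter_less\<inverse>)" by (auto simp: lex_conv)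
    then show False using max that by blast
  qed
  have dc: "d \<in> chains S l" "contains_pivot S d" using d(1) z by auto
  define s where "s = pivot_rank S (word d)"
  have sa: "ascent (word d) s" using pivot_rank_ascent[OF dc(1) l] by (simp add: s_def)
  obtain y where y: "y \<in> set d" "rk y = s" using dc(2) by (auto simp: contains_pivot_def s_def)
  then obtain p where p: "p < l" "d ! p = y" using dc(1) by (auto simp: in_set_conv_nth chains_def)
  define f where "f = face p d"
  have wf: "word f = word d" using face_word(1)[OF dc(1) p(1)] sa y p by (simp add: f_def)
  have set_face: "set c = insert (c ! i) (set (face i c))" if "i < length c" for c :: "'a set list" and i
    by (subst face_split[OF that]) (auto simp: face_def)
  have dist: "distinct c" if "c \<in> chains S l" for c
    using that by (auto simp: chains_def intro: sorted_wrt_less_distinct)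
  have notin: "c ! i \<notin> set (face i c)" if "i < length c" "distinct c" for c :: "'a set list" and i
    using that(2) by (subst (asm) face_split[OF that(1)]) (auto simp: face_def)
  have uniq: "d' = d \<and> i = p" if d': "d' \<in> keys z" "i < length d'" "face i d' = f" for d' i
  proof -
    have d'c: "d' \<in> chains S l" "contains_pivot S d'" using d' z by auto
    have il: "i < l" using d'c d' by (auto simp: chains_def)
    have "word d' = word d" using face_word(2)[OF d'c(1) il] max'[OF d'(1)] d'(3) wf by auto
    then have "s \<in> rk ` set d'" using d'c(2) by (simp add: contains_pivot_def s_def)
    moreover have "s \<notin> rk ` set f"
    proof
      assume "s \<in> rk ` set f"
      then obtain F where F: "F \<in> set f" "rk F = s" by auto
      have "F \<in> set d" using F set_face[of p d] p dc by (auto simp: f_def chains_def)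
      then have "F = y" using chains_rank_inj[OF dc(1)] y F by auto
      then show False using notin[of p d] p dist[OF dc(1)] F dc by (auto simp: f_def chains_def)
    qed
    ultimately have ri: "rk (d' ! i) = s" using set_face[OF d'(2)] d'(3) by auto
    have "d' ! i = y"
      using face_word(3)[OF d'c(1) il] face_word(3)[OF dc(1) p(1)] ri p y \<open>word d' = word d\<close> by simp
    then have "set d' = set d" using set_face[OF d'(2)] set_face[of p d] p dc d'(3) by (auto simp: f_def chains_def)
    then have eq: "d' = d" using sorted_psubset_list_unique[of d' d] d'c dc by (auto simp: chains_def)
    moreover have "i = p"
      using dist[OF dc(1)] eq \<open>d' ! i = y\<close> p d'(2) dc by (auto simp: nth_eq_iff_index_eq chains_def)
    ultimately show ?thesis by simp
  qed
  have "lookup (boundary z) f = (\<Sum>d'\<in>keys z. \<Sum>i<length d'. if d' = d \<and> i = p then (-1) ^ i * lookup z d' else 0)"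
    unfolding lookup_boundary
    by (intro sum.cong refl) (use uniq in \<open>auto simp: f_def\<close>)
  also have "\<dots> = (\<Sum>d'\<in>keys z. if d' = d then (-1) ^ p * lookup z d else 0)"
  proof (intro sum.cong refl)
    fix d' assume "d' \<in> keys z"
    show "(\<Sum>i<length d'. if d' = d \<and> i = p then (-1) ^ i * lookup z d' else 0) =
      (if d' = d then (-1) ^ p * lookup z d else 0)"
      using p dc(1) by (cases "d' = d") (auto simp: chains_def)
  qed
  also have "\<dots> = (-1) ^ p * lookup z d" using d(1) by simp
  finally show False using z(2) d(1) by (simp add: in_keys_iff)
qed

text \<open>Homology of a rank-selected geometric lattice vanishes below the top dimension: modulo boundaries a cycle consists of chains
  that contain their pivot, and such a cycle is zero.\<close>
lemma cycle_is_boundary: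
  assumes l: "l < card S" and z: "z \<in> chain_space S l" "boundary z = 0"
  shows "\<exists>b\<in>chain_space S (Suc l). boundary b = z"
proof -
  have "\<forall>c\<in>chains S l. \<exists>b. b \<in> chain_space S (Suc l) \<and> keys (single c 1 - boundary b) \<subseteq> {d \<in> chains S l. contains_pivot S d}"
    using chain_contains_pivot_mod_boundary[OF l] by blast
  then obtain b where b: "\<And>c. c \<in> chains S l \<Longrightarrow> b c \<in> chain_space S (Suc l)"
    "\<And>c. c \<in> chains S l \<Longrightarrow> keys (single c 1 - boundary (b c)) \<subseteq> {d \<in> chains S l. contains_pivot S d}"
    by metis
  let ?K = "keys z"
  have K: "?K \<subseteq> chains S l" using z by (simp add: chain_space_def)
  define B where "B = (\<Sum>c\<in>?K. cscale (lookup z c) (b c))"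
  have B: "B \<in> chain_space S (Suc l)" unfolding B_def
    by (intro free.subspace_sum[OF chain_space_subspace] free.subspace_scale[OF chain_space_subspace]) (use b K in auto)
  have bB: "boundary B = (\<Sum>c\<in>?K. cscale (lookup z c) (boundary (b c)))"
    by (simp add: B_def boundary_def lin_ext_sum lin_ext_cscale)
  have zz: "z = (\<Sum>c\<in>?K. cscale (lookup z c) (single c 1))"
    by (subst sum_single_keys[of z, symmetric]) (simp add: single_conv_cscale[symmetric])
  have e: "z - boundary B = (\<Sum>c\<in>?K. cscale (lookup z c) (single c 1 - boundary (b c)))"
    unfolding bB by (subst (1) zz) (simp add: sum_subtractf free.scale_right_diff_distrib)
  have k: "keys (z - boundary B) \<subseteq> {d \<in> chains S l. contains_pivot S d}"
  proof -
    have "keys (z - boundary B) \<subseteq> (\<Union>c\<in>?K. keys (cscale (lookup z c) (single c 1 - boundary (b c))))"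
      unfolding e by (rule Poly_Mapping.keys_sum)
    also have "\<dots> \<subseteq> (\<Union>c\<in>?K. keys (single c 1 - boundary (b c)))"
      by (intro UN_mono) (auto simp: in_keys_iff)
    also have "\<dots> \<subseteq> {d \<in> chains S l. contains_pivot S d}" using b(2) K by blast
    finally show ?thesis .
  qed
  have "boundary (z - boundary B) = 0" using z(2) by (simp add: boundary_diff boundary_boundary)
  then have "z - boundary B = 0" by (rule contains_pivot_cycle_zero[OF l k])
  then show ?thesis using B by (intro bexI[of _ B]) auto
qed

end

end

section \<open>Substitution, ideals and functionals on polynomials\<close>

interpretation ring_ideal: Modules.module "(*) :: 'r::comm_ring_1 \<Rightarrow> 'r \<Rightarrow> 'r"
  by unfold_locales (auto simp: algebra_simps)

declare ring_ideal.scale_scale [simp del]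

text \<open>Ideals of a commutative ring given by a type class are the submodules of the ring as a module over itself.\<close>
abbreviation ideal_span :: "'r::comm_ring_1 set \<Rightarrow> 'r set" where
  "ideal_span \<equiv> ring_ideal.span"

definition monom_subst :: "('v \<Rightarrow> 'r::comm_ring_1) \<Rightarrow> ('v \<Rightarrow>\<^sub>0 nat) \<Rightarrow> 'r" where
  "monom_subst f m = (\<Prod>v\<in>keys m. f v ^ lookup m v)"

lemma monom_subst_superset:
  "finite A \<Longrightarrow> keys m \<subseteq> A \<Longrightarrow> monom_subst f m = (\<Prod>v\<in>A. f v ^ lookup m v)"
  unfolding monom_subst_def by (rule prod.mono_neutral_left) (auto simp: in_keys_iff)

lemma monom_subst_0 [simp]: "monom_subst f 0 = 1" by (simp add: monom_subst_def)

lemma monom_subst_add: "monom_subst f (m + n) = monom_subst f m * monom_subst f n"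
proof -
  let ?A = "keys m \<union> keys n"
  have "keys (m + n) \<subseteq> ?A" by (rule Poly_Mapping.keys_add)
  then show ?thesis
    by (simp add: monom_subst_superset[of ?A] Poly_Mapping.lookup_add power_add prod.distrib)
qed

lemma monom_subst_single: "monom_subst f (single v k) = f v ^ k"
  by (simp add: monom_subst_superset[of "{v}"])

lemma monom_subst_cong: "(\<And>v. v \<in> keys m \<Longrightarrow> f v = g v) \<Longrightarrow> monom_subst f m = monom_subst g m"
  unfolding monom_subst_def by (rule prod.cong) auto

text \<open>The value of a polynomial at \<open>f\<close> in a commutative ring, with \<open>\<phi>\<close> embedding the rational constants.\<close>
definition poly_subst :: "(rat \<Rightarrow> 'r::comm_ring_1) \<Rightarrow> ('v \<Rightarrow> 'r) \<Rightarrow> 'v qpoly \<Rightarrow> 'r" where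
  "poly_subst \<phi> f p = (\<Sum>m\<in>keys p. \<phi> (lookup p m) * monom_subst f m)"

lemma poly_subst_cong: "(\<And>m v. m \<in> keys p \<Longrightarrow> v \<in> keys m \<Longrightarrow> f v = g v) \<Longrightarrow> poly_subst \<phi> f p = poly_subst \<phi> g p"
  unfolding poly_subst_def by (intro sum.cong arg_cong2[where f="(*)"] monom_subst_cong) auto

locale coeff_hom =
  fixes \<phi> :: "rat \<Rightarrow> 'r::comm_ring_1"
  assumes \<phi>_add: "\<phi> (a + b) = \<phi> a + \<phi> b" and \<phi>_mult: "\<phi> (a * b) = \<phi> a * \<phi> b" and \<phi>_1: "\<phi> 1 = 1"
begin

lemma \<phi>_0 [simp]: "\<phi> 0 = 0" using \<phi>_add[of 0 0] by simp

lemma poly_subst_superset: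
  "finite A \<Longrightarrow> keys p \<subseteq> A \<Longrightarrow> poly_subst \<phi> f p = (\<Sum>m\<in>A. \<phi> (lookup p m) * monom_subst f m)"
  unfolding poly_subst_def by (rule sum.mono_neutral_left) (auto simp: in_keys_iff)

lemma poly_subst_0 [simp]: "poly_subst \<phi> f 0 = 0" by (simp add: poly_subst_def)

lemma poly_subst_add: "poly_subst \<phi> f (p + q) = poly_subst \<phi> f p + poly_subst \<phi> f q"
proof -
  let ?A = "keys p \<union> keys q"
  have "keys (p + q) \<subseteq> ?A" by (rule Poly_Mapping.keys_add)
  then show ?thesis
    by (simp add: poly_subst_superset[of ?A] Poly_Mapping.lookup_add \<phi>_add sum.distrib algebra_simps)
qed

lemma poly_subst_single: "poly_subst \<phi> f (single m c) = \<phi> c * monom_subst f m"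
  by (simp add: poly_subst_superset[of "{m}"])

lemma poly_subst_sum: "poly_subst \<phi> f (\<Sum>i\<in>I. p i) = (\<Sum>i\<in>I. poly_subst \<phi> f (p i))"
  by (induction I rule: infinite_finite_induct) (auto simp: poly_subst_add)

lemma poly_subst_uminus: "poly_subst \<phi> f (- p) = - poly_subst \<phi> f p"
  by (metis add.right_inverse add_eq_0_iff poly_subst_0 poly_subst_add)

lemma poly_subst_diff: "poly_subst \<phi> f (p - q) = poly_subst \<phi> f p - poly_subst \<phi> f q"
  by (metis add_uminus_conv_diff poly_subst_add poly_subst_uminus)

lemma poly_subst_mult: "poly_subst \<phi> f (p * q) = poly_subst \<phi> f p * poly_subst \<phi> f q"
proof -
  have "p * q = (\<Sum>m\<in>keys p. \<Sum>n\<in>keys q.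
      single (m + n) (lookup p m * lookup q n))"
    by (subst (1) sum_single_keys[of p, symmetric], subst (1) sum_single_keys[of q, symmetric])
       (simp only: sum_product mult_single)
  then have "poly_subst \<phi> f (p * q) = (\<Sum>m\<in>keys p. \<Sum>n\<in>keys q.
      \<phi> (lookup p m) * \<phi> (lookup q n) * (monom_subst f m * monom_subst f n))"
    by (simp only: poly_subst_sum poly_subst_single monom_subst_add \<phi>_mult)
  also have "\<dots> = (\<Sum>m\<in>keys p. \<Sum>n\<in>keys q.
      (\<phi> (lookup p m) * monom_subst f m) * (\<phi> (lookup q n) * monom_subst f n))"
    by (intro sum.cong refl) (simp only: mult_ac)
  also have "\<dots> = poly_subst \<phi> f p * poly_subst \<phi> f q" by (simp only: poly_subst_def sum_product)
  finally show ?thesis .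
qed

lemma poly_subst_1 [simp]: "poly_subst \<phi> f 1 = 1"
  using poly_subst_single[of f 0 1] by (simp add: \<phi>_1)

lemma poly_subst_power: "poly_subst \<phi> f (p ^ n) = poly_subst \<phi> f p ^ n"
  by (induction n) (auto simp: poly_subst_mult)

lemma poly_subst_pvar [simp]: "poly_subst \<phi> f (pvar v) = f v"
  by (simp add: pvar_def poly_subst_single monom_subst_single \<phi>_1)

lemma poly_subst_pconst [simp]: "poly_subst \<phi> f (pconst c) = \<phi> c"
  by (simp add: pconst_def poly_subst_single)

end

lemma pconst_add: "pconst (a + b) = pconst a + pconst b"
  and pconst_mult: "pconst (a * b) = pconst a * pconst b"
  and pconst_1: "pconst 1 = 1"
  by (simp_all add: pconst_def single_add mult_single)

interpretation pconst: coeff_hom pconst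
  by unfold_locales (auto simp: pconst_add pconst_mult pconst_1)

interpretation cpconst: coeff_hom "\<lambda>q. [:pconst q:]"
  by unfold_locales (auto simp: pconst_add pconst_mult pconst_1 one_pCons)

lemma rename_vars_poly_subst: "rename_vars f = poly_subst pconst (\<lambda>v. pvar (f v))"
  by (rule ext) (simp add: rename_vars_def poly_subst_def monom_subst_def)

lemma pvar_power: "pvar v ^ k = single (single v k) 1"
  by (induction k) (auto simp: pvar_def mult_single single_add[symmetric])

lemma monom_subst_pvar: "monom_subst pvar m = single m 1"
proof -
  have "(\<Prod>v\<in>A. single (single v (lookup m v)) (1::rat)) =
    single (\<Sum>v\<in>A. single v (lookup m v)) 1" if "finite A" for A
    using that by (induction A rule: finite_induct) (auto simp: mult_single)
  then show ?thesis by (simp add: monom_subst_def pvar_power sum_single_keys)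
qed

lemma ideal_mult: "x \<in> ideal_span S \<Longrightarrow> a * x \<in> ideal_span S"
  by (rule ring_ideal.span_scale)
lemma ideal_mult': "x \<in> ideal_span S \<Longrightarrow> x * a \<in> ideal_span S"
  by (metis ideal_mult mult.commute)

lemma coeff_ideal_mult:
  assumes "\<And>j. j < (c::nat) \<Longrightarrow> coeff q j \<in> ideal_span S" "j < c"
  shows "coeff (r * q) j \<in> ideal_span S"
  unfolding coeff_mult by (intro ring_ideal.span_sum ideal_mult) (use assms in auto)

lemma coeff_ideal_pcompose:
  assumes "\<And>j. coeff q j \<in> ideal_span S"
  shows "coeff (pcompose q r) j \<in> ideal_span S"
  using assms
proof (induction q arbitrary: j)
  case (pCons a q)
  have q: "coeff q j \<in> ideal_span S" for j using pCons.prems[of "Suc j"] by simp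
  have a: "a \<in> ideal_span S" using pCons.prems[of 0] by simp
  have "coeff (r * pcompose q r) j \<in> ideal_span S"
    by (rule coeff_ideal_mult[of "Suc j"]) (use pCons.IH[OF q] in auto)
  moreover have "coeff [:a:] j \<in> ideal_span S" using a by (cases j) (auto simp: ring_ideal.span_zero)
  ultimately show ?case by (simp only: pcompose_pCons coeff_add ring_ideal.span_add)
qed (simp add: ring_ideal.span_zero)

lemma pcompose_poly_subst:
  "pcompose (poly_subst (\<lambda>q. [:pconst q:]) f p) r = poly_subst (\<lambda>q. [:pconst q:]) (\<lambda>v. pcompose (f v) r) p"
proof -
  have path_word: "pcompose (x ^ n) r = pcompose x r ^ n" for x n
    by (induction n) (auto simp: pcompose_mult pcompose_1)
  have "pcompose (monom_subst f m) r = monom_subst (\<lambda>v. pcompose (f v) r) m" for m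
    by (simp add: monom_subst_def pcompose_prod path_word)
  then show ?thesis by (simp add: poly_subst_def pcompose_sum pcompose_mult pcompose_smult)
qed

text \<open>The \<open>R\<close>-linear map from \<open>R[t]\<close> to \<open>R\<close> that sends \<open>t^k\<close> to \<open>s k\<close>.\<close>
definition coeff_functional :: "(nat \<Rightarrow> 'r) \<Rightarrow> 'r::comm_ring_1 poly \<Rightarrow> 'r" where
  "coeff_functional s q = (\<Sum>k\<le>degree q. coeff q k * s k)"

lemma coeff_functional_bound: "degree q \<le> n \<Longrightarrow> coeff_functional s q = (\<Sum>k\<le>n. coeff q k * s k)"
  unfolding coeff_functional_def by (rule sum.mono_neutral_left) (auto simp: coeff_eq_0)

lemma coeff_functional_add: "coeff_functional s (p + q) = coeff_functional s p + coeff_functional s q"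
proof -
  let ?n = "max (degree p) (degree q)"
  show ?thesis
    by (simp add: coeff_functional_bound[of _ ?n] degree_add_le algebra_simps sum.distrib)
qed

lemma coeff_functional_0 [simp]: "coeff_functional s 0 = 0" by (simp add: coeff_functional_def)

lemma coeff_functional_sum: "coeff_functional s (\<Sum>i\<in>I. p i) = (\<Sum>i\<in>I. coeff_functional s (p i))"
  by (induction I rule: infinite_finite_induct) (auto simp: coeff_functional_add)

lemma coeff_functional_monom: "coeff_functional s (monom a k) = a * s k"
proof -
  have "coeff_functional s (monom a k) = (\<Sum>i\<le>k. coeff (monom a k) i * s i)" by (rule coeff_functional_bound) (rule degree_monom_le)
  also have "\<dots> = (\<Sum>i\<le>k. if i = k then a * s i else 0)" by (intro sum.cong) auto
  finally show ?thesis by simp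
qed

lemma coeff_functional_smult: "coeff_functional s (Polynomial.smult a q) = a * coeff_functional s q"
proof -
  have "coeff_functional s (Polynomial.smult a q) = (\<Sum>k\<le>degree q. coeff (Polynomial.smult a q) k * s k)" by (rule coeff_functional_bound) (rule degree_smult_le)
  also have "\<dots> = (\<Sum>k\<le>degree q. a * (coeff q k * s k))" by (simp add: mult.assoc)
  also have "\<dots> = a * coeff_functional s q" by (simp only: coeff_functional_def sum_distrib_left)
  finally show ?thesis .
qed

lemma coeff_functional_mult_ideal:
  assumes "\<And>k. coeff_functional s (monom 1 k * q) \<in> ideal_span S"
  shows "coeff_functional s (r * q) \<in> ideal_span S"
proof -
  have m: "monom (coeff r i) i * q = Polynomial.smult (coeff r i) (monom 1 i * q)" for i
    by (metis mult.right_neutral mult_smult_left smult_monom)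
  have "r * q = (\<Sum>i\<le>degree r. monom (coeff r i) i * q)"
    by (subst (1) poly_as_sum_of_monoms[of r, symmetric]) (simp add: sum_distrib_right)
  then have "coeff_functional s (r * q) = (\<Sum>i\<le>degree r. coeff r i * coeff_functional s (monom 1 i * q))"
    by (simp add: coeff_functional_sum m coeff_functional_smult)
  also have "\<dots> \<in> ideal_span S" by (intro ring_ideal.span_sum ideal_mult assms)
  finally show ?thesis .
qed

text \<open>The linearly recurrent sequence with characteristic polynomial \<open>(t + h)^c\<close> that starts with \<open>1, 0, \<dots>, 0\<close>. It
  models the push-forward of the powers of the exceptional divisor of a blow-up whose centre has codimension \<open>c\<close>.\<close>
function push_coeff :: "nat \<Rightarrow> 'r::comm_ring_1 \<Rightarrow> nat \<Rightarrow> 'r" where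
  "push_coeff c h k = (if k = 0 then 1 else if k < c then 0
     else - (\<Sum>i<c. of_nat (c choose i) * h ^ (c - i) * push_coeff c h (k - c + i)))"
  by auto
termination by (relation "measure (\<lambda>(c, h, k). k)") auto

declare push_coeff.simps [simp del]

lemma push_coeff_0: "push_coeff c h 0 = 1" by (simp add: push_coeff.simps)
lemma push_coeff_small: "0 < k \<Longrightarrow> k < c \<Longrightarrow> push_coeff c h k = 0" by (simp add: push_coeff.simps)

lemma push_coeff_rec: "0 < c \<Longrightarrow> (\<Sum>i\<le>c. of_nat (c choose i) * h ^ (c - i) * push_coeff c h (k + i)) = 0"
  using push_coeff.simps[of c h "k + c"] by (simp add: lessThan_Suc_atMost[symmetric])

text \<open>Every term of positive index arises from the initial \<open>1\<close> by at least one use of the recurrence in which it has the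
  coefficient \<open>h^c\<close>.\<close>
lemma push_coeff_dvd: assumes "0 < c" "0 < k" shows "h ^ c dvd push_coeff c h k"
  using assms(2)
proof (induction k rule: less_induct)
  case (less k)
  show ?case
  proof (cases "k < c")
    case True then show ?thesis using less by (simp add: push_coeff_small)
  next
    case False
    have "h ^ c dvd h ^ (c - i) * push_coeff c h (k - c + i)" if i: "i < c" for i
    proof (cases "k - c + i = 0")
      case True then show ?thesis by simp
    next
      case False
      then have "h ^ c dvd push_coeff c h (k - c + i)" using less i \<open>\<not> k < c\<close> by auto
      then show ?thesis by simp
    qed
    then have "h ^ c dvd (\<Sum>i<c. of_nat (c choose i) * h ^ (c - i) * push_coeff c h (k - c + i))"
      by (intro dvd_sum) (simp add: mult.assoc)
    moreover have "push_coeff c h k = - (\<Sum>i<c. of_nat (c choose i) * h ^ (c - i) * push_coeff c h (k - c + i))"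
      using False less.prems by (simp add: push_coeff.simps[of c h k])
    ultimately show ?thesis by (simp only: dvd_minus_iff)
  qed
qed

section \<open>Independence of the Feichtner-Yuzvinsky monomials\<close>

lemma X_power_monom: "[:0, 1:] ^ n = (monom 1 n :: 'r::comm_ring_1 poly)"
  by (simp add: monom_altdef)

context loopless_matroid
begin

text \<open>For \<open>K\<close> the closure of an element \<open>i\<close> and \<open>U\<close> all nonempty flats this is the linear form attached to \<open>i\<close>.\<close>
definition upper_sum :: "'a set set \<Rightarrow> 'a set \<Rightarrow> 'a set qpoly" where
  "upper_sum U K = (\<Sum>N | N \<in> U \<and> K \<subseteq> N. pvar N)"

text \<open>The Feichtner-Yuzvinsky relations, relative to a base flat \<open>F\<close> and a set \<open>U\<close> of flats above it that plays the role of a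
  stage of the blow-up construction. All stages share one polynomial ring, so the variables outside \<open>U\<close> are set to \<open>0\<close>.\<close>
definition fy_relations :: "'a set \<Rightarrow> 'a set set \<Rightarrow> 'a set qpoly set" where
  "fy_relations F U = {pvar H | H. H \<notin> U} \<union>
     {pvar H * pvar K | H K. H \<in> U \<and> K \<in> U \<and> \<not> H \<subseteq> K \<and> \<not> K \<subseteq> H} \<union>
     {upper_sum U K ^ (rk K - rk F) | K. K \<in> U} \<union>
     {pvar H * upper_sum U K ^ (rk K - rk H) | H K. H \<in> U \<and> K \<in> U \<and> H \<subset> K}"

lemma fy_relationsE:
  assumes "g \<in> fy_relations F U"
  obtains (var) H where "g = pvar H" "H \<notin> U"
    | (inc) H K where "g = pvar H * pvar K" "H \<in> U" "K \<in> U" "\<not> H \<subseteq> K" "\<not> K \<subseteq> H"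
    | (pow) K where "g = upper_sum U K ^ (rk K - rk F)" "K \<in> U"
    | (vpow) H K where "g = pvar H * upper_sum U K ^ (rk K - rk H)" "H \<in> U" "K \<in> U" "H \<subset> K"
  using assms unfolding fy_relations_def
proof (elim UnE CollectE exE conjE)
  fix H assume "g = pvar H" "H \<notin> U" then show thesis by (rule var)
next
  fix H K assume "g = pvar H * pvar K" "H \<in> U" "K \<in> U" "\<not> H \<subseteq> K" "\<not> K \<subseteq> H" then show thesis by (rule inc)
next
  fix K assume "g = upper_sum U K ^ (rk K - rk F)" "K \<in> U" then show thesis by (rule pow)
next
  fix H K assume "g = pvar H * upper_sum U K ^ (rk K - rk H)" "H \<in> U" "K \<in> U" "H \<subset> K" then show thesis by (rule vpow)
qed

abbreviation fy_ideal :: "'a set \<Rightarrow> 'a set set \<Rightarrow> 'a set qpoly set" where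
  "fy_ideal F U \<equiv> ideal_span (fy_relations F U)"

definition above :: "'a set \<Rightarrow> 'a set set" where "above F = {K \<in> L. F \<subset> K}"

definition upset :: "'a set set \<Rightarrow> bool" where
  "upset U \<longleftrightarrow> (\<forall>K\<in>U. \<forall>N\<in>L. K \<subseteq> N \<longrightarrow> N \<in> U)"

lemma finite_above: "finite (above F)" using finite_flats by (simp add: above_def)

lemma above_upset: "upset (above G)" "G \<in> L \<Longrightarrow> upset (insert G (above G))"
  by (auto simp: upset_def above_def)

lemma fy_ideal_var: "H \<notin> U \<Longrightarrow> pvar H \<in> fy_ideal F U"
  by (rule ring_ideal.span_base) (auto simp: fy_relations_def)

lemma fy_ideal_incomparable: "H \<in> U \<Longrightarrow> K \<in> U \<Longrightarrow> \<not> H \<subseteq> K \<Longrightarrow> \<not> K \<subseteq> H \<Longrightarrow> pvar H * pvar K \<in> fy_ideal F U"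
  by (rule ring_ideal.span_base) (unfold fy_relations_def, blast)

lemma fy_ideal_power: assumes "K \<in> U" "rk K \<le> d + rk F" shows "upper_sum U K ^ d \<in> fy_ideal F U"
proof -
  have "upper_sum U K ^ (rk K - rk F) \<in> fy_ideal F U"
    by (rule ring_ideal.span_base) (use assms in \<open>auto simp: fy_relations_def\<close>)
  then have "upper_sum U K ^ (d - (rk K - rk F)) * upper_sum U K ^ (rk K - rk F) \<in> fy_ideal F U" by (rule ideal_mult)
  then show ?thesis using assms by (simp add: power_add[symmetric])
qed

lemma fy_ideal_var_power: assumes "H \<in> U" "K \<in> U" "H \<subset> K" "rk K \<le> d + rk H" shows "pvar H * upper_sum U K ^ d \<in> fy_ideal F U"
proof -
  have "pvar H * upper_sum U K ^ (rk K - rk H) \<in> fy_ideal F U"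
    by (rule ring_ideal.span_base) (use assms in \<open>auto simp: fy_relations_def\<close>)
  then have "upper_sum U K ^ (d - (rk K - rk H)) * (pvar H * upper_sum U K ^ (rk K - rk H)) \<in> fy_ideal F U" by (rule ideal_mult)
  then have "pvar H * (upper_sum U K ^ (d - (rk K - rk H)) * upper_sum U K ^ (rk K - rk H)) \<in> fy_ideal F U" by (simp only: mult_ac)
  then show ?thesis using assms by (simp add: power_add[symmetric])
qed

text \<open>Modulo products of incomparable flats, multiplication by \<open>x\<^sub>N\<close> leaves from the sum over the flats above \<open>K\<close> only those
  above \<open>N\<close> as well. The incomparability relations are a hypothesis so that the lemma serves every ideal that contains them.\<close>
lemma join_shift:
  assumes U: "U \<subseteq> L" "upset U" and K: "K \<in> L" and N: "N \<in> U" "\<not> K \<subseteq> N"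
    and inc: "\<And>N P. N \<in> U \<Longrightarrow> P \<in> U \<Longrightarrow> \<not> N \<subseteq> P \<Longrightarrow> \<not> P \<subseteq> N \<Longrightarrow> pvar N * pvar P \<in> ideal_span S"
  shows "pvar N * upper_sum U K ^ n - pvar N * upper_sum U (join K N) ^ n \<in> ideal_span S"
proof -
  have NL: "N \<in> L" using N U by auto
  define J where "J = join K N"
  have J: "J \<in> L" "K \<subseteq> J" "N \<subseteq> J" "\<And>P. P \<in> L \<Longrightarrow> K \<subseteq> P \<Longrightarrow> N \<subseteq> P \<Longrightarrow> J \<subseteq> P"
    using join_flat join_upper join_least K NL by (auto simp: J_def)
  have fU: "finite U" using U finite_flats finite_subset by blast
  have 1: "pvar N * upper_sum U K - pvar N * upper_sum U J \<in> ideal_span S"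
  proof -
    have "{P. P \<in> U \<and> K \<subseteq> P} = {P. P \<in> U \<and> J \<subseteq> P} \<union> {P \<in> U. K \<subseteq> P \<and> \<not> J \<subseteq> P}" using J by auto
    then have "upper_sum U K = upper_sum U J + (\<Sum>P\<in>{P \<in> U. K \<subseteq> P \<and> \<not> J \<subseteq> P}. pvar P)"
      unfolding upper_sum_def by (simp only:) (rule sum.union_disjoint, use fU in auto)
    then have "pvar N * upper_sum U K - pvar N * upper_sum U J = (\<Sum>P\<in>{P \<in> U. K \<subseteq> P \<and> \<not> J \<subseteq> P}. pvar N * pvar P)"
      by (simp add: algebra_simps sum_distrib_left)
    also have "\<dots> \<in> ideal_span S"
    proof (rule ring_ideal.span_sum)
      fix P assume P: "P \<in> {P \<in> U. K \<subseteq> P \<and> \<not> J \<subseteq> P}"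
      then have "\<not> N \<subseteq> P" "\<not> P \<subseteq> N" using J(4)[of P] U N by auto
      then show "pvar N * pvar P \<in> ideal_span S" using P N by (intro inc) auto
    qed
    finally show ?thesis .
  qed
  show ?thesis unfolding J_def[symmetric]
  proof (induction n)
    case 0 then show ?case by (simp add: ring_ideal.span_zero)
  next
    case (Suc n)
    have e: "pvar N * upper_sum U K ^ Suc n - pvar N * upper_sum U J ^ Suc n =
      upper_sum U K * (pvar N * upper_sum U K ^ n - pvar N * upper_sum U J ^ n) + upper_sum U J ^ n * (pvar N * upper_sum U K - pvar N * upper_sum U J)"
      by (simp add: algebra_simps)
    show ?case unfolding e by (intro ring_ideal.span_add ideal_mult Suc 1)
  qed
qed

text \<open>After passing to the join \<open>J\<close> of \<open>K\<close> and \<open>N\<close>, semimodularity bounds \<open>rk J - rk N\<close> by the exponent, and the relation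
  for \<open>N \<subset> J\<close> applies.\<close>
lemma absorb:
  assumes U: "U \<subseteq> L" "upset U" and K: "K \<in> L" and N: "N \<in> U" "\<not> K \<subseteq> N" and d: "rk K \<le> d + rk (K \<inter> N)"
  shows "pvar N * upper_sum U K ^ d \<in> fy_ideal F U"
proof -
  have NL: "N \<in> L" using N U by auto
  define J where "J = join K N"
  have J: "J \<in> L" "K \<subseteq> J" "N \<subseteq> J" using join_flat join_upper K NL by (auto simp: J_def)
  have JU: "J \<in> U" using U N J by (auto simp: upset_def)
  have "rk J + rk (K \<inter> N) \<le> rk K + rk N" unfolding J_def by (rule rank_join[OF K NL])
  moreover have "N \<subset> J" using J N by auto
  ultimately have 3: "pvar N * upper_sum U J ^ d \<in> fy_ideal F U" using d by (intro fy_ideal_var_power[OF N(1) JU]) auto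
  have "pvar N * upper_sum U K ^ d - pvar N * upper_sum U J ^ d \<in> fy_ideal F U"
    unfolding J_def by (rule join_shift[OF U K N]) (rule fy_ideal_incomparable)
  from ring_ideal.span_add[OF this 3] show ?thesis by simp
qed

text \<open>By \<open>absorb\<close>, the factor of \<open>K\<close> makes the two upper sums interchangeable, which gives a power of that of \<open>K\<close> alone
  with the exponent \<open>c + d\<close>, large enough for the relation over the base flat.\<close>
lemma absorb_power:
  assumes U: "U \<subseteq> L" "upset U" and G: "G \<in> L" and K: "K \<in> U" "G \<subset> K"
    and c: "rk G \<le> c + rk F" and d: "rk K \<le> d + rk G"
  shows "upper_sum U G ^ c * upper_sum U K ^ d \<in> fy_ideal F U"
proof -
  have fU: "finite U" using U finite_flats finite_subset by blast
  have KL: "K \<in> L" using U K by auto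
  have "{P. P \<in> U \<and> G \<subseteq> P} = {P. P \<in> U \<and> K \<subseteq> P} \<union> {P \<in> U. G \<subseteq> P \<and> \<not> K \<subseteq> P}" using K by auto
  then have "upper_sum U G = upper_sum U K + (\<Sum>P\<in>{P \<in> U. G \<subseteq> P \<and> \<not> K \<subseteq> P}. pvar P)"
    unfolding upper_sum_def by (simp only:) (rule sum.union_disjoint, use fU in auto)
  then have "(upper_sum U G - upper_sum U K) * upper_sum U K ^ d = (\<Sum>P\<in>{P \<in> U. G \<subseteq> P \<and> \<not> K \<subseteq> P}. pvar P * upper_sum U K ^ d)"
    by (simp add: sum_distrib_right)
  also have "\<dots> \<in> fy_ideal F U"
  proof (rule ring_ideal.span_sum)
    fix P assume P: "P \<in> {P \<in> U. G \<subseteq> P \<and> \<not> K \<subseteq> P}"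
    have "rk G \<le> rk (K \<inter> P)" by (rule rank_mono) (use P K in auto)
    then show "pvar P * upper_sum U K ^ d \<in> fy_ideal F U" using P d by (intro absorb[OF U KL]) auto
  qed
  finally have 1: "(upper_sum U G - upper_sum U K) * upper_sum U K ^ d \<in> fy_ideal F U" .
  have 2: "upper_sum U G ^ n * upper_sum U K ^ d - upper_sum U K ^ (n + d) \<in> fy_ideal F U" for n
  proof (induction n)
    case 0 then show ?case by (simp add: ring_ideal.span_zero)
  next
    case (Suc n)
    have e: "upper_sum U G ^ Suc n * upper_sum U K ^ d - upper_sum U K ^ (Suc n + d) =
      upper_sum U G * (upper_sum U G ^ n * upper_sum U K ^ d - upper_sum U K ^ (n + d)) + upper_sum U K ^ n * ((upper_sum U G - upper_sum U K) * upper_sum U K ^ d)"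
      by (simp add: algebra_simps power_add)
    show ?case unfolding e by (intro ring_ideal.span_add ideal_mult Suc 1)
  qed
  have 3: "upper_sum U K ^ (c + d) \<in> fy_ideal F U" by (rule fy_ideal_power) (use K c d in auto)
  from ring_ideal.span_add[OF 2[of c] 3] show ?thesis by simp
qed

lemma ideal_span_induct:
  assumes "x \<in> ideal_span S" "P 0" "\<And>x y. P x \<Longrightarrow> P y \<Longrightarrow> P (x + y)" "\<And>a s. s \<in> S \<Longrightarrow> P (a * s)"
  shows "P x"
  using assms(1)
proof (induction rule: ring_ideal.span_induct_alt)
  case base then show ?case by fact
next
  case (step c x y)
  then show ?case using assms(3,4) by blast
qed

text \<open>A polynomial regarded as a polynomial in \<open>x\<^sub>G\<close> over the others.\<close>
definition split_var :: "'a set \<Rightarrow> 'a set qpoly \<Rightarrow> 'a set qpoly poly" where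
  "split_var G = poly_subst (\<lambda>q. [:pconst q:]) (\<lambda>v. if v = G then [:0, 1:] else [:pvar v:])"

text \<open>Restriction to the exceptional divisor over \<open>G\<close>. The target is to be read modulo \<open>t^c\<close>: it is a projective bundle over
  the space for the flats above \<open>G\<close>, with fibre coordinate \<open>t = x\<^sub>G + h\<close>, where \<open>h\<close> is the sum of the variables above \<open>G\<close>.\<close>
definition exc_restrict :: "'a set set \<Rightarrow> 'a set \<Rightarrow> 'a set qpoly \<Rightarrow> 'a set qpoly poly" where
  "exc_restrict U G = poly_subst (\<lambda>q. [:pconst q:]) (\<lambda>v. if v = G then [:- upper_sum U G, 1:] else if v \<in> above G then [:pvar v:] else 0)"

context
  fixes F G :: "'a set" and U :: "'a set set"
  assumes F: "F \<in> L" and U: "U \<subseteq> above F" "upset U" and G: "G \<in> above F" "G \<notin> U"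
    and up: "upset (insert G U)"
begin

lemma GL: "G \<in> L" and FG: "F \<subset> G" and UL: "U \<subseteq> L" and UF: "\<And>K. K \<in> U \<Longrightarrow> F \<subset> K"
  using F U G by (auto simp: above_def)

lemma above_G_U: "above G \<subseteq> U" using up by (auto simp: above_def upset_def)

lemma not_below_G: "K \<in> U \<Longrightarrow> \<not> K \<subseteq> G" using U(2) G(2) GL by (auto simp: upset_def)

lemma finite_U: "finite U" using UL finite_flats finite_subset by blast

lemma upper_sum_insert: "K \<in> U \<Longrightarrow> upper_sum (insert G U) K = upper_sum U K"
  unfolding upper_sum_def by (rule sum.cong) (use not_below_G in auto)

lemma upper_sum_G: "upper_sum (insert G U) G = pvar G + upper_sum U G"
proof -
  have "{N. N \<in> insert G U \<and> G \<subseteq> N} = insert G {N. N \<in> U \<and> G \<subseteq> N}" by auto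
  then show ?thesis unfolding upper_sum_def using G finite_U by simp
qed

lemma above_G_eq: "{N. N \<in> U \<and> G \<subseteq> N} = above G"
  using above_G_U G UL by (auto simp: above_def)

lemma split_const: "H \<noteq> G \<Longrightarrow> split_var G (pvar H) = [:pvar H:]"
  by (simp add: split_var_def)

lemma split_upper_sum: "split_var G (upper_sum U K) = [:upper_sum U K:]"
proof -
  have "split_var G (upper_sum U K) = (\<Sum>N | N \<in> U \<and> K \<subseteq> N. [:pvar N:])"
    unfolding upper_sum_def split_var_def cpconst.poly_subst_sum by (intro sum.cong) (use G in auto)
  also have "\<dots> = [:upper_sum U K:]" unfolding upper_sum_def
    by (induction "{N. N \<in> U \<and> K \<subseteq> N}" rule: infinite_finite_induct) (auto simp: poly_eq_iff coeff_pCons coeff_sum split: nat.split)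
  finally show ?thesis .
qed

lemma split_ops: "split_var G (p + q) = split_var G p + split_var G q" "split_var G (p * q) = split_var G p * split_var G q"
  "split_var G (p ^ n) = split_var G p ^ n" "split_var G (pvar G) = [:0, 1:]" "split_var G 0 = 0"
  by (simp_all add: split_var_def cpconst.poly_subst_add cpconst.poly_subst_mult cpconst.poly_subst_power)

lemma exc_restrict_ops: "exc_restrict U G (p + q) = exc_restrict U G p + exc_restrict U G q" "exc_restrict U G (p * q) = exc_restrict U G p * exc_restrict U G q"
  "exc_restrict U G (p ^ n) = exc_restrict U G p ^ n" "exc_restrict U G (pvar G) = [:- upper_sum U G, 1:]" "exc_restrict U G 0 = 0"
  by (simp_all add: exc_restrict_def cpconst.poly_subst_add cpconst.poly_subst_mult cpconst.poly_subst_power)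

lemma const_power: "[:a:] ^ n = [:a ^ n :: 'r :: comm_ring_1:]"
  by (induction n) (auto simp: one_pCons)

definition exc_codim where "exc_codim = rk G - rk F"

lemma exc_codim: "0 < exc_codim" "exc_codim + rk F = rk G"
  using flat_rank_less[OF F GL FG] by (auto simp: exc_codim_def)

lemma coeff_functional_monom_const: "coeff_functional s (monom 1 k * [:a:]) = a * s k"
proof -
  have "monom 1 k * [:a:] = monom a k" by (simp add: smult_monom)
  then show ?thesis by (simp add: coeff_functional_monom)
qed

lemma push_coeff_ideal: "0 < k \<Longrightarrow> upper_sum U G ^ exc_codim * x \<in> fy_ideal F U \<Longrightarrow> push_coeff exc_codim (upper_sum U G) k * x \<in> fy_ideal F U"
proof -
  assume k: "0 < k" and x: "upper_sum U G ^ exc_codim * x \<in> fy_ideal F U"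
  obtain y where "push_coeff exc_codim (upper_sum U G) k = upper_sum U G ^ exc_codim * y" using push_coeff_dvd[OF exc_codim(1) k] by (auto elim: dvdE)
  then have "push_coeff exc_codim (upper_sum U G) k * x = y * (upper_sum U G ^ exc_codim * x)" by (simp add: mult_ac)
  then show ?thesis using ideal_mult[OF x] by simp
qed

text \<open>The push-forward maps the ideal of the new stage into that of the previous one. The relation
  \<open>(x\<^sub>G + h)^c\<close> goes to \<open>0\<close> by the recurrence, and every positive power of \<open>x\<^sub>G\<close> produces a factor \<open>h^c\<close>, which is absorbed by each
  of the other relations that involve \<open>x\<^sub>G\<close>.\<close>
lemma pushforward:
  assumes "p \<in> fy_ideal F (insert G U)"
  shows "coeff_functional (push_coeff exc_codim (upper_sum U G)) (split_var G p) \<in> fy_ideal F U"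
  using assms
proof (rule ideal_span_induct)
  let ?s = "push_coeff exc_codim (upper_sum U G)"
  show "coeff_functional ?s (split_var G 0) \<in> fy_ideal F U" by (simp add: split_ops ring_ideal.span_zero)
  show "coeff_functional ?s (split_var G (x + y)) \<in> fy_ideal F U" if "coeff_functional ?s (split_var G x) \<in> fy_ideal F U" "coeff_functional ?s (split_var G y) \<in> fy_ideal F U" for x y
    using that by (simp add: split_ops coeff_functional_add ring_ideal.span_add)
  fix a g assume g: "g \<in> fy_relations F (insert G U)"
  have "coeff_functional ?s (monom 1 k * split_var G g) \<in> fy_ideal F U" for k
  proof -
    have const: ?thesis if "split_var G g = [:x:]" "x \<in> fy_ideal F U" for x
      using that by (simp only: coeff_functional_monom_const ideal_mult')
    have lin: ?thesis if "split_var G g = [:0, 1:] * [:x:]" "upper_sum U G ^ exc_codim * x \<in> fy_ideal F U" for x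
    proof -
      have "monom 1 k * split_var G g = monom 1 (Suc k) * [:x:]"
        unfolding that(1) by (simp add: monom_Suc smult_monom)
      then have "coeff_functional ?s (monom 1 k * split_var G g) = ?s (Suc k) * x" by (simp only: coeff_functional_monom_const mult.commute[of x])
      then show ?thesis using push_coeff_ideal[of "Suc k" x] that by simp
    qed
    from g show ?thesis
    proof (cases rule: fy_relationsE)
      case (var H) then show ?thesis by (intro const[of "pvar H"] fy_ideal_var) (auto simp: split_const)
    next
      case (inc H K)
      have *: ?thesis if "g = pvar G * pvar N" "N \<in> U" "\<not> G \<subseteq> N" for N
      proof (rule lin[of "pvar N"])
        have "N \<noteq> G" using that G by auto
        then show "split_var G g = [:0, 1:] * [:pvar N:]" using that by (simp add: split_ops split_const)
        have "rk F \<le> rk (G \<inter> N)" by (rule rank_mono) (use FG UF[OF that(2)] in auto)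
        then have "pvar N * upper_sum U G ^ exc_codim \<in> fy_ideal F U" using exc_codim that by (intro absorb[OF UL U(2) GL]) auto
        then show "upper_sum U G ^ exc_codim * pvar N \<in> fy_ideal F U" by (simp only: mult.commute)
      qed
      show ?thesis
      proof (cases "H = G \<or> K = G")
        case True
        then show ?thesis
        proof
          assume "H = G" then show ?thesis using *[of K] inc by auto
        next
          assume "K = G" then show ?thesis using *[of H] inc by (auto simp: mult.commute[of "pvar G"])
        qed
      next
        case False
        then show ?thesis using inc
          by (intro const[of "pvar H * pvar K"] fy_ideal_incomparable) (auto simp: split_ops split_const)
      qed
    next
      case (pow K)
      show ?thesis
      proof (cases "K = G")
        case False
        then have "K \<in> U" using pow by auto
        then show ?thesis using pow
          by (intro const[of "upper_sum U K ^ (rk K - rk F)"] fy_ideal_power) (auto simp: upper_sum_insert split_ops split_upper_sum const_power)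
      next
        case True
        let ?h = "upper_sum U G"
        have "split_var G g = ([:0, 1:] + [:?h:]) ^ exc_codim"
          unfolding pow True upper_sum_G by (simp only: split_ops split_upper_sum exc_codim_def)
        also have "\<dots> = (\<Sum>i\<le>exc_codim. of_nat (exc_codim choose i) * [:0, 1:] ^ i * [:?h:] ^ (exc_codim - i))"
          by (rule binomial_ring)
        finally have "monom 1 k * split_var G g = (\<Sum>i\<le>exc_codim. monom (of_nat (exc_codim choose i) * ?h ^ (exc_codim - i)) (k + i))"
        proof -
          assume e: "split_var G g = (\<Sum>i\<le>exc_codim. of_nat (exc_codim choose i) * [:0, 1:] ^ i * [:?h:] ^ (exc_codim - i))"
          have "monom 1 k * (of_nat (exc_codim choose i) * [:0, 1:] ^ i * [:?h:] ^ (exc_codim - i)) = monom (of_nat (exc_codim choose i) * ?h ^ (exc_codim - i)) (k + i)" for i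
            by (simp add: const_power of_nat_poly X_power_monom mult_monom smult_monom)
          then show ?thesis unfolding e sum_distrib_left by simp
        qed
        then have "coeff_functional ?s (monom 1 k * split_var G g) = (\<Sum>i\<le>exc_codim. of_nat (exc_codim choose i) * ?h ^ (exc_codim - i) * ?s (k + i))"
          by (simp add: coeff_functional_sum coeff_functional_monom)
        also have "\<dots> = 0" by (rule push_coeff_rec[OF exc_codim(1)])
        finally show ?thesis by (simp add: ring_ideal.span_zero)
      qed
    next
      case (vpow H K)
      have K: "K \<in> U" "K \<noteq> G" using vpow not_below_G[of H] by auto
      show ?thesis
      proof (cases "H = G")
        case False
        then have "H \<in> U" using vpow by auto
        have "split_var G g = [:pvar H * upper_sum U K ^ (rk K - rk H):]"
          unfolding vpow upper_sum_insert[OF K(1)] split_ops split_const[OF False] split_upper_sum const_power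
          by (simp add: mult.commute)
        then show ?thesis by (rule const) (rule fy_ideal_var_power; use vpow K \<open>H \<in> U\<close> in simp)
      next
        case True
        show ?thesis
        proof (rule lin)
          show "split_var G g = [:0, 1:] * [:upper_sum U K ^ (rk K - rk G):]"
            unfolding vpow True upper_sum_insert[OF K(1)] by (simp only: split_ops split_upper_sum const_power)
          show "upper_sum U G ^ exc_codim * upper_sum U K ^ (rk K - rk G) \<in> fy_ideal F U"
            by (rule absorb_power[OF UL U(2) GL K(1)]) (use vpow True exc_codim in auto)
        qed
      qed
    qed
  qed
  then show "coeff_functional ?s (split_var G (a * g)) \<in> fy_ideal F U"
    unfolding split_ops by (rule coeff_functional_mult_ideal)
qed

lemma exc_restrict_var: "H \<noteq> G \<Longrightarrow> exc_restrict U G (pvar H) = (if H \<in> above G then [:pvar H:] else 0)"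
  by (simp add: exc_restrict_def)

lemma exc_restrict_upper_sum: assumes "K \<in> U"
  shows "exc_restrict U G (upper_sum U K) = [:upper_sum (above G) (join G K):]" "join G K \<in> above G"
proof -
  have KL: "K \<in> L" using assms UL by auto
  show J: "join G K \<in> above G"
    using join_flat[OF GL KL] join_upper[OF GL KL] not_below_G[OF assms] by (auto simp: above_def)
  have "exc_restrict U G (upper_sum U K) = (\<Sum>N | N \<in> U \<and> K \<subseteq> N. if N \<in> above G then [:pvar N:] else 0)"
    unfolding upper_sum_def exc_restrict_def cpconst.poly_subst_sum by (intro sum.cong) (use G in auto)
  also have "\<dots> = (\<Sum>N | N \<in> above G \<and> join G K \<subseteq> N. [:pvar N:])"
  proof (rule sum.mono_neutral_cong_right)
    show "{N. N \<in> above G \<and> join G K \<subseteq> N} \<subseteq> {N. N \<in> U \<and> K \<subseteq> N}"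
      using above_G_U join_upper[OF GL KL] by auto
    show "\<forall>N\<in>{N. N \<in> U \<and> K \<subseteq> N} - {N. N \<in> above G \<and> join G K \<subseteq> N}. (if N \<in> above G then [:pvar N:] else 0) = 0"
      using join_least[of _ G K] by (auto simp: above_def)
  qed (use finite_U in auto)
  also have "\<dots> = [:upper_sum (above G) (join G K):]" unfolding upper_sum_def
    by (induction "{N. N \<in> above G \<and> join G K \<subseteq> N}" rule: infinite_finite_induct) (auto simp: poly_eq_iff coeff_pCons coeff_sum split: nat.split)
  finally show "exc_restrict U G (upper_sum U K) = [:upper_sum (above G) (join G K):]" .
qed

text \<open>The restriction maps the ideal of the new stage into \<open>t^c\<close> and the ideal of the flats above \<open>G\<close>. An upper sum of \<open>K\<close> becomes
  that of the join of \<open>G\<close> and \<open>K\<close>, and semimodularity keeps its exponent large enough.\<close>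
lemma restriction:
  assumes "p \<in> fy_ideal F (insert G U)" "j < exc_codim"
  shows "coeff (exc_restrict U G p) j \<in> fy_ideal G (above G)"
proof -
  define X where "X = {q :: 'a set qpoly poly. \<forall>j<exc_codim. coeff q j \<in> fy_ideal G (above G)}"
  have X_mult: "a * q \<in> X" if "q \<in> X" for a q
    using that unfolding X_def by (auto intro: coeff_ideal_mult)
  have X_mult': "q * a \<in> X" if "q \<in> X" for a q using X_mult[OF that, of a] by (simp only: mult.commute)
  have X_const: "[:x:] \<in> X" if "x \<in> fy_ideal G (above G)" for x
    using that by (auto simp: X_def coeff_pCons ring_ideal.span_zero split: nat.split)
  have X_0: "0 \<in> X" by (simp add: X_def ring_ideal.span_zero)
  have "exc_restrict U G p \<in> X" using assms(1)
  proof (rule ideal_span_induct)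
    show "exc_restrict U G 0 \<in> X" using X_0 by (simp add: exc_restrict_ops)
    show "exc_restrict U G (x + y) \<in> X" if "exc_restrict U G x \<in> X" "exc_restrict U G y \<in> X" for x y
      using that by (auto simp: X_def exc_restrict_ops ring_ideal.span_add)
    fix a g assume g: "g \<in> fy_relations F (insert G U)"
    from g have gX: "exc_restrict U G g \<in> X"
    proof (cases rule: fy_relationsE)
      case (var H)
      then have "exc_restrict U G g = 0" using above_G_U by (auto simp: exc_restrict_var)
      then show ?thesis using X_0 by simp
    next
      case (inc H K)
      have *: ?thesis if "g = pvar A * pvar B" "A \<noteq> G" "A \<notin> above G" for A B
        using that X_0 by (simp add: exc_restrict_ops exc_restrict_var)
      consider "H \<noteq> G \<and> H \<notin> above G" | "K \<noteq> G \<and> K \<notin> above G" | "G \<subseteq> H" "G \<subseteq> K"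
        by (auto simp: above_def)
      then show ?thesis
      proof cases
        case 1 then show ?thesis using *[of H K] inc by auto
      next
        case 2 then show ?thesis using *[of K H] inc by (auto simp: mult.commute)
      next
        case 3
        then have "H \<in> above G" "K \<in> above G" "H \<noteq> G" "K \<noteq> G" using inc UL GL by (auto simp: above_def)
        moreover from this have "exc_restrict U G g = [:pvar H * pvar K:]" using inc by (simp add: exc_restrict_ops exc_restrict_var)
        ultimately show ?thesis using X_const fy_ideal_incomparable inc by auto
      qed
    next
      case (pow K)
      show ?thesis
      proof (cases "K = G")
        case False
        then have K: "K \<in> U" using pow by auto
        then have KL: "K \<in> L" using UL by auto
        have "rk F \<le> rk (G \<inter> K)" by (rule rank_mono) (use FG UF[OF K] in auto)
        moreover have "rk F < rk K" using flat_rank_less[OF F KL UF[OF K]] .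
        ultimately have r: "rk (join G K) \<le> (rk K - rk F) + rk G" using rank_join[OF GL KL] by linarith
        have "exc_restrict U G g = [:upper_sum (above G) (join G K) ^ (rk K - rk F):]"
          unfolding pow upper_sum_insert[OF K] by (simp only: exc_restrict_ops exc_restrict_upper_sum[OF K] const_power)
        then show ?thesis using X_const[OF fy_ideal_power[OF exc_restrict_upper_sum(2)[OF K] r]] by simp
      next
        case True
        have "exc_restrict U G (upper_sum U G) = (\<Sum>N\<in>above G. [:pvar N:])"
          unfolding upper_sum_def exc_restrict_def cpconst.poly_subst_sum above_G_eq by (intro sum.cong) (auto simp: above_def)
        also have "\<dots> = [:upper_sum U G:]" unfolding upper_sum_def above_G_eq
          by (induction "above G" rule: infinite_finite_induct) (auto simp: poly_eq_iff coeff_pCons coeff_sum split: nat.split)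
        finally have "exc_restrict U G g = monom 1 exc_codim"
          unfolding pow True upper_sum_G by (simp add: exc_restrict_ops X_power_monom exc_codim_def)
        then show ?thesis by (auto simp: X_def ring_ideal.span_zero)
      qed
    next
      case (vpow H K)
      have K: "K \<in> U" "K \<noteq> G" using vpow not_below_G[of H] by auto
      show ?thesis
      proof (cases "G \<subseteq> H")
        case False
        then have "H \<noteq> G" "H \<notin> above G" by (auto simp: above_def)
        then show ?thesis using X_0 vpow by (simp add: exc_restrict_ops exc_restrict_var)
      next
        case True
        then have KG: "K \<in> above G" using vpow K UL by (auto simp: above_def)
        have "join G K = K"
          unfolding join_def using KG cl_of_flat by (metis (no_types, lifting) above_def mem_Collect_eq psubset_imp_subset sup.absorb2)
        then have r: "exc_restrict U G g = exc_restrict U G (pvar H) * [:upper_sum (above G) K ^ (rk K - rk H):]"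
          unfolding vpow upper_sum_insert[OF K(1)] by (simp only: exc_restrict_ops exc_restrict_upper_sum[OF K(1)] const_power)
        show ?thesis
        proof (cases "H = G")
          case True
          then have "upper_sum (above G) K ^ (rk K - rk H) \<in> fy_ideal G (above G)"
            by (intro fy_ideal_power[OF KG]) auto
          then show ?thesis unfolding r by (intro X_mult X_const)
        next
          case False
          then have H: "H \<in> above G" using True vpow UL by (auto simp: above_def)
          have "pvar H * upper_sum (above G) K ^ (rk K - rk H) \<in> fy_ideal G (above G)"
            by (rule fy_ideal_var_power[OF H KG]) (use vpow in auto)
          then show ?thesis unfolding r using False H X_const by (simp add: exc_restrict_var mult.commute)
        qed
      qed
    qed
    show "exc_restrict U G (a * g) \<in> X" unfolding exc_restrict_ops by (rule X_mult[OF gX])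
  qed
  then show ?thesis using assms(2) by (simp add: X_def)
qed

end

end

lemma lookup_single_minus: "lookup (m - single G (lookup m G)) v =
   (if v = G then 0 else lookup m (v :: 'v) :: nat)"
  by (simp add: Poly_Mapping.lookup_minus Poly_Mapping.lookup_single when_def)

lemma minus_single_add: "m - single G (lookup m G) + single G (lookup m G) = (m :: 'v \<Rightarrow>\<^sub>0 nat)"
  by (rule poly_mapping_eqI) (simp add: Poly_Mapping.lookup_add lookup_single_minus Poly_Mapping.lookup_single when_def)

context loopless_matroid
begin

lemma split_var_monom: "split_var G (single m c) =
   monom (single (m - single G (lookup m G)) c) (lookup m G)"
proof -
  define k where "k = lookup m G"
  define m' where "m' = m - single G k"
  define f where "f v = (if v = G then [:0, 1:] else [:pvar v:])" for v :: "'a set"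
  have m: "m = m' + single G k" unfolding m'_def k_def by (rule minus_single_add[symmetric])
  have G: "G \<notin> keys m'" unfolding m'_def k_def by (simp add: in_keys_iff lookup_single_minus)
  have "monom_subst f m' = monom_subst (\<lambda>v. [:pvar v:]) m'" by (rule monom_subst_cong) (use G in \<open>auto simp: f_def\<close>)
  also have "\<dots> = [:monom_subst pvar m':]"
  proof -
    have path_word: "[:a:] ^ n = [:a ^ n:]" for a :: "'a set qpoly" and n by (induction n) (auto simp: one_pCons)
    have "(\<Prod>v\<in>A. [:g v:]) = [:\<Prod>v\<in>A. g v:]" if "finite A" for A and g :: "'a set \<Rightarrow> 'a set qpoly"
      using that by (induction A rule: finite_induct) (auto simp: one_pCons)
    then show ?thesis by (simp add: monom_subst_def path_word)
  qed
  finally have "monom_subst f m = [:single m' 1:] * [:0, 1:] ^ k"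
    unfolding m by (simp add: monom_subst_add monom_subst_single f_def monom_subst_pvar)
  then have "split_var G (single m c) = [:pconst c * single m' 1:] * [:0, 1:] ^ k"
    unfolding split_var_def f_def[symmetric] cpconst.poly_subst_single by (simp add: mult.commute)
  also have "pconst c * single m' 1 = single m' c"
    by (simp add: pconst_def mult_single)
  also have "[:single m' c:] * [:0, 1:] ^ k = monom (single m' c) k"
    by (simp add: X_power_monom Polynomial.smult_monom)
  finally show ?thesis by (simp add: m'_def k_def)
qed

lemma lookup_coeff_split_var:
  "lookup (coeff (split_var G p) k) e =
     (if lookup e G = 0 then lookup p (e + single G k) else 0)"
proof -
  have "split_var G p = (\<Sum>m\<in>keys p. split_var G (single m (lookup p m)))"
    by (subst (1) sum_single_keys[of p, symmetric]) (simp add: split_var_def cpconst.poly_subst_sum)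
  then have "lookup (coeff (split_var G p) k) e =
    (\<Sum>m\<in>keys p. if lookup m G = k \<and> m - single G (lookup m G) = e then lookup p m else 0)"
    by (auto simp: split_var_monom coeff_sum Poly_Mapping.lookup_sum coeff_monom Poly_Mapping.lookup_single when_def intro!: sum.cong)
  also have "\<dots> = (\<Sum>m\<in>keys p. if m = e + single G k \<and> lookup e G = 0 then lookup p m else 0)"
  proof (intro sum.cong refl if_cong)
    fix m
    show "(lookup m G = k \<and> m - single G (lookup m G) = e) \<longleftrightarrow>
      (m = e + single G k \<and> lookup e G = 0)" (is "?l \<longleftrightarrow> ?r")
    proof
      assume ?l
      then show ?r using minus_single_add[of m G] lookup_single_minus[of m G G] by auto
    next
      assume r: ?r
      then have "lookup m G = k" by (simp add: Poly_Mapping.lookup_add)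
      then show ?l using r by simp
    qed
  qed
  also have "\<dots> = (if lookup e G = 0 then lookup p (e + single G k) else 0)"
    by (cases "lookup e G = 0") (auto simp: in_keys_iff)
  finally show ?thesis .
qed

text \<open>The exponent bound is required against every smaller flat of the chain and the base flat; it is the bound for the nearest one
  that is the strongest.\<close>
definition fy_exps :: "'a set \<Rightarrow> 'a set set \<Rightarrow> ('a set \<Rightarrow>\<^sub>0 nat) set" where
  "fy_exps F U = {m. keys m \<subseteq> U \<and> (\<forall>H\<in>keys m. \<forall>K\<in>keys m. H \<subseteq> K \<or> K \<subseteq> H) \<and>
     (\<forall>K\<in>keys m. \<forall>H\<in>insert F (keys m). H \<subset> K \<longrightarrow> lookup m K + rk H < rk K)}"

lemma fy_exps_remove:
  assumes "G \<notin> U" "lookup e G = 0" "e \<in> fy_exps F (insert G U)"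
  shows "e \<in> fy_exps F U"
  using assms by (auto simp: fy_exps_def in_keys_iff)

lemma fy_exps_above:
  assumes up: "upset (insert G U)" "U \<subseteq> above F" "upset U" "G \<in> above F" "G \<notin> U"
    and e: "lookup e G = 0" and k: "0 < k" and fy_exps: "e + single G k \<in> fy_exps F (insert G U)"
  shows "e \<in> fy_exps G (above G)" "k + rk F < rk G"
proof -
  let ?m = "e + single G k"
  have km: "keys ?m = insert G (keys e)"
    using k by (auto simp: in_keys_iff Poly_Mapping.lookup_add Poly_Mapping.lookup_single when_def split: if_splits)
  have lm: "lookup ?m K = lookup e K" if "K \<in> keys e" for K
    using that e by (auto simp: Poly_Mapping.lookup_add Poly_Mapping.lookup_single when_def in_keys_iff)
  have lG: "lookup ?m G = k" using e by (simp add: Poly_Mapping.lookup_add)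
  show "k + rk F < rk G" using fy_exps up(4) km lG unfolding fy_exps_def above_def by fastforce
  have "K \<in> above G" if K: "K \<in> keys e" for K
  proof -
    have "K \<noteq> G" using K e by (auto simp: in_keys_iff)
    moreover have "K \<in> U" using fy_exps km K \<open>K \<noteq> G\<close> by (auto simp: fy_exps_def)
    moreover have "K \<subseteq> G \<or> G \<subseteq> K" using fy_exps km K by (auto simp: fy_exps_def)
    moreover have "\<not> K \<subseteq> G" using up \<open>K \<in> U\<close> by (auto simp: upset_def above_def)
    ultimately show ?thesis using up(2) by (auto simp: above_def)
  qed
  then show "e \<in> fy_exps G (above G)" using fy_exps km lm unfolding fy_exps_def by auto
qed

text \<open>Induction on the number of flats in \<open>U\<close>. A flat \<open>G\<close> of least rank is removed. A combination \<open>p\<close> of basis monomials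
  in the ideal is \<open>p\<^sub>0 + x\<^sub>G p\<^sub>1 + \<cdots>\<close> of degree below \<open>c = rk G - rk F\<close> in \<open>x\<^sub>G\<close>. The push-forward of \<open>p\<close> is \<open>p\<^sub>0\<close>, a
  combination of basis monomials over \<open>U - {G}\<close>, so \<open>p\<^sub>0 = 0\<close>. The remaining coefficients involve only flats above \<open>G\<close>; the restriction of \<open>p\<close> is
  the sum of the \<open>(t - h)^k p\<^sub>k\<close>, of degree below \<open>c\<close> in \<open>t\<close>, so each \<open>p\<^sub>k\<close> lies in the ideal over the base flat \<open>G\<close> and
  vanishes as well.\<close>
lemma fy_exps_independent:
  assumes "F \<in> L" "U \<subseteq> above F" "upset U" "keys p \<subseteq> fy_exps F U" "p \<in> fy_ideal F U"
  shows "p = 0"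
  using assms
proof (induction "card U" arbitrary: F U p rule: less_induct)
  case less
  have finU: "finite U" using less(3) finite_above finite_subset by blast
  show ?case
  proof (cases "U = {}")
    case True
    then have k: "keys p \<subseteq> {0}" using less(5) by (auto simp: fy_exps_def)
    then have p: "p = single 0 (lookup p 0)"
      by (intro poly_mapping_eqI) (auto simp: Poly_Mapping.lookup_single when_def in_keys_iff)
    have "poly_subst pconst (\<lambda>_. 0 :: 'a set qpoly) p = 0"
      using less(6) unfolding True
    proof (rule ideal_span_induct)
      fix a g assume "g \<in> fy_relations F {}"
      then show "poly_subst pconst (\<lambda>_. 0 :: 'a set qpoly) (a * g) = 0" by (auto simp: fy_relations_def pconst.poly_subst_mult)
    qed (auto simp: pconst.poly_subst_add)
    then have "pconst (lookup p 0) = (0 :: 'a set qpoly)"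
      by (subst (asm) p) (simp only: pconst.poly_subst_single monom_subst_0 mult_1_right)
    then have "lookup p 0 = 0" by (metis pconst_def lookup_single_eq lookup_zero)
    then show ?thesis using p by simp
  next
    case False
    then obtain G where G: "G \<in> U" "\<And>K. K \<in> U \<Longrightarrow> rk G \<le> rk K"
      using ex_has_least_nat[of "\<lambda>K. K \<in> U" _ rk] by blast
    define V where "V = U - {G}"
    have UV: "U = insert G V" "G \<notin> V" using G by (auto simp: V_def)
    have UL: "U \<subseteq> L" using less(3) by (auto simp: above_def)
    have V: "V \<subseteq> above F" "upset V"
    proof -
      show "V \<subseteq> above F" using less(3) UV by auto
      show "upset V" unfolding upset_def
      proof (intro ballI impI)
        fix K N assume KN: "K \<in> V" "N \<in> L" "K \<subseteq> N"
        have "N \<noteq> G"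
        proof
          assume "N = G"
          then have "K \<subset> G" using KN UV by auto
          then have "rk K < rk G" using flat_rank_less[of K G] KN UL UV G by auto
          then show False using G(2)[of K] KN UV by auto
        qed
        then show "N \<in> V" using less(4) KN UV by (auto simp: upset_def)
      qed
    qed
    have Ga: "G \<in> above F" using G less(3) by auto
    have up: "upset (insert G V)" using less(4) UV by simp
    have GL: "G \<in> L" using G UL by auto
    note ctx = less(2) V Ga UV(2) up
    note FYa = fy_exps_above[OF up V Ga UV(2)]
    have cV: "card V < card U" unfolding V_def by (rule card_Diff1_less[OF finU G(1)])
    have cA: "card (above G) < card U"
    proof -
      have "above G \<subseteq> V" by (rule above_G_U[OF ctx])
      then have "card (above G) \<le> card V" by (rule card_mono[rotated]) (use finU in \<open>auto simp: V_def\<close>)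
      then show ?thesis using cV by simp
    qed
    define q where "q = split_var G p"
    define c where "c = exc_codim F G"
    have c: "0 < c" "c + rk F = rk G" using exc_codim[OF ctx] by (simp_all add: c_def)
    have keys_q: "e + single G k \<in> fy_exps F (insert G V) \<and> lookup e G = 0"
      if "e \<in> keys (coeff q k)" for e k
      using that less(5) UV(1) unfolding q_def by (auto simp: in_keys_iff lookup_coeff_split_var split: if_splits)
    have keys_q0: "keys (coeff q 0) \<subseteq> fy_exps F V"
      using keys_q[of _ 0] fy_exps_remove[OF UV(2)] by auto
    have keys_qk: "keys (coeff q k) \<subseteq> fy_exps G (above G)" if "0 < k" for k
      using keys_q[of _ k] FYa(1) that by blast
    have q_high: "coeff q k = 0" if "c \<le> k" for k
    proof (rule ccontr)
      assume "coeff q k \<noteq> 0"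
      then obtain e where e: "e \<in> keys (coeff q k)" by fastforce
      have "0 < k" using that c by simp
      then have "k + rk F < rk G" using keys_q[OF e] FYa(2)[of e k] by blast
      then show False using that c by simp
    qed
    have deg: "degree q < c"
      using q_high[of "degree q"] c by (cases "q = 0") (auto intro: ccontr simp: not_less)
    have "coeff q 0 = 0"
    proof -
      have "coeff_functional (push_coeff c (upper_sum V G)) q = (\<Sum>k\<le>degree q. if k = 0 then coeff q 0 else 0)"
        unfolding coeff_functional_def by (intro sum.cong) (use deg in \<open>auto simp: push_coeff_0 push_coeff_small\<close>)
      then have "coeff_functional (push_coeff c (upper_sum V G)) q = coeff q 0" by simp
      moreover have "coeff_functional (push_coeff c (upper_sum V G)) q \<in> fy_ideal F V"
        unfolding q_def c_def by (rule pushforward[OF ctx]) (use less(6) UV in simp)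
      ultimately have "coeff q 0 \<in> fy_ideal F V" by simp
      then show ?thesis by (rule less(1)[OF cV less(2) V keys_q0])
    qed
    have G_in: "0 < lookup m G" if "m \<in> keys p" for m
    proof (rule ccontr)
      assume "\<not> ?thesis"
      then have "lookup (coeff q 0) m = lookup p m"
        by (simp add: q_def lookup_coeff_split_var)
      then show False using that \<open>coeff q 0 = 0\<close> by (simp add: in_keys_iff)
    qed
    have r: "exc_restrict V G p = pcompose q [:- upper_sum V G, 1:]"
      unfolding q_def split_var_def pcompose_poly_subst exc_restrict_def
    proof (rule poly_subst_cong)
      fix m v assume m: "m \<in> keys p" and v: "v \<in> keys m"
      define e where "e = m - single G (lookup m G)"
      have eG: "lookup e G = 0" unfolding e_def by (simp add: lookup_single_minus)
      have "e + single G (lookup m G) \<in> fy_exps F (insert G V)"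
        unfolding e_def minus_single_add using m less(5) UV by auto
      from FYa(1)[OF eG G_in[OF m] this] have "keys e \<subseteq> above G" by (simp add: fy_exps_def)
      moreover have "v \<in> keys e" if "v \<noteq> G"
        using v that by (simp add: e_def in_keys_iff lookup_single_minus)
      ultimately show "(if v = G then [:- upper_sum V G, 1:] else if v \<in> above G then [:pvar v:] else 0) =
        pcompose (if v = G then [:0, 1:] else [:pvar v:]) [:- upper_sum V G, 1:]"
        by (auto simp: pcompose_pCons)
    qed
    have "degree (exc_restrict V G p) \<le> degree q * degree [:- upper_sum V G, 1:]"
      unfolding r by (rule degree_pcompose_le)
    then have degr: "degree (exc_restrict V G p) < c" using deg by simp
    have "coeff (exc_restrict V G p) j \<in> fy_ideal G (above G)" for j
    proof (cases "j < c")
      case True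
      then show ?thesis using restriction[OF ctx, of p j] less(6) UV by (simp add: c_def)
    next
      case False
      then show ?thesis using degr by (simp add: coeff_eq_0 ring_ideal.span_zero)
    qed
    then have "coeff (pcompose (exc_restrict V G p) [:upper_sum V G, 1:]) j \<in> fy_ideal G (above G)" for j
      by (rule coeff_ideal_pcompose)
    moreover have "pcompose (exc_restrict V G p) [:upper_sum V G, 1:] = q"
      unfolding r by (simp add: pcompose_assoc[symmetric] pcompose_pCons pcompose_idR)
    ultimately have qI: "coeff q k \<in> fy_ideal G (above G)" for k by simp
    have "coeff q k = 0" if "0 < k" for k
      by (rule less(1)[OF cA GL order_refl above_upset(1) keys_qk[OF that] qI])
    then have q0: "coeff q k = 0" for k using \<open>coeff q 0 = 0\<close> by (cases k) auto
    show "p = 0"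
    proof (rule poly_mapping_eqI)
      fix m
      have "lookup (coeff q (lookup m G)) (m - single G (lookup m G)) = lookup p m"
        unfolding q_def lookup_coeff_split_var by (simp add: lookup_single_minus minus_single_add)
      then show "lookup p m = lookup 0 m" by (simp add: q0)
    qed
  qed
qed

end

section \<open>The Feichtner-Yuzvinsky monomials span\<close>

definition exp_weight :: "('v \<Rightarrow> nat) \<Rightarrow> ('v \<Rightarrow>\<^sub>0 nat) \<Rightarrow> nat" where
  "exp_weight w m = (\<Sum>v\<in>keys m. lookup m v * w v)"

lemma exp_weight_superset: "finite A \<Longrightarrow> keys m \<subseteq> A \<Longrightarrow> exp_weight w m = (\<Sum>v\<in>A. lookup m v * w v)"
  unfolding exp_weight_def by (rule sum.mono_neutral_left) (auto simp: in_keys_iff)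

lemma exp_weight_add: "exp_weight w (m + n) = exp_weight w m + exp_weight w n"
proof -
  let ?A = "keys m \<union> keys n"
  have "keys (m + n) \<subseteq> ?A" by (rule Poly_Mapping.keys_add)
  then show ?thesis
    by (simp add: exp_weight_superset[of ?A] Poly_Mapping.lookup_add sum.distrib algebra_simps)
qed

lemma exp_weight_single: "exp_weight w (single v k) = k * w v"
  by (simp add: exp_weight_superset[of "{v}"])

abbreviation exp_deg :: "('v \<Rightarrow>\<^sub>0 nat) \<Rightarrow> nat" where "exp_deg \<equiv> exp_weight (\<lambda>_. 1)"

lemma homogeneous_exp_deg: "homogeneous d p \<longleftrightarrow> (\<forall>m\<in>keys p. exp_deg m = d)"
  by (simp add: homogeneous_def exp_weight_def)

text \<open>Besides fixing the degree this bounds a weight, which decreases under the rewriting in \<open>fy_exps_spanning\<close>.\<close>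
definition bounded_by :: "('v \<Rightarrow> nat) \<Rightarrow> nat \<Rightarrow> nat \<Rightarrow> 'v qpoly \<Rightarrow> bool" where
  "bounded_by w d t p \<longleftrightarrow> (\<forall>m\<in>keys p. exp_deg m = d \<and> exp_weight w m \<le> t)"

lemma bounded_by_mult:
  assumes "bounded_by w d t p" "bounded_by w d' t' q"
  shows "bounded_by w (d + d') (t + t') (p * q)"
  unfolding bounded_by_def
proof
  fix m assume "m \<in> keys (p * q)"
  then obtain a b where "m = a + b" "a \<in> keys p" "b \<in> keys q"
    using Poly_Mapping.keys_mult[of p q] by blast
  then show "exp_deg m = d + d' \<and> exp_weight w m \<le> t + t'"
    using assms by (auto simp: bounded_by_def exp_weight_add add_mono)
qed

lemma bounded_by_add: "bounded_by w d t p \<Longrightarrow> bounded_by w d t q \<Longrightarrow> bounded_by w d t (p + q)"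
  unfolding bounded_by_def using Poly_Mapping.keys_add[of p q] by blast

lemma bounded_by_0: "bounded_by w d t 0" by (simp add: bounded_by_def)
lemma bounded_by_1: "bounded_by w 0 0 1" by (simp add: bounded_by_def exp_weight_def)

lemma bounded_by_sum: "(\<And>i. i \<in> I \<Longrightarrow> bounded_by w d t (f i)) \<Longrightarrow> bounded_by w d t (\<Sum>i\<in>I. f i)"
  by (induction I rule: infinite_finite_induct) (auto simp: bounded_by_0 bounded_by_add)

lemma bounded_by_power: "bounded_by w d t p \<Longrightarrow> bounded_by w (n * d) (n * t) (p ^ n)"
proof (induction n)
  case 0 then show ?case by (simp add: bounded_by_1)
next
  case (Suc n)
  then show ?case using bounded_by_mult[of w d t p "n * d" "n * t" "p ^ n"] by simp
qed

lemma bounded_by_pvar: "w v \<le> t \<Longrightarrow> bounded_by w 1 t (pvar v)"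
  by (simp add: bounded_by_def pvar_def exp_weight_single)

lemma bounded_by_monom: "bounded_by w (exp_deg m) (exp_weight w m) (single m 1)"
  by (simp add: bounded_by_def)

lemma bounded_by_mono: "bounded_by w d t p \<Longrightarrow> t \<le> t' \<Longrightarrow> bounded_by w d t' p"
  by (auto simp: bounded_by_def)

lemma monom_split:
  assumes "k \<le> lookup m v"
  shows "single m (1::rat) = single (m - single v k) 1 * pvar v ^ k"
    and "m = (m - single v k) + single v k"
proof -
  show "m = (m - single v k) + single v k"
    by (rule poly_mapping_eqI) (use assms in \<open>auto simp: Poly_Mapping.lookup_add Poly_Mapping.lookup_minus Poly_Mapping.lookup_single when_def\<close>)
  then show "single m (1::rat) = single (m - single v k) 1 * pvar v ^ k"
    by (simp add: pvar_power mult_single)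
qed

context loopless_matroid
begin

text \<open>A monomial outside the basis contains a factor \<open>x\<^sub>H x\<^sub>K^c\<close> with \<open>c = rk K - rk H\<close>, or \<open>x\<^sub>K^c\<close> with \<open>c = rk K - rk F\<close>,
  unless a relation kills it outright. The relation with leading term \<open>x\<^sub>K^c\<close> replaces \<open>x\<^sub>K^c\<close> by terms in which at least
  one \<open>x\<^sub>K\<close> has become a variable of larger rank. Weighting a variable by its corank makes this terminate.\<close>
lemma fy_exps_spanning:
  assumes UL: "U \<subseteq> L" and p: "homogeneous d p"
  shows "\<exists>q. keys q \<subseteq> fy_exps F U \<and> homogeneous d q \<and> p - q \<in> fy_ideal F U"
proof -
  have finU: "finite U" using UL finite_flats finite_subset by blast
  \<comment> \<open>the successor keeps the weight of the ground set positive\<close>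
  define w where "w v = Suc (rk E) - rk v" for v
  define X where "X d = {p. \<exists>q. keys q \<subseteq> fy_exps F U \<and> homogeneous d q \<and> p - q \<in> fy_ideal F U}" for d
  have X_fy_ideal: "p \<in> X d" if "p \<in> fy_ideal F U" for p d
    unfolding X_def using that by (intro CollectI exI[of _ 0]) (simp add: homogeneous_def)
  have X_add: "p + p' \<in> X d" if pp: "p \<in> X d" "p' \<in> X d" for p p' d
  proof -
    obtain q q' where q: "keys q \<subseteq> fy_exps F U" "homogeneous d q" "p - q \<in> fy_ideal F U"
      "keys q' \<subseteq> fy_exps F U" "homogeneous d q'" "p' - q' \<in> fy_ideal F U"
      using pp unfolding X_def by blast
    have k: "keys (q + q') \<subseteq> keys q \<union> keys q'" by (rule Poly_Mapping.keys_add)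
    have e: "(p + p') - (q + q') = (p - q) + (p' - q')" by simp
    have "(p + p') - (q + q') \<in> fy_ideal F U" unfolding e by (rule ring_ideal.span_add[OF q(3,6)])
    moreover have "keys (q + q') \<subseteq> fy_exps F U" using k q by blast
    moreover have "homogeneous d (q + q')" using k q unfolding homogeneous_def by blast
    ultimately show ?thesis unfolding X_def by blast
  qed
  have X_scale: "pconst c * p \<in> X d" if pp: "p \<in> X d" for p d c
  proof -
    obtain q where q: "keys q \<subseteq> fy_exps F U" "homogeneous d q" "p - q \<in> fy_ideal F U"
      using pp unfolding X_def by blast
    have k: "keys (pconst c * q) \<subseteq> keys q"
    proof
      fix x assume "x \<in> keys (pconst c * q)"
      then obtain a b where "x = a + b" "a \<in> keys (pconst c :: 'a set qpoly)" "b \<in> keys q"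
        using Poly_Mapping.keys_mult[of "pconst c" q] by blast
      then show "x \<in> keys q" by (auto simp: pconst_def split: if_splits)
    qed
    have "pconst c * p - pconst c * q = pconst c * (p - q)" by (simp add: algebra_simps)
    then have "pconst c * p - pconst c * q \<in> fy_ideal F U" using ideal_mult[OF q(3)] by simp
    moreover have "homogeneous d (pconst c * q)" using k q unfolding homogeneous_def by blast
    ultimately show ?thesis unfolding X_def using k q by blast
  qed
  have X_monoms: "p \<in> X d" if "\<And>m. m \<in> keys p \<Longrightarrow> single m 1 \<in> X d" for p d
  proof -
    have s: "(\<Sum>i\<in>I. f i) \<in> X d" if "\<And>i. i \<in> I \<Longrightarrow> f i \<in> X d" for I and f :: "('a set \<Rightarrow>\<^sub>0 nat) \<Rightarrow> _"
      using that by (induction I rule: infinite_finite_induct) (auto intro: X_add X_fy_ideal ring_ideal.span_zero)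
    have e: "pconst c * single m 1 = single m c" for c and m :: "'a set \<Rightarrow>\<^sub>0 nat"
      by (simp add: pconst_def mult_single)
    have "(\<Sum>m\<in>keys p. pconst (lookup p m) * single m 1) \<in> X d"
      by (intro s X_scale that)
    then show ?thesis by (simp add: e sum_single_keys)
  qed
  have monom: "single m 1 \<in> X (exp_deg m)" for m
  proof (induction "exp_weight w m" arbitrary: m rule: less_induct)
    case less
    show ?case
    proof (cases "m \<in> fy_exps F U")
      case True
      then show ?thesis unfolding X_def
        by (intro CollectI exI[of _ "single m 1"]) (auto simp: homogeneous_exp_deg ring_ideal.span_zero)
    next
      case False
      then consider (var) v where "v \<in> keys m" "v \<notin> U"
        | (inc) H K where "keys m \<subseteq> U" "H \<in> keys m" "K \<in> keys m" "\<not> H \<subseteq> K" "\<not> K \<subseteq> H"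
        | (big) H K where "keys m \<subseteq> U" "K \<in> keys m" "H \<in> insert F (keys m)" "H \<subset> K"
            "rk K \<le> lookup m K + rk H"
      proof (cases "keys m \<subseteq> U")
        case False then show ?thesis using var by blast
      next
        case kU: True
        show ?thesis
        proof (cases "\<forall>H\<in>keys m. \<forall>K\<in>keys m. H \<subseteq> K \<or> K \<subseteq> H")
          case True
          then obtain K H where "K \<in> keys m" "H \<in> insert F (keys m)" "H \<subset> K"
            "\<not> lookup m K + rk H < rk K"
            using False kU unfolding fy_exps_def by blast
          then show ?thesis using big[of K H] kU by linarith
        next
          case False then show ?thesis using inc kU by blast
        qed
      qed
      then show ?thesis
      proof cases
        case (var v)
        then have "single m 1 = single (m - single v 1) 1 * pvar v ^ 1"
          by (intro monom_split) (auto simp: in_keys_iff)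
        then show ?thesis using ideal_mult[OF fy_ideal_var[OF var(2)]] by (intro X_fy_ideal) simp
      next
        case (inc H K)
        let ?m = "m - single H 1"
        have 1: "single m (1::rat) = single ?m 1 * pvar H ^ 1"
          by (rule monom_split) (use inc in \<open>auto simp: in_keys_iff\<close>)
        have "lookup ?m K = lookup m K"
          using inc by (auto simp: Poly_Mapping.lookup_minus Poly_Mapping.lookup_single when_def)
        then have 2: "single ?m (1::rat) = single (?m - single K 1) 1 * pvar K ^ 1"
          by (intro monom_split) (use inc in \<open>auto simp: in_keys_iff\<close>)
        have "single m 1 = single (?m - single K 1) 1 * (pvar H * pvar K)"
          unfolding 1 2 by (simp add: mult_ac)
        then show ?thesis using ideal_mult[OF fy_ideal_incomparable[of H U K]] inc by (intro X_fy_ideal) auto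
      next
        case (big H K)
        have KU: "K \<in> U" and KL: "K \<in> L" using big UL by auto
        define c where "c = rk K - rk H"
        define m0 where "m0 = m - single K c"
        let ?h = "upper_sum U K"
        have cl: "c \<le> lookup m K" using big by (simp add: c_def)
        note ms = monom_split[OF cl, folded m0_def]
        have in1: "single m0 1 * ?h ^ c \<in> fy_ideal F U"
        proof (cases "H = F")
          case True
          then show ?thesis unfolding c_def using KU by (intro ideal_mult fy_ideal_power) auto
        next
          case False
          then have H: "H \<in> keys m" "H \<noteq> K" using big by auto
          then have "1 \<le> lookup m0 H"
            by (auto simp: m0_def Poly_Mapping.lookup_minus Poly_Mapping.lookup_single when_def in_keys_iff)
          from monom_split(1)[OF this]
          have "single m0 1 * ?h ^ c = single (m0 - single H 1) 1 * (pvar H * ?h ^ c)"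
            by (simp add: mult_ac)
          moreover have "pvar H * ?h ^ c \<in> fy_ideal F U"
            unfolding c_def by (rule fy_ideal_var_power) (use H big KU in auto)
          ultimately show ?thesis using ideal_mult by simp
        qed
        have lower: "single m0 1 * (?h ^ c - pvar K ^ c) \<in> X (exp_deg m)"
        proof (cases "c = 0")
          case True then show ?thesis using X_fy_ideal[OF ring_ideal.span_zero] by simp
        next
          case False
          have KK: "{N. N \<in> U \<and> K \<subseteq> N} = insert K {N \<in> U. K \<subset> N}" using KU by auto
          have h: "?h - pvar K = (\<Sum>N\<in>{N \<in> U. K \<subset> N}. pvar N)"
            unfolding upper_sum_def KK using finU by (subst sum.insert) auto
          have wle: "w N \<le> w K - 1" if "N \<in> U" "K \<subset> N" for N
            using flat_rank_less[OF KL _ that(2)] that(1) UL flat_rank_le by (force simp: w_def)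
          have b1: "bounded_by w 1 (w K - 1) (?h - pvar K)"
            unfolding h by (intro bounded_by_sum bounded_by_pvar) (use wle in auto)
          have "bounded_by w 1 (w K) (pvar K)" by (rule bounded_by_pvar) simp
          moreover have "bounded_by w 1 (w K) (?h - pvar K)" by (rule bounded_by_mono[OF b1]) simp
          ultimately have "bounded_by w 1 (w K) ((?h - pvar K) + pvar K)" by (rule bounded_by_add[rotated])
          then have b2: "bounded_by w 1 (w K) ?h" by simp
          have b3: "bounded_by w (c - 1) ((c - 1) * w K) (\<Sum>i<c. pvar K ^ (c - Suc i) * ?h ^ i)"
          proof (rule bounded_by_sum)
            fix i assume i: "i \<in> {..<c}"
            have "bounded_by w ((c - Suc i) * 1 + i * 1) ((c - Suc i) * w K + i * w K) (pvar K ^ (c - Suc i) * ?h ^ i)"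
              by (intro bounded_by_mult bounded_by_power b2 bounded_by_pvar) simp
            moreover have "(c - Suc i) * 1 + i * 1 = c - 1" using i by auto
            moreover have "(c - Suc i) * w K + i * w K = (c - 1) * w K"
              unfolding distrib_right[symmetric] using i by auto
            ultimately show "bounded_by w (c - 1) ((c - 1) * w K) (pvar K ^ (c - Suc i) * ?h ^ i)" by simp
          qed
          have "?h ^ c - pvar K ^ c = (?h - pvar K) * (\<Sum>i<c. pvar K ^ (c - Suc i) * ?h ^ i)"
            by (rule power_diff_sumr2)
          then have "bounded_by w (1 + (c - 1)) ((w K - 1) + (c - 1) * w K) (?h ^ c - pvar K ^ c)"
            using bounded_by_mult[OF b1 b3] by simp
          then have "bounded_by w (exp_deg m0 + (1 + (c - 1))) (exp_weight w m0 + ((w K - 1) + (c - 1) * w K)) (single m0 1 * (?h ^ c - pvar K ^ c))"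
            by (intro bounded_by_mult bounded_by_monom)
          moreover have "exp_deg m0 + (1 + (c - 1)) = exp_deg m"
            by (subst ms(2)) (use False in \<open>simp add: exp_weight_add exp_weight_single\<close>)
          moreover have "exp_weight w m0 + ((w K - 1) + (c - 1) * w K) < exp_weight w m"
          proof -
            have "0 < w K" using flat_rank_le[OF KL] by (simp add: w_def)
            moreover have "c * w K = w K + (c - 1) * w K" using False by (cases c) auto
            ultimately show ?thesis by (subst ms(2)) (simp add: exp_weight_add exp_weight_single)
          qed
          ultimately have low: "\<forall>m'\<in>keys (single m0 1 * (?h ^ c - pvar K ^ c)). exp_deg m' = exp_deg m \<and> exp_weight w m' < exp_weight w m"
            unfolding bounded_by_def by fastforce
          show ?thesis
          proof (rule X_monoms)
            fix m' assume "m' \<in> keys (single m0 1 * (?h ^ c - pvar K ^ c))"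
            then have m': "exp_deg m' = exp_deg m" "exp_weight w m' < exp_weight w m" using low by blast+
            show "single m' 1 \<in> X (exp_deg m)" using less[OF m'(2)] unfolding m'(1) .
          qed
        qed
        have "single m0 1 * ?h ^ c + pconst (- 1) * (single m0 1 * (?h ^ c - pvar K ^ c)) \<in> X (exp_deg m)"
          by (intro X_add X_fy_ideal in1 X_scale lower)
        moreover have "pconst (- 1) = (- 1 :: 'a set qpoly)"
          using pconst_add[of 1 "-1"] by (simp add: pconst_1 pconst.\<phi>_0 eq_neg_iff_add_eq_0 add.commute)
        ultimately show ?thesis unfolding ms(1) by (simp add: algebra_simps)
      qed
    qed
  qed
  have "p \<in> X d" by (rule X_monoms) (use monom p in \<open>auto simp: homogeneous_exp_deg\<close>)
  then show ?thesis by (simp add: X_def)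
qed

end

section \<open>The Chow ring in terms of the Feichtner-Yuzvinsky ideal\<close>

lemma qpoly_ring_simps [simp]:
  "p \<otimes>\<^bsub>qpoly_ring V\<^esub> q = p * q" "p \<oplus>\<^bsub>qpoly_ring V\<^esub> q = p + q" "\<one>\<^bsub>qpoly_ring V\<^esub> = 1" "\<zero>\<^bsub>qpoly_ring V\<^esub> = 0"
  "mult (qpoly_ring V) = (*)" "add (qpoly_ring V) = (+)"
  by (simp_all add: qpoly_ring_def)

lemma qpoly_carrier: "p \<in> carrier (qpoly_ring V) \<longleftrightarrow> (\<forall>m\<in>keys p. keys m \<subseteq> V)"
  by (simp add: qpoly_ring_def)

lemma qpoly_carrier_add: "p \<in> carrier (qpoly_ring V) \<Longrightarrow> q \<in> carrier (qpoly_ring V) \<Longrightarrow> p + q \<in> carrier (qpoly_ring V)"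
  unfolding qpoly_carrier using Poly_Mapping.keys_add[of p q] by blast

lemma qpoly_carrier_mult:
  assumes "p \<in> carrier (qpoly_ring V)" "q \<in> carrier (qpoly_ring V)"
  shows "p * q \<in> carrier (qpoly_ring V)"
  unfolding qpoly_carrier
proof
  fix m assume "m \<in> keys (p * q)"
  then obtain a b where m: "m = a + b" "a \<in> keys p" "b \<in> keys q"
    using Poly_Mapping.keys_mult[of p q] by blast
  then have "keys a \<subseteq> V" "keys b \<subseteq> V" using assms by (auto simp: qpoly_carrier)
  then show "keys m \<subseteq> V" using Poly_Mapping.keys_add[of a b] m by blast
qed

lemma qpoly_carrier_uminus: "p \<in> carrier (qpoly_ring V) \<Longrightarrow> - p \<in> carrier (qpoly_ring V)"
  by (simp add: qpoly_carrier in_keys_iff)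

lemma qpoly_carrier_diff: "p \<in> carrier (qpoly_ring V) \<Longrightarrow> q \<in> carrier (qpoly_ring V) \<Longrightarrow> p - q \<in> carrier (qpoly_ring V)"
  using qpoly_carrier_add[OF _ qpoly_carrier_uminus, of p V q] by simp

lemma qpoly_carrier_0: "0 \<in> carrier (qpoly_ring V)" and qpoly_carrier_1: "1 \<in> carrier (qpoly_ring V)"
  and qpoly_carrier_pconst: "pconst c \<in> carrier (qpoly_ring V)"
  by (auto simp: qpoly_carrier pconst_def)

lemma qpoly_carrier_pvar: "v \<in> V \<Longrightarrow> pvar v \<in> carrier (qpoly_ring V)"
  by (auto simp: qpoly_carrier pvar_def)

lemma qpoly_carrier_sum: "(\<And>i. i \<in> I \<Longrightarrow> f i \<in> carrier (qpoly_ring V)) \<Longrightarrow> (\<Sum>i\<in>I. f i) \<in> carrier (qpoly_ring V)"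
  by (induction I rule: infinite_finite_induct) (auto simp: qpoly_carrier_0 qpoly_carrier_add)

lemma qpoly_carrier_power: "p \<in> carrier (qpoly_ring V) \<Longrightarrow> p ^ n \<in> carrier (qpoly_ring V)"
  by (induction n) (auto simp: qpoly_carrier_1 qpoly_carrier_mult)

lemma qpoly_carrier_prod: "(\<And>i. i \<in> I \<Longrightarrow> f i \<in> carrier (qpoly_ring V)) \<Longrightarrow> (\<Prod>i\<in>I. f i) \<in> carrier (qpoly_ring V)"
  by (induction I rule: infinite_finite_induct) (auto simp: qpoly_carrier_1 qpoly_carrier_mult)

lemma qpoly_carrier_poly_subst: "(\<And>v. f v \<in> carrier (qpoly_ring V)) \<Longrightarrow> poly_subst pconst f p \<in> carrier (qpoly_ring V)"
  unfolding poly_subst_def monom_subst_def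
  by (intro qpoly_carrier_sum qpoly_carrier_mult qpoly_carrier_pconst qpoly_carrier_prod qpoly_carrier_power)

lemma qpoly_cring: "cring (qpoly_ring V)"
proof (rule cringI)
  show "abelian_group (qpoly_ring V)"
  proof (rule abelian_groupI)
    fix x assume "x \<in> carrier (qpoly_ring V)"
    then show "\<exists>y\<in>carrier (qpoly_ring V). y \<oplus>\<^bsub>qpoly_ring V\<^esub> x = \<zero>\<^bsub>qpoly_ring V\<^esub>"
      by (intro bexI[of _ "- x"]) (auto simp: qpoly_carrier_uminus)
  qed (auto simp: qpoly_carrier_add qpoly_carrier_0 add.assoc add.commute)
  show "Group.comm_monoid (qpoly_ring V)"
    by (rule comm_monoidI) (auto simp: qpoly_carrier_mult qpoly_carrier_1 mult.assoc mult.commute)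
qed (auto simp: algebra_simps)

lemma qpoly_a_minus: "p \<in> carrier (qpoly_ring V) \<Longrightarrow> \<ominus>\<^bsub>qpoly_ring V\<^esub> p = - p"
proof -
  interpret cring "qpoly_ring V" by (rule qpoly_cring)
  assume "p \<in> carrier (qpoly_ring V)"
  then show ?thesis using minus_equality[of "- p" p] by (simp add: qpoly_carrier_uminus)
qed

context loopless_matroid
begin

definition nonempty_flats :: "'a set set" where "nonempty_flats = L - {{}}"

lemma nonempty_flats_above: "nonempty_flats = above {}" by (auto simp: nonempty_flats_def above_def)
lemma nonempty_flats_upset: "upset nonempty_flats" by (auto simp: upset_def nonempty_flats_def)
lemma nonempty_flats_L: "nonempty_flats \<subseteq> L" by (auto simp: nonempty_flats_def)
lemma finite_nonempty_flats: "finite nonempty_flats" using nonempty_flats_L finite_flats finite_subset by blast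

abbreviation "R \<equiv> chow_poly_ring M"
lemma R_def: "R = qpoly_ring nonempty_flats" by (simp add: chow_poly_ring_def nonempty_flats_def)
lemma R_simps [simp]:
  "p \<otimes>\<^bsub>R\<^esub> q = p * q" "p \<oplus>\<^bsub>R\<^esub> q = p + q" "\<one>\<^bsub>R\<^esub> = 1" "\<zero>\<^bsub>R\<^esub> = 0"
  by (simp_all add: R_def)

abbreviation "chow_fy_ideal \<equiv> fy_ideal {} nonempty_flats"

definition incomparable_products :: "'a set qpoly set" where
  "incomparable_products = {pvar F * pvar F' | F F'. F \<in> L - {{}} \<and> F' \<in> L - {{}} \<and> \<not> F \<subseteq> F' \<and> \<not> F' \<subseteq> F}"
definition atom_sums :: "'a set qpoly set" where
  "atom_sums = {\<Sum>F\<in>{F \<in> L. i \<in> F}. pvar F | i. i \<in> E}"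
text \<open>The variables that do not belong to the Chow ring; adding them as relations replaces its polynomial ring by the one on all
  variables.\<close>
definition foreign_vars :: "'a set qpoly set" where "foreign_vars = {pvar H | H. H \<notin> nonempty_flats}"

lemma atom_relation: assumes "i \<in> E"
  shows "(\<Sum>F\<in>{F \<in> L. i \<in> F}. pvar F) = upper_sum nonempty_flats (cl {i})" "cl {i} \<in> nonempty_flats" "rk (cl {i}) = 1"
proof -
  have i: "{i} \<subseteq> E" using assms by simp
  have c: "cl {i} \<in> L" "i \<in> cl {i}" using cl_flat[OF i] subset_cl[OF i] by auto
  then show "cl {i} \<in> nonempty_flats" by (auto simp: nonempty_flats_def)
  have "rk (cl {i}) = Suc (rk {})"
    using rank_cl_insert[OF empty_flat assms] by simp
  then show "rk (cl {i}) = 1" by (simp add: rank_empty)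
  have "{F \<in> L. i \<in> F} = {N. N \<in> nonempty_flats \<and> cl {i} \<subseteq> N}"
    using c(2) cl_minimal[of _ "{i}"] by (auto simp: nonempty_flats_def)
  then show "(\<Sum>F\<in>{F \<in> L. i \<in> F}. pvar F) = upper_sum nonempty_flats (cl {i})" by (simp add: upper_sum_def)
qed

lemma incomparable_products_chow_fy_ideal: "incomparable_products \<subseteq> chow_fy_ideal"
  using fy_ideal_incomparable[of _ nonempty_flats _ "{}"] by (auto simp: incomparable_products_def nonempty_flats_def)

lemma atom_sums_chow_fy_ideal: "atom_sums \<subseteq> chow_fy_ideal"
proof
  fix x assume "x \<in> atom_sums"
  then obtain i where i: "i \<in> E" "x = upper_sum nonempty_flats (cl {i})" using atom_relation(1) by (auto simp: atom_sums_def)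
  have "upper_sum nonempty_flats (cl {i}) ^ 1 \<in> chow_fy_ideal" by (rule fy_ideal_power) (use atom_relation[OF i(1)] in auto)
  then show "x \<in> chow_fy_ideal" using i by simp
qed

text \<open>Induction on the exponent \<open>d\<close>. For \<open>i\<close> in \<open>K - H\<close>, one factor of the power of the upper sum of \<open>K\<close> is the linear
  form of \<open>i\<close> minus the variables \<open>x\<^sub>N\<close> with \<open>i\<close> in \<open>N\<close> but not \<open>K \<subseteq> N\<close>. Such an \<open>N\<close> is incomparable with \<open>H\<close> or contains it;
  then \<open>K \<inter> N\<close> has larger rank than \<open>H\<close>, so by semimodularity the relation for \<open>N\<close> and the join of \<open>K\<close> and \<open>N\<close> needs only
  the exponent \<open>d - 1\<close>.\<close>
lemma chow_fy_ideal_from_relations: "chow_fy_ideal \<subseteq> ideal_span (incomparable_products \<union> atom_sums \<union> foreign_vars)"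
proof -
  let ?S = "incomparable_products \<union> atom_sums \<union> foreign_vars"
  have inc: "pvar N * pvar P \<in> ideal_span ?S" if "N \<in> nonempty_flats" "P \<in> nonempty_flats" "\<not> N \<subseteq> P" "\<not> P \<subseteq> N" for N P
    by (rule ring_ideal.span_base) (use that in \<open>auto simp: incomparable_products_def nonempty_flats_def\<close>)
  \<comment> \<open>the empty flat has no variable and stands for the unit\<close>
  define y where "y H = (if H = {} then 1 else pvar H :: 'a set qpoly)" for H :: "'a set"
  have main: "y H * upper_sum nonempty_flats K ^ d \<in> ideal_span ?S"
    if "H \<in> insert {} nonempty_flats" "K \<in> nonempty_flats" "H \<subset> K" "rk K \<le> rk H + d" for H K d
    using that
  proof (induction d arbitrary: H K)
    case 0
    have "rk H < rk K" by (rule flat_rank_less) (use 0 empty_flat in \<open>auto simp: nonempty_flats_def\<close>)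
    then show ?case using 0 by simp
  next
    case (Suc d)
    have HL: "H \<in> L" and KL: "K \<in> L" using Suc.prems empty_flat by (auto simp: nonempty_flats_def)
    obtain i where i: "i \<in> K" "i \<notin> H" using Suc.prems by auto
    have iE: "i \<in> E" using i flat_sub_E[OF KL] by auto
    have theta: "(\<Sum>F\<in>{F \<in> L. i \<in> F}. pvar F) \<in> ideal_span ?S"
      by (rule ring_ideal.span_base) (use iE in \<open>auto simp: atom_sums_def\<close>)
    have "{F \<in> L. i \<in> F} = {N. N \<in> nonempty_flats \<and> K \<subseteq> N} \<union> {N \<in> nonempty_flats. i \<in> N \<and> \<not> K \<subseteq> N}"
      using i by (auto simp: nonempty_flats_def)
    then have split: "(\<Sum>F\<in>{F \<in> L. i \<in> F}. pvar F) = upper_sum nonempty_flats K + (\<Sum>N\<in>{N \<in> nonempty_flats. i \<in> N \<and> \<not> K \<subseteq> N}. pvar N)"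
      unfolding upper_sum_def by (simp only:) (rule sum.union_disjoint, use finite_nonempty_flats in auto)
    have each: "y H * pvar N * upper_sum nonempty_flats K ^ d \<in> ideal_span ?S" if N: "N \<in> {N \<in> nonempty_flats. i \<in> N \<and> \<not> K \<subseteq> N}" for N
    proof (cases "H \<subseteq> N")
      case False
      then have "H \<in> nonempty_flats" "H \<noteq> {}" "\<not> N \<subseteq> H" using Suc.prems(1) N i by auto
      then have "y H * pvar N \<in> ideal_span ?S" using inc[of H N] N False by (simp add: y_def)
      then show ?thesis by (rule ideal_mult')
    next
      case True
      have NL: "N \<in> L" "N \<in> nonempty_flats" "N \<noteq> {}" using N by (auto simp: nonempty_flats_def)
      define J where "J = join K N"
      have J: "J \<in> L" "K \<subseteq> J" "N \<subseteq> J" "\<And>P. P \<in> L \<Longrightarrow> K \<subseteq> P \<Longrightarrow> N \<subseteq> P \<Longrightarrow> J \<subseteq> P"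
        using join_flat join_upper join_least KL NL by (auto simp: J_def)
      have JV: "J \<in> nonempty_flats" using J NL by (auto simp: nonempty_flats_def)
      have "H \<subset> K \<inter> N" using True Suc.prems(3) N i by auto
      then have "rk H < rk (K \<inter> N)" by (rule flat_rank_less[OF HL flat_Int[OF KL NL(1)]])
      then have "rk J \<le> rk N + d" using rank_join[OF KL NL(1)] Suc.prems(4) by (simp add: J_def)
      moreover have "N \<subset> J" using J N by auto
      ultimately have "y N * upper_sum nonempty_flats J ^ d \<in> ideal_span ?S" using Suc.IH[of N J] NL JV by auto
      then have 1: "pvar N * upper_sum nonempty_flats J ^ d \<in> ideal_span ?S" using NL by (simp add: y_def)
      have 2: "pvar N * upper_sum nonempty_flats K ^ d - pvar N * upper_sum nonempty_flats J ^ d \<in> ideal_span ?S"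
        unfolding J_def by (rule join_shift[OF nonempty_flats_L nonempty_flats_upset KL NL(2) _ inc]) (use N in auto)
      from ring_ideal.span_add[OF 2 1] have "pvar N * upper_sum nonempty_flats K ^ d \<in> ideal_span ?S" by simp
      then have "y H * (pvar N * upper_sum nonempty_flats K ^ d) \<in> ideal_span ?S" by (rule ideal_mult)
      then show ?thesis by (simp add: mult.assoc)
    qed
    have eq: "y H * upper_sum nonempty_flats K ^ Suc d = y H * upper_sum nonempty_flats K ^ d * (\<Sum>F\<in>{F \<in> L. i \<in> F}. pvar F) -
       (\<Sum>N\<in>{N \<in> nonempty_flats. i \<in> N \<and> \<not> K \<subseteq> N}. y H * pvar N * upper_sum nonempty_flats K ^ d)"
    proof -
      have "(\<Sum>N\<in>{N \<in> nonempty_flats. i \<in> N \<and> \<not> K \<subseteq> N}. y H * pvar N * upper_sum nonempty_flats K ^ d) =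
        y H * upper_sum nonempty_flats K ^ d * (\<Sum>N\<in>{N \<in> nonempty_flats. i \<in> N \<and> \<not> K \<subseteq> N}. pvar N)"
        unfolding sum_distrib_left by (intro sum.cong refl) (simp only: mult_ac)
      then show ?thesis unfolding split by (simp add: algebra_simps)
    qed
    show ?case unfolding eq by (intro ring_ideal.span_diff ideal_mult theta ring_ideal.span_sum each)
  qed
  have "fy_relations {} nonempty_flats \<subseteq> ideal_span ?S"
  proof
    fix g assume "g \<in> fy_relations {} nonempty_flats"
    then show "g \<in> ideal_span ?S"
    proof (cases rule: fy_relationsE)
      case (var H)
      then show ?thesis by (intro ring_ideal.span_base) (auto simp: foreign_vars_def)
    next
      case (inc H K)
      then show ?thesis using \<open>\<And>N P. N \<in> nonempty_flats \<Longrightarrow> P \<in> nonempty_flats \<Longrightarrow> \<not> N \<subseteq> P \<Longrightarrow> \<not> P \<subseteq> N \<Longrightarrow> pvar N * pvar P \<in> ideal_span ?S\<close> by blast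
    next
      case (pow K)
      then show ?thesis using main[of "{}" K "rk K - rk {}"] by (auto simp: nonempty_flats_def y_def rank_empty)
    next
      case (vpow H K)
      then have "H \<noteq> {}" by (auto simp: nonempty_flats_def)
      then show ?thesis using main[of H K "rk K - rk H"] vpow by (auto simp: y_def)
    qed
  qed
  then show ?thesis by (metis ring_ideal.span_minimal ring_ideal.subspace_span)
qed

lemma chow_fy_ideal_ideal: "ideal (chow_fy_ideal \<inter> carrier R) R"
proof -
  interpret cring R unfolding R_def by (rule qpoly_cring)
  show ?thesis
  proof (rule idealI)
    show "ring R" by (rule ring_axioms)
    show "subgroup (chow_fy_ideal \<inter> carrier R) (add_monoid R)"
    proof (rule add.subgroupI)
      show "chow_fy_ideal \<inter> carrier R \<subseteq> carrier R" by auto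
      show "chow_fy_ideal \<inter> carrier R \<noteq> {}" using ring_ideal.span_zero[of "fy_relations {} nonempty_flats"] qpoly_carrier_0[of nonempty_flats] by (auto simp: R_def)
      fix a b assume a: "a \<in> chow_fy_ideal \<inter> carrier R"
      show "\<ominus>\<^bsub>R\<^esub> a \<in> chow_fy_ideal \<inter> carrier R"
        using a ring_ideal.span_neg[of a "fy_relations {} nonempty_flats"] by (auto simp: R_def qpoly_a_minus qpoly_carrier_uminus)
      assume b: "b \<in> chow_fy_ideal \<inter> carrier R"
      show "a \<oplus>\<^bsub>R\<^esub> b \<in> chow_fy_ideal \<inter> carrier R" using a b by (auto simp: R_def qpoly_carrier_add ring_ideal.span_add)
    qed
  qed (auto simp: R_def qpoly_carrier_mult intro: ideal_mult ideal_mult')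
qed

lemma incomparable_products_R: "incomparable_products \<subseteq> carrier R"
  by (auto simp: incomparable_products_def R_def nonempty_flats_def intro!: qpoly_carrier_mult qpoly_carrier_pvar)

lemma atom_sums_R: "atom_sums \<subseteq> carrier R"
  by (auto simp: atom_sums_def R_def nonempty_flats_def intro!: qpoly_carrier_sum qpoly_carrier_pvar)

text \<open>The Chow ideal is formed inside the polynomial ring on the nonempty flats, the other one in the ring on all variables. The
  retraction that kills the foreign variables carries a representation of an element in the large ring to one in the small ring.\<close>
lemma chow_ideal_eq: "chow_ideal M = chow_fy_ideal \<inter> carrier R"
proof
  interpret cring R unfolding R_def by (rule qpoly_cring)
  interpret chow_fy_ideal: ideal "chow_fy_ideal \<inter> carrier R" R by (rule chow_fy_ideal_ideal)
  have I: "chow_I M = Idl\<^bsub>R\<^esub> incomparable_products" and J: "chow_J M = Idl\<^bsub>R\<^esub> atom_sums"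
    by (simp_all add: chow_I_def chow_J_def incomparable_products_def atom_sums_def)
  have IJ1: "chow_I M \<subseteq> chow_fy_ideal \<inter> carrier R" unfolding I
    by (rule genideal_minimal[OF chow_fy_ideal_ideal]) (use incomparable_products_chow_fy_ideal incomparable_products_R in auto)
  have IJ2: "chow_J M \<subseteq> chow_fy_ideal \<inter> carrier R" unfolding J
    by (rule genideal_minimal[OF chow_fy_ideal_ideal]) (use atom_sums_chow_fy_ideal atom_sums_R in auto)
  show "chow_ideal M \<subseteq> chow_fy_ideal \<inter> carrier R"
  proof
    fix x assume "x \<in> chow_ideal M"
    then obtain a b where x: "x = a \<oplus>\<^bsub>R\<^esub> b" "a \<in> chow_I M" "b \<in> chow_J M"
      unfolding chow_ideal_def set_add_def' by blast
    show "x \<in> chow_fy_ideal \<inter> carrier R" unfolding x(1) by (rule chow_fy_ideal.a_closed) (use x IJ1 IJ2 in auto)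
  qed
  have idI: "ideal (chow_I M) R" unfolding I by (rule genideal_ideal[OF incomparable_products_R])
  have idJ: "ideal (chow_J M) R" unfolding J by (rule genideal_ideal[OF atom_sums_R])
  have idC: "ideal (chow_ideal M) R" unfolding chow_ideal_def by (rule add_ideals[OF idI idJ])
  interpret C: ideal "chow_ideal M" R by (rule idC)
  interpret II: ideal "chow_I M" R by (rule idI)
  interpret JJ: ideal "chow_J M" R by (rule idJ)
  have sum_mem: "a + b \<in> chow_ideal M" if "a \<in> chow_I M" "b \<in> chow_J M" for a b
    unfolding chow_ideal_def set_add_def' using that by auto
  have incC: "x \<in> chow_ideal M" if "x \<in> incomparable_products" for x
  proof -
    have "x \<in> chow_I M" unfolding I using genideal_self[OF incomparable_products_R] that by blast
    moreover have "0 \<in> chow_J M" using JJ.zero_closed by simp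
    ultimately show ?thesis using sum_mem[of x 0] by simp
  qed
  have linC: "x \<in> chow_ideal M" if "x \<in> atom_sums" for x
  proof -
    have "x \<in> chow_J M" unfolding J using genideal_self[OF atom_sums_R] that by blast
    moreover have "0 \<in> chow_I M" using II.zero_closed by simp
    ultimately show ?thesis using sum_mem[of 0 x] by simp
  qed
  \<comment> \<open>setting the foreign variables to zero retracts the ring on all variables onto the Chow polynomial ring\<close>
  define \<pi> where "\<pi> = poly_subst pconst (\<lambda>v. if v \<in> nonempty_flats then pvar v else (0 :: 'a set qpoly))"
  have \<pi>R: "\<pi> a \<in> carrier R" for a
    unfolding \<pi>_def R_def by (rule qpoly_carrier_poly_subst) (auto simp: qpoly_carrier_pvar qpoly_carrier_0)
  have \<pi>id: "\<pi> p = p" if "p \<in> carrier R" for p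
  proof -
    have "\<pi> p = poly_subst pconst pvar p"
      unfolding \<pi>_def by (rule poly_subst_cong) (use that in \<open>auto simp: R_def qpoly_carrier\<close>)
    also have "\<dots> = p" by (simp add: poly_subst_def monom_subst_pvar pconst_def mult_single sum_single_keys)
    finally show ?thesis .
  qed
  have \<pi>I: "\<pi> x \<in> chow_ideal M" if "x \<in> ideal_span (incomparable_products \<union> atom_sums \<union> foreign_vars)" for x
    using that
  proof (rule ideal_span_induct)
    show "\<pi> 0 \<in> chow_ideal M" using C.zero_closed by (simp add: \<pi>_def)
    show "\<pi> (x + y) \<in> chow_ideal M" if "\<pi> x \<in> chow_ideal M" "\<pi> y \<in> chow_ideal M" for x y
      using C.a_closed[OF that] by (simp add: \<pi>_def pconst.poly_subst_add)
    fix a s assume "s \<in> incomparable_products \<union> atom_sums \<union> foreign_vars"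
    then have "\<pi> s \<in> chow_ideal M"
    proof (elim UnE)
      assume "s \<in> incomparable_products" then show ?thesis using incC[of s] incomparable_products_R \<pi>id[of s] by (simp add: subsetD)
    next
      assume "s \<in> atom_sums" then show ?thesis using linC[of s] atom_sums_R \<pi>id[of s] by (simp add: subsetD)
    next
      assume "s \<in> foreign_vars" then show ?thesis using C.zero_closed by (auto simp: foreign_vars_def \<pi>_def)
    qed
    then show "\<pi> (a * s) \<in> chow_ideal M" using C.I_l_closed[OF _ \<pi>R, of "\<pi> s" a] by (simp add: \<pi>_def pconst.poly_subst_mult)
  qed
  show "chow_fy_ideal \<inter> carrier R \<subseteq> chow_ideal M"
  proof
    fix x assume x: "x \<in> chow_fy_ideal \<inter> carrier R"
    then have "\<pi> x \<in> chow_ideal M" using \<pi>I chow_fy_ideal_from_relations by blast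
    then show "x \<in> chow_ideal M" using \<pi>id x by simp
  qed
qed

lemma chow_class_def': "chow_class M p = {i + p | i. i \<in> chow_fy_ideal \<inter> carrier R}"
  by (auto simp: chow_class_def a_r_coset_def' chow_ideal_eq)

lemma chow_class_eq_iff:
  assumes "p \<in> carrier R" "q \<in> carrier R"
  shows "chow_class M p = chow_class M q \<longleftrightarrow> p - q \<in> chow_fy_ideal"
proof
  assume e: "chow_class M p = chow_class M q"
  have "p \<in> chow_class M p" unfolding chow_class_def'
    using ring_ideal.span_zero[of "fy_relations {} nonempty_flats"] qpoly_carrier_0[of nonempty_flats] by (force simp: R_def)
  then have "p \<in> chow_class M q" using e by simp
  then show "p - q \<in> chow_fy_ideal" by (auto simp: chow_class_def')
next
  assume d: "p - q \<in> chow_fy_ideal"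
  have *: "chow_class M p \<subseteq> chow_class M q" if "p - q \<in> chow_fy_ideal" "p \<in> carrier R" "q \<in> carrier R" for p q
  proof
    fix x assume "x \<in> chow_class M p"
    then obtain i where i: "x = i + p" "i \<in> chow_fy_ideal" "i \<in> carrier R" by (auto simp: chow_class_def')
    have "x = (i + (p - q)) + q" using i by simp
    moreover have "i + (p - q) \<in> chow_fy_ideal \<inter> carrier R"
      using i that by (auto intro!: ring_ideal.span_add simp: R_def qpoly_carrier_add qpoly_carrier_diff)
    ultimately show "x \<in> chow_class M q" unfolding chow_class_def' by blast
  qed
  have "q - p \<in> chow_fy_ideal" using ring_ideal.span_neg[OF d] by simp
  then show "chow_class M p = chow_class M q" using *[OF d] *[of q p] assms by blast
qed

lemma chow_class_add:
  assumes "p \<in> carrier R" "q \<in> carrier R"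
  shows "add (chow_ring M) (chow_class M p) (chow_class M q) = chow_class M (p + q)"
proof -
  interpret cring R unfolding R_def by (rule qpoly_cring)
  interpret chow_fy_ideal: ideal "chow_ideal M" R unfolding chow_ideal_eq by (rule chow_fy_ideal_ideal)
  show ?thesis using chow_fy_ideal.a_rcos_sum[OF assms] by (simp add: chow_ring_def FactRing_def chow_class_def)
qed

lemma chow_class_scale:
  assumes "p \<in> carrier R"
  shows "chow_scale M c (chow_class M p) = chow_class M (pconst c * p)"
proof -
  interpret cring R unfolding R_def by (rule qpoly_cring)
  interpret chow_fy_ideal: ideal "chow_ideal M" R unfolding chow_ideal_eq by (rule chow_fy_ideal_ideal)
  have c: "pconst c \<in> carrier R" by (simp add: R_def qpoly_carrier_pconst)
  show ?thesis using chow_fy_ideal.rcoset_mult_add[OF c assms] by (simp add: chow_scale_def chow_ring_def FactRing_def chow_class_def)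
qed

end

section \<open>Characters of the graded pieces\<close>

lemma poly_subst_prod: "poly_subst pconst f (\<Prod>i\<in>I. h i) = (\<Prod>i\<in>I. poly_subst pconst f (h i))"
  by (induction I rule: infinite_finite_induct) (auto simp: pconst.poly_subst_mult)

lemma poly_subst_poly_subst: "poly_subst pconst f (poly_subst pconst g p) = poly_subst pconst (\<lambda>v. poly_subst pconst f (g v)) p"
proof -
  have m: "poly_subst pconst f (monom_subst g m) = monom_subst (\<lambda>v. poly_subst pconst f (g v)) m" for m
    by (simp add: monom_subst_def poly_subst_prod pconst.poly_subst_power)
  show ?thesis unfolding poly_subst_def[of _ g] pconst.poly_subst_sum pconst.poly_subst_mult m by (simp add: poly_subst_def[of _ "\<lambda>v. poly_subst pconst f (g v)"])
qed

lemma poly_subst_pvar_id: "poly_subst pconst pvar p = p"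
  by (simp add: poly_subst_def monom_subst_pvar pconst_def mult_single sum_single_keys)

context loopless_matroid
begin

definition automorphism :: "('a \<Rightarrow> 'a) \<Rightarrow> bool" where
  "automorphism \<sigma> \<longleftrightarrow> \<sigma> permutes E \<and> (\<forall>X\<subseteq>E. rk (\<sigma> ` X) = rk X)"

lemma aut_carrier: "carrier (aut_group M) = Collect automorphism"
  by (auto simp: aut_group_def automorphism_def)

abbreviation inv_perm :: "('a \<Rightarrow> 'a) \<Rightarrow> 'a \<Rightarrow> 'a" where "inv_perm \<equiv> inv_into UNIV"

lemma aut_inv: assumes "automorphism \<sigma>" shows "automorphism (inv_perm \<sigma>)"
  unfolding automorphism_def
proof (intro conjI allI impI)
  have p: "\<sigma> permutes E" using assms by (simp add: automorphism_def)
  show q: "inv_perm \<sigma> permutes E" by (rule permutes_inv[OF p])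
  fix X assume X: "X \<subseteq> E"
  have "inv_perm \<sigma> ` X \<subseteq> E" using image_mono[OF X, of "inv_perm \<sigma>"] permutes_image[OF q] by simp
  then have "rk (\<sigma> ` inv_perm \<sigma> ` X) = rk (inv_perm \<sigma> ` X)" using assms by (simp add: automorphism_def)
  moreover have "\<sigma> ` inv_perm \<sigma> ` X = X" using permutes_inverses(1)[OF p] by (auto simp: image_image)
  ultimately show "rk (inv_perm \<sigma> ` X) = rk X" by simp
qed

context
  fixes \<sigma> assumes \<sigma>: "automorphism \<sigma>"
begin

lemma aut_perm: "\<sigma> permutes E" using \<sigma> by (simp add: automorphism_def)

lemma aut_inj: "inj \<sigma>" using permutes_inj[OF aut_perm] .

lemma aut_inverse: "\<sigma> ` inv_perm \<sigma> ` X = X" "inv_perm \<sigma> ` \<sigma> ` X = X"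
  using permutes_inverses[OF aut_perm] by (auto simp: image_image)

lemma aut_flat: "F \<in> L \<Longrightarrow> \<sigma> ` F \<in> L"
  by (rule automorphism_flat) (use \<sigma> in \<open>auto simp: automorphism_def\<close>)

lemma aut_inv_flat: "F \<in> L \<Longrightarrow> inv_perm \<sigma> ` F \<in> L"
  by (rule automorphism_flat) (use aut_inv[OF \<sigma>] in \<open>auto simp: automorphism_def\<close>)

lemma aut_nonempty_flats: "\<sigma> ` F \<in> nonempty_flats \<longleftrightarrow> F \<in> nonempty_flats"
  using aut_flat[of F] aut_inv_flat[of "\<sigma> ` F"] by (auto simp: nonempty_flats_def aut_inverse)

lemma aut_rk: "F \<in> L \<Longrightarrow> rk (\<sigma> ` F) = rk F"
  using \<sigma> flat_sub_E by (auto simp: automorphism_def)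

lemma aut_subset: "\<sigma> ` F \<subseteq> \<sigma> ` G \<longleftrightarrow> F \<subseteq> G" by (rule inj_image_subset_iff[OF aut_inj])

lemma aut_psubset: "\<sigma> ` F \<subset> \<sigma> ` G \<longleftrightarrow> F \<subset> G" by (simp add: psubset_eq aut_subset inj_image_eq_iff[OF aut_inj])

abbreviation "relabel \<equiv> rename_vars (\<lambda>F. \<sigma> ` F)"

lemma relabel_ops: "relabel (p + q) = relabel p + relabel q" "relabel (p * q) = relabel p * relabel q" "relabel (p - q) = relabel p - relabel q" "relabel (p ^ n) = relabel p ^ n"
   "relabel 0 = 0" "relabel (pvar F) = pvar (\<sigma> ` F)" "relabel (pconst c) = pconst c"
  by (simp_all add: rename_vars_poly_subst pconst.poly_subst_add pconst.poly_subst_mult pconst.poly_subst_diff pconst.poly_subst_power)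

lemma relabel_upper_sum: "relabel (upper_sum nonempty_flats K) = upper_sum nonempty_flats (\<sigma> ` K)"
proof -
  have "relabel (upper_sum nonempty_flats K) = (\<Sum>N | N \<in> nonempty_flats \<and> K \<subseteq> N. pvar (\<sigma> ` N))"
    by (simp add: upper_sum_def rename_vars_poly_subst pconst.poly_subst_sum)
  also have "\<dots> = (\<Sum>N | N \<in> nonempty_flats \<and> \<sigma> ` K \<subseteq> N. pvar N)"
  proof (rule sum.reindex_bij_witness[where i = "\<lambda>N. inv_perm \<sigma> ` N" and j = "\<lambda>N. \<sigma> ` N"])
    fix N assume N: "N \<in> {N. N \<in> nonempty_flats \<and> \<sigma> ` K \<subseteq> N}"
    then have "\<sigma> ` inv_perm \<sigma> ` N \<in> nonempty_flats" "\<sigma> ` K \<subseteq> \<sigma> ` inv_perm \<sigma> ` N" by (simp_all only: aut_inverse mem_Collect_eq)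
    then show "inv_perm \<sigma> ` N \<in> {N. N \<in> nonempty_flats \<and> K \<subseteq> N}" by (simp only: aut_nonempty_flats aut_subset mem_Collect_eq)
  qed (auto simp: aut_inverse aut_nonempty_flats simp del: image_subset_iff)
  finally show ?thesis by (simp add: upper_sum_def)
qed

lemma relabel_chow_fy_ideal: assumes "p \<in> chow_fy_ideal" shows "relabel p \<in> chow_fy_ideal"
  using assms
proof (rule ideal_span_induct)
  fix a g assume g: "g \<in> fy_relations {} nonempty_flats"
  then have "relabel g \<in> chow_fy_ideal"
  proof (cases rule: fy_relationsE)
    case (var H) then show ?thesis using fy_ideal_var[of "\<sigma> ` H" nonempty_flats] by (simp add: relabel_ops aut_nonempty_flats)
  next
    case (inc H K)
    then show ?thesis using fy_ideal_incomparable[of "\<sigma> ` H" nonempty_flats "\<sigma> ` K"] by (simp add: relabel_ops aut_nonempty_flats aut_subset)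
  next
    case (pow K)
    then have "rk (\<sigma> ` K) = rk K" using nonempty_flats_L by (intro aut_rk) auto
    then show ?thesis using pow fy_ideal_power[of "\<sigma> ` K" nonempty_flats "rk K - rk {}" "{}"] by (simp add: relabel_ops relabel_upper_sum aut_nonempty_flats)
  next
    case (vpow H K)
    then have "rk (\<sigma> ` K) = rk K" "rk (\<sigma> ` H) = rk H" using nonempty_flats_L by (auto intro: aut_rk)
    then show ?thesis using vpow fy_ideal_var_power[of "\<sigma> ` H" nonempty_flats "\<sigma> ` K" "rk K - rk H"] by (simp add: relabel_ops relabel_upper_sum aut_nonempty_flats aut_psubset)
  qed
  then show "relabel (a * g) \<in> chow_fy_ideal" unfolding relabel_ops by (rule ideal_mult)
qed (auto simp: relabel_ops ring_ideal.span_zero ring_ideal.span_add)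

lemma relabel_R: assumes "p \<in> carrier R" shows "relabel p \<in> carrier R"
proof -
  have "relabel p = poly_subst pconst (\<lambda>F. if F \<in> nonempty_flats then pvar (\<sigma> ` F) else 0) p"
    unfolding rename_vars_poly_subst by (rule poly_subst_cong) (use assms in \<open>auto simp: R_def qpoly_carrier\<close>)
  also have "\<dots> \<in> carrier R" unfolding R_def
    by (rule qpoly_carrier_poly_subst) (auto simp: aut_nonempty_flats qpoly_carrier_0 intro: qpoly_carrier_pvar)
  finally show ?thesis .
qed

text \<open>Pulling back along the inverse relabels each variable by its image.\<close>
definition exp_image :: "('a set \<Rightarrow>\<^sub>0 nat) \<Rightarrow> ('a set \<Rightarrow>\<^sub>0 nat)" where
  "exp_image = Poly_Mapping.map_key (\<lambda>F. inv_perm \<sigma> ` F)"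

lemma inj_inv_image: "inj (\<lambda>F. inv_perm \<sigma> ` F)"
  by (rule inj_on_inverseI[where g = "\<lambda>F. \<sigma> ` F"]) (simp add: aut_inverse)

lemma lookup_exp_image: "lookup (exp_image m) F = lookup m (inv_perm \<sigma> ` F)"
  unfolding exp_image_def by (simp add: map_key.rep_eq[OF inj_inv_image])

lemma lookup_exp_image_image: "lookup (exp_image m) (\<sigma> ` F) = lookup m F"
  by (simp add: lookup_exp_image aut_inverse)

lemma keys_exp_image: "keys (exp_image m) = (\<lambda>F. \<sigma> ` F) ` keys m"
proof (intro Set.set_eqI iffI)
  fix F assume "F \<in> keys (exp_image m)"
  then have "inv_perm \<sigma> ` F \<in> keys m" by (simp add: in_keys_iff lookup_exp_image)
  then have "\<sigma> ` inv_perm \<sigma> ` F \<in> (\<lambda>F. \<sigma> ` F) ` keys m" by (rule imageI)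
  then show "F \<in> (\<lambda>F. \<sigma> ` F) ` keys m" by (simp only: aut_inverse)
next
  fix F assume "F \<in> (\<lambda>F. \<sigma> ` F) ` keys m"
  then show "F \<in> keys (exp_image m)" by (auto simp: in_keys_iff lookup_exp_image_image)
qed

lemma inj_image_aut: "inj_on (\<lambda>F. \<sigma> ` F) A"
  by (rule inj_on_inverseI[where g = "\<lambda>F. inv_perm \<sigma> ` F"]) (simp add: aut_inverse)

lemma relabel_monom: "relabel (single m 1) = single (exp_image m) 1"
proof -
  have "relabel (single m 1) = monom_subst (\<lambda>F. pvar (\<sigma> ` F)) m"
    unfolding rename_vars_poly_subst pconst.poly_subst_single by (simp add: pconst_1)
  also have "\<dots> = monom_subst pvar (exp_image m)"
    by (simp add: monom_subst_def keys_exp_image prod.reindex[OF inj_image_aut] lookup_exp_image_image)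
  finally show ?thesis by (simp add: monom_subst_pvar)
qed

lemma fy_exps_exp_image: assumes "m \<in> fy_exps {} nonempty_flats" shows "exp_image m \<in> fy_exps {} nonempty_flats"
proof -
  have k: "keys m \<subseteq> nonempty_flats" using assms by (simp add: fy_exps_def)
  then have r: "rk (\<sigma> ` K) = rk K" if "K \<in> keys m" for K using that nonempty_flats_L by (intro aut_rk) auto
  show ?thesis using assms unfolding fy_exps_def
    by (auto simp: keys_exp_image aut_nonempty_flats aut_subset aut_psubset lookup_exp_image_image r simp del: image_subset_iff)
qed

lemma exp_deg_exp_image: "exp_deg (exp_image m) = exp_deg m"
  by (simp add: exp_weight_def keys_exp_image sum.reindex[OF inj_image_aut] lookup_exp_image_image)

text \<open>An automorphism that fixes the monomial permutes its chain; a flat and its image are comparable and have the same rank,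
  hence agree.\<close>
lemma exp_image_fixed: assumes "m \<in> fy_exps {} nonempty_flats"
  shows "exp_image m = m \<longleftrightarrow> (\<forall>F\<in>keys m. \<sigma> ` F = F)"
proof
  assume fx: "exp_image m = m"
  show "\<forall>F\<in>keys m. \<sigma> ` F = F"
  proof
    fix F assume F: "F \<in> keys m"
    then have sF: "\<sigma> ` F \<in> keys m" using keys_exp_image[of m] fx by auto
    then have "F \<subseteq> \<sigma> ` F \<or> \<sigma> ` F \<subseteq> F" using F assms by (auto simp: fy_exps_def)
    moreover have "F \<in> L" "\<sigma> ` F \<in> L" using F sF assms nonempty_flats_L by (auto simp: fy_exps_def)
    ultimately show "\<sigma> ` F = F" using aut_rk[of F] flat_eqI by (metis)
  qed
next
  assume a: "\<forall>F\<in>keys m. \<sigma> ` F = F"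
  show "exp_image m = m"
  proof (rule poly_mapping_eqI)
    fix F
    show "lookup (exp_image m) F = lookup m F"
    proof (cases "F \<in> keys m")
      case True
      then have "inv_perm \<sigma> ` F = F" using a aut_inverse(2)[of F] by simp
      then show ?thesis by (simp add: lookup_exp_image)
    next
      case False
      then have "inv_perm \<sigma> ` F \<notin> keys m" using a aut_inverse(1)[of F] by force
      then show ?thesis using False by (simp add: lookup_exp_image in_keys_iff)
    qed
  qed
qed

end

lemma relabel_inverse: assumes "automorphism \<sigma>" shows "rename_vars (\<lambda>F. \<sigma> ` F) (rename_vars (\<lambda>F. inv_perm \<sigma> ` F) p) = p"
  unfolding rename_vars_poly_subst poly_subst_poly_subst by (simp add: aut_inverse[OF assms] poly_subst_pvar_id)

text \<open>The action on a coset is elementwise, so the inclusion from right to left uses the inverse automorphism to show that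
  the ideal is mapped onto itself.\<close>
lemma chow_act_class: assumes \<sigma>: "automorphism \<sigma>" and p: "p \<in> carrier R"
  shows "chow_act \<sigma> (chow_class M p) = chow_class M (rename_vars (\<lambda>F. \<sigma> ` F) p)"
proof (rule Set.set_eqI)
  fix x
  let ?r = "rename_vars (\<lambda>F. \<sigma> ` F)"
  show "x \<in> chow_act \<sigma> (chow_class M p) \<longleftrightarrow> x \<in> chow_class M (?r p)"
  proof
    assume "x \<in> chow_act \<sigma> (chow_class M p)"
    then obtain i where "i \<in> chow_fy_ideal" "i \<in> carrier R" "x = ?r i + ?r p"
      by (auto simp: chow_act_def chow_class_def' relabel_ops[OF \<sigma>])
    then show "x \<in> chow_class M (?r p)" using relabel_chow_fy_ideal[OF \<sigma>] relabel_R[OF \<sigma>] by (auto simp: chow_class_def')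
  next
    assume "x \<in> chow_class M (?r p)"
    then obtain i where i: "i \<in> chow_fy_ideal" "i \<in> carrier R" "x = i + ?r p" by (auto simp: chow_class_def')
    define j where "j = rename_vars (\<lambda>F. inv_perm \<sigma> ` F) i"
    have "j \<in> chow_fy_ideal" "j \<in> carrier R" unfolding j_def using relabel_chow_fy_ideal[OF aut_inv[OF \<sigma>] i(1)] relabel_R[OF aut_inv[OF \<sigma>] i(2)] by auto
    moreover have "x = ?r (j + p)" using i by (simp add: j_def relabel_ops[OF \<sigma>] relabel_inverse[OF \<sigma>])
    ultimately show "x \<in> chow_act \<sigma> (chow_class M p)" unfolding chow_act_def chow_class_def' by blast
  qed
qed

definition fy_exps_deg :: "nat \<Rightarrow> ('a set \<Rightarrow>\<^sub>0 nat) set" where "fy_exps_deg i = {m \<in> fy_exps {} nonempty_flats. exp_deg m = i}"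

lemma finite_fy_exps: "finite (fy_exps {} nonempty_flats)"
proof (rule inj_on_finite)
  show "finite (nonempty_flats \<rightarrow>\<^sub>E {..rk E})" by (rule finite_PiE) (use finite_nonempty_flats in auto)
  show "(\<lambda>m. restrict (lookup m) nonempty_flats) ` fy_exps {} nonempty_flats \<subseteq> nonempty_flats \<rightarrow>\<^sub>E {..rk E}"
  proof
    fix f assume "f \<in> (\<lambda>m. restrict (lookup m) nonempty_flats) ` fy_exps {} nonempty_flats"
    then obtain m where m: "m \<in> fy_exps {} nonempty_flats" "f = restrict (lookup m) nonempty_flats" by blast
    have "lookup m K \<le> rk E" if K: "K \<in> nonempty_flats" for K
    proof (cases "K \<in> keys m")
      case True
      then have "lookup m K + rk {} < rk K" using m K by (auto simp: fy_exps_def nonempty_flats_def)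
      then show ?thesis using flat_rank_le[of K] K nonempty_flats_L by auto
    qed (simp add: in_keys_iff)
    then show "f \<in> nonempty_flats \<rightarrow>\<^sub>E {..rk E}" by (auto simp: m)
  qed
  show "inj_on (\<lambda>m. restrict (lookup m) nonempty_flats) (fy_exps {} nonempty_flats)"
  proof (rule inj_onI)
    fix m m' assume m: "m \<in> fy_exps {} nonempty_flats" "m' \<in> fy_exps {} nonempty_flats" "restrict (lookup m) nonempty_flats = restrict (lookup m') nonempty_flats"
    show "m = m'"
    proof (rule poly_mapping_eqI)
      fix K
      show "lookup m K = lookup m' K"
      proof (cases "K \<in> nonempty_flats")
        case True then show ?thesis using fun_cong[OF m(3), of K] by simp
      next
        case False
        then have "K \<notin> keys m" "K \<notin> keys m'" using m by (auto simp: fy_exps_def)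
        then show ?thesis by (simp add: in_keys_iff)
      qed
    qed
  qed
qed

lemma fy_exps_carrier: "keys q \<subseteq> fy_exps {} nonempty_flats \<Longrightarrow> q \<in> carrier R"
  by (auto simp: R_def qpoly_carrier fy_exps_def)

text \<open>Existence is spanning and uniqueness is independence of the basis monomials.\<close>
lemma normal_form:
  assumes "X \<in> chow_piece M i"
  shows "\<exists>!q. keys q \<subseteq> fy_exps_deg i \<and> chow_class M q = X"
proof -
  obtain p where p: "p \<in> carrier R" "homogeneous i p" "X = chow_class M p" using assms by (auto simp: chow_piece_def)
  obtain q where q: "keys q \<subseteq> fy_exps {} nonempty_flats" "homogeneous i q" "p - q \<in> chow_fy_ideal"
    using fy_exps_spanning[OF nonempty_flats_L p(2)] by blast
  show ?thesis
  proof (rule ex1I[of _ q])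
    have "chow_class M p = chow_class M q" using chow_class_eq_iff[OF p(1) fy_exps_carrier[OF q(1)]] q(3) by simp
    then show "keys q \<subseteq> fy_exps_deg i \<and> chow_class M q = X"
      using q p by (auto simp: fy_exps_deg_def homogeneous_exp_deg)
    then have qX: "chow_class M q = X" by simp
    fix q' assume q': "keys q' \<subseteq> fy_exps_deg i \<and> chow_class M q' = X"
    then have k': "keys q' \<subseteq> fy_exps {} nonempty_flats" by (auto simp: fy_exps_deg_def)
    have "q' - q \<in> chow_fy_ideal" using chow_class_eq_iff[OF fy_exps_carrier[OF k'] fy_exps_carrier[OF q(1)]] q' qX by simp
    moreover have "keys (q' - q) \<subseteq> fy_exps {} nonempty_flats"
      using k' q(1) by (auto simp: in_keys_iff Poly_Mapping.lookup_minus subset_iff) (metis diff_zero)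
    ultimately have "q' - q = 0"
      by (intro fy_exps_independent[OF empty_flat _ nonempty_flats_upset]) (auto simp: nonempty_flats_above)
    then show "q' = q" by simp
  qed
qed

definition normal_form_of :: "nat \<Rightarrow> 'a set qpoly set \<Rightarrow> 'a set qpoly" where
  "normal_form_of i X = (THE q. keys q \<subseteq> fy_exps_deg i \<and> chow_class M q = X)"

lemma normal_form_of: assumes "X \<in> chow_piece M i" shows "keys (normal_form_of i X) \<subseteq> fy_exps_deg i" "chow_class M (normal_form_of i X) = X" "normal_form_of i X \<in> carrier R"
proof -
  show "keys (normal_form_of i X) \<subseteq> fy_exps_deg i" "chow_class M (normal_form_of i X) = X"
    using theI'[OF normal_form[OF assms]] unfolding normal_form_of_def by auto
  then show "normal_form_of i X \<in> carrier R" by (intro fy_exps_carrier) (auto simp: fy_exps_deg_def)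
qed

lemma class_piece: "keys q \<subseteq> fy_exps_deg i \<Longrightarrow> chow_class M q \<in> chow_piece M i"
  unfolding chow_piece_def by (intro imageI CollectI conjI fy_exps_carrier) (auto simp: fy_exps_deg_def homogeneous_exp_deg)

lemma normal_form_of_class: assumes "keys q \<subseteq> fy_exps_deg i" shows "normal_form_of i (chow_class M q) = q"
  unfolding normal_form_of_def by (rule the1_equality[OF normal_form[OF class_piece[OF assms]]]) (use assms in simp)

lemma chow_rational_basis:
  "rational_basis (chow_piece M i) (add (chow_ring M)) (chow_scale M) (fy_exps_deg i)
     (\<lambda>m. chow_class M (single m 1)) (\<lambda>X. lookup (normal_form_of i X))"
proof
  show "finite (fy_exps_deg i)" using finite_fy_exps by (simp add: fy_exps_deg_def)
  show "chow_class M (single k 1) \<in> chow_piece M i" if "k \<in> fy_exps_deg i" for k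
    by (rule class_piece) (use that in simp)
  show "lookup (normal_form_of i (chow_class M (single k 1))) j = (if j = k then 1 else 0)"
    if "j \<in> fy_exps_deg i" "k \<in> fy_exps_deg i" for j k
    by (subst normal_form_of_class) (use that in \<open>auto simp: Poly_Mapping.lookup_single when_def\<close>)
  have add: "add (chow_ring M) v w = chow_class M (normal_form_of i v + normal_form_of i w)" "keys (normal_form_of i v + normal_form_of i w) \<subseteq> fy_exps_deg i"
    if "v \<in> chow_piece M i" "w \<in> chow_piece M i" for v w
  proof -
    show "add (chow_ring M) v w = chow_class M (normal_form_of i v + normal_form_of i w)"
      using chow_class_add[of "normal_form_of i v" "normal_form_of i w"] normal_form_of(2,3) that by simp
    show "keys (normal_form_of i v + normal_form_of i w) \<subseteq> fy_exps_deg i"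
      using Poly_Mapping.keys_add[of "normal_form_of i v" "normal_form_of i w"] normal_form_of(1)[OF that(1)] normal_form_of(1)[OF that(2)] by blast
  qed
  have lp: "lookup (pconst q * p) m = q * lookup p m" for q and p :: "'a set qpoly" and m
  proof -
    have "pconst q * p = Poly_Mapping.map ((*) q) p"
      unfolding pconst_def by (rule Poly_Mapping.mult_map_scale_conv_mult[symmetric])
    then show ?thesis by (simp add: Poly_Mapping.map.rep_eq when_def)
  qed
  have scale: "chow_scale M q v = chow_class M (pconst q * normal_form_of i v)" "keys (pconst q * normal_form_of i v) \<subseteq> fy_exps_deg i"
    if "v \<in> chow_piece M i" for q v
  proof -
    show "chow_scale M q v = chow_class M (pconst q * normal_form_of i v)"
      using chow_class_scale[of "normal_form_of i v" q] normal_form_of(2,3) that by simp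
    show "keys (pconst q * normal_form_of i v) \<subseteq> fy_exps_deg i"
      using normal_form_of(1)[OF that] by (auto simp: in_keys_iff lp)
  qed
  fix v w q k assume v: "v \<in> chow_piece M i"
  show "chow_scale M q v \<in> chow_piece M i" using scale[OF v] class_piece by simp
  show "lookup (normal_form_of i (chow_scale M q v)) k = q * lookup (normal_form_of i v) k"
    unfolding scale(1)[OF v] normal_form_of_class[OF scale(2)[OF v]] by (rule lp)
  assume w: "w \<in> chow_piece M i"
  show "add (chow_ring M) v w \<in> chow_piece M i" using add[OF v w] class_piece by simp
  show "lookup (normal_form_of i (add (chow_ring M) v w)) k = lookup (normal_form_of i v) k + lookup (normal_form_of i w) k"
    unfolding add(1)[OF v w] normal_form_of_class[OF add(2)[OF v w]] by (rule Poly_Mapping.lookup_add)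
  assume eq: "\<And>k. k \<in> fy_exps_deg i \<Longrightarrow> lookup (normal_form_of i v) k = lookup (normal_form_of i w) k"
  have "normal_form_of i v = normal_form_of i w"
  proof (rule poly_mapping_eqI)
    fix k
    show "lookup (normal_form_of i v) k = lookup (normal_form_of i w) k"
    proof (cases "k \<in> fy_exps_deg i")
      case False
      then have "k \<notin> keys (normal_form_of i v)" "k \<notin> keys (normal_form_of i w)" using normal_form_of(1)[OF v] normal_form_of(1)[OF w] by blast+
      then show ?thesis by (simp add: in_keys_iff)
    qed (rule eq)
  qed
  then have "chow_class M (normal_form_of i v) = chow_class M (normal_form_of i w)" by (rule arg_cong)
  then show "v = w" by (simp only: normal_form_of(2)[OF v] normal_form_of(2)[OF w])
qed

text \<open>The basis monomials of degree \<open>i\<close> give a rational basis of the graded piece that is permuted by the action.\<close>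
lemma chow_trace:
  assumes \<sigma>: "automorphism \<sigma>"
  shows "trace_mod (elems (chow_piece_C M i)) (rels (chow_piece_C M i)) (act (chow_piece_C M i) \<sigma>) =
    of_nat (card {m \<in> fy_exps_deg i. \<forall>F\<in>keys m. \<sigma> ` F = F})"
proof -
  interpret rb: rational_basis "chow_piece M i" "add (chow_ring M)" "chow_scale M" "fy_exps_deg i"
     "\<lambda>m. chow_class M (single m 1)" "\<lambda>X. lookup (normal_form_of i X)"
    by (rule chow_rational_basis)
  let ?r = "rename_vars (\<lambda>F. \<sigma> ` F)"
  have elems: "elems (chow_piece_C M i) = rb.U" by (simp add: chow_piece_C_def complexify_def rb.U_def)
  have rels: "rels (chow_piece_C M i) = free.span rb.tensor_relations"
    by (simp add: chow_piece_C_def complexify_def rb.tensor_relations_def)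
  have act: "act (chow_piece_C M i) \<sigma> = lin_ext (\<lambda>v. single (chow_act \<sigma> v) 1)"
    by (simp add: chow_piece_C_def complexify_def)
  have FYdR: "single m 1 \<in> carrier R" if "m \<in> fy_exps_deg i" for m
    by (rule fy_exps_carrier) (use that in \<open>auto simp: fy_exps_deg_def\<close>)
  have act_normal_form_of: "chow_act \<sigma> v = chow_class M (?r (normal_form_of i v))" if "v \<in> chow_piece M i" for v
    using chow_act_class[OF \<sigma> normal_form_of(3)[OF that]] normal_form_of(2)[OF that] by simp
  have eimgd: "exp_image \<sigma> m \<in> fy_exps_deg i" if "m \<in> fy_exps_deg i" for m
    using that fy_exps_exp_image[OF \<sigma>] exp_deg_exp_image[OF \<sigma>] by (auto simp: fy_exps_deg_def)
  have keys_r: "keys (?r p) \<subseteq> fy_exps_deg i" if p: "keys p \<subseteq> fy_exps_deg i" for p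
  proof -
    have "?r p = (\<Sum>m\<in>keys p. pconst (lookup p m) * ?r (single m 1))"
      unfolding rename_vars_poly_subst by (simp add: poly_subst_def pconst.poly_subst_single pconst_1)
    also have "\<dots> = (\<Sum>m\<in>keys p. single (exp_image \<sigma> m) (lookup p m))"
      by (simp add: relabel_monom[OF \<sigma>] pconst_def mult_single)
    finally have "keys (?r p) \<subseteq> (\<Union>m\<in>keys p. keys (single (exp_image \<sigma> m) (lookup p m)))"
      by (simp only: Poly_Mapping.keys_sum)
    then show ?thesis using p eimgd by (auto split: if_splits)
  qed
  have "trace_mod rb.U (free.span rb.tensor_relations) (lin_ext (\<lambda>v. single (chow_act \<sigma> v) 1)) =
    of_nat (card {k \<in> fy_exps_deg i. exp_image \<sigma> k = k})"
  proof (rule rb.trace_permutation)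
    fix v assume v: "v \<in> chow_piece M i"
    show "chow_act \<sigma> v \<in> chow_piece M i"
      unfolding act_normal_form_of[OF v] by (rule class_piece[OF keys_r[OF normal_form_of(1)[OF v]]])
    show "chow_act \<sigma> (chow_scale M q v) = chow_scale M q (chow_act \<sigma> v)" for q
    proof -
      have s: "chow_scale M q v = chow_class M (pconst q * normal_form_of i v)"
        using chow_class_scale[of "normal_form_of i v" q] normal_form_of(2,3) v by simp
      have c: "pconst q * normal_form_of i v \<in> carrier R"
        using normal_form_of(3)[OF v] by (simp add: R_def qpoly_carrier_mult qpoly_carrier_pconst)
      show ?thesis unfolding s chow_act_class[OF \<sigma> c] act_normal_form_of[OF v] chow_class_scale[OF relabel_R[OF \<sigma> normal_form_of(3)[OF v]]]
        by (simp only: relabel_ops[OF \<sigma>])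
    qed
    fix w assume w: "w \<in> chow_piece M i"
    have s: "add (chow_ring M) v w = chow_class M (normal_form_of i v + normal_form_of i w)"
      using chow_class_add[of "normal_form_of i v" "normal_form_of i w"] normal_form_of(2,3) v w by simp
    have c: "normal_form_of i v + normal_form_of i w \<in> carrier R" using normal_form_of(3) v w by (simp add: R_def qpoly_carrier_add)
    show "chow_act \<sigma> (add (chow_ring M) v w) = add (chow_ring M) (chow_act \<sigma> v) (chow_act \<sigma> w)"
      unfolding s chow_act_class[OF \<sigma> c] act_normal_form_of[OF v] act_normal_form_of[OF w]
        chow_class_add[OF relabel_R[OF \<sigma> normal_form_of(3)[OF v]] relabel_R[OF \<sigma> normal_form_of(3)[OF w]]]
      by (simp only: relabel_ops[OF \<sigma>])
  next
    fix k assume k: "k \<in> fy_exps_deg i"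
    show "exp_image \<sigma> k \<in> fy_exps_deg i" by (rule eimgd[OF k])
    show "chow_act \<sigma> (chow_class M (single k 1)) = chow_class M (single (exp_image \<sigma> k) 1)"
      unfolding chow_act_class[OF \<sigma> FYdR[OF k]] relabel_monom[OF \<sigma>] ..
  qed
  also have "{k \<in> fy_exps_deg i. exp_image \<sigma> k = k} = {m \<in> fy_exps_deg i. \<forall>F\<in>keys m. \<sigma> ` F = F}"
    using exp_image_fixed[OF \<sigma>] by (auto simp: fy_exps_deg_def)
  finally show ?thesis unfolding elems rels act .
qed

end

section \<open>The signed count of fixed monomials\<close>

context loopless_matroid
begin

text \<open>The flats of the monomial form a finite chain, so their intersection is the least of them.\<close>
lemma fy_exps_least_key:
  assumes m: "m \<in> fy_exps F (above F)" "m \<noteq> 0"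
  shows "\<Inter>(keys m) \<in> keys m"
proof -
  have "keys m \<noteq> {}" using m(2) by simp
  then obtain G where G: "G \<in> keys m" "\<And>K. K \<in> keys m \<Longrightarrow> rk G \<le> rk K"
    using ex_has_least_nat[of "\<lambda>K. K \<in> keys m" _ rk] by blast
  have "G \<subseteq> K" if K: "K \<in> keys m" for K
  proof -
    have KL: "K \<in> L" "G \<in> L" using m K G by (auto simp: fy_exps_def above_def)
    have "K \<subseteq> G \<or> G \<subseteq> K" using m K G by (auto simp: fy_exps_def)
    then show ?thesis using flat_rank_less[OF KL] G(2)[OF K] by (metis not_less psubsetI order_refl)
  qed
  then have "\<Inter>(keys m) = G" using G by auto
  then show ?thesis using G by simp
qed

lemma keys_add_single: "lookup e G = 0 \<Longrightarrow> 0 < k \<Longrightarrow>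
    keys (e + single G (k::nat)) = insert G (keys e)"
  by (auto simp: in_keys_iff Poly_Mapping.lookup_add Poly_Mapping.lookup_single when_def split: if_splits)

text \<open>Removing the variable of the least flat \<open>G\<close> leaves a basis monomial over the base flat \<open>G\<close>.\<close>
lemma fy_exps_peel:
  assumes F: "F \<in> L" and m: "m \<in> fy_exps F (above F)" "m \<noteq> 0"
  defines "G \<equiv> \<Inter>(keys m)"
  defines "k \<equiv> lookup m G"
  defines "e \<equiv> m - single G k"
  shows "G \<in> above F" "0 < k" "k + rk F < rk G" "e \<in> fy_exps G (above G)" "m = e + single G k"
    "lookup e G = 0" "G \<in> keys m"
proof -
  show Gk: "G \<in> keys m" unfolding G_def by (rule fy_exps_least_key[OF m])
  then show GF: "G \<in> above F" using m by (auto simp: fy_exps_def)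
  then have GL: "G \<in> L" "F \<subset> G" by (auto simp: above_def)
  show k: "0 < k" using Gk by (simp add: k_def in_keys_iff)
  show e0: "lookup e G = 0" by (simp add: e_def k_def lookup_single_minus)
  show me: "m = e + single G k" unfolding e_def k_def by (rule minus_single_add[symmetric])
  have "keys m \<subseteq> insert G (above G)"
  proof
    fix K assume K: "K \<in> keys m"
    then have "G \<subseteq> K" by (auto simp: G_def)
    then show "K \<in> insert G (above G)" using K m by (auto simp: above_def fy_exps_def)
  qed
  then have "m \<in> fy_exps F (insert G (above G))" using m by (auto simp: fy_exps_def)
  then have FYm: "e + single G k \<in> fy_exps F (insert G (above G))" by (simp add: me[symmetric])
  have aF: "above G \<subseteq> above F" using GL by (auto simp: above_def)
  have "G \<notin> above G" by (simp add: above_def)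
  from fy_exps_above[OF above_upset(2)[OF GL(1)] aF above_upset(1) GF this e0 k FYm]
  show "e \<in> fy_exps G (above G)" "k + rk F < rk G" by auto
qed

lemma fy_exps_extend:
  assumes "G \<in> above F" "e \<in> fy_exps G (above G)" "0 < k" "k + rk F < rk G"
  shows "e + single G k \<in> fy_exps F (above F)" "lookup e G = 0"
    "\<Inter>(keys (e + single G k)) = G"
proof -
  have ke: "keys e \<subseteq> above G" using assms by (simp add: fy_exps_def)
  then have "G \<notin> keys e" by (auto simp: above_def)
  then show e0: "lookup e G = 0" by (simp add: in_keys_iff)
  note ks = keys_add_single[OF e0 assms(3)]
  have lm: "lookup (e + single G k) K = (if K = G then k else lookup e K)" for K
    using e0 by (auto simp: Poly_Mapping.lookup_add Poly_Mapping.lookup_single when_def)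
  show "\<Inter>(keys (e + single G k)) = G"
    unfolding ks using ke by (auto simp: above_def)
  have G: "G \<in> L" "F \<subset> G" using assms by (auto simp: above_def)
  have Gb: "G \<subset> K" "K \<in> L" if "K \<in> keys e" for K using ke that by (auto simp: above_def)
  show "e + single G k \<in> fy_exps F (above F)"
    unfolding fy_exps_def mem_Collect_eq
  proof (intro conjI ballI impI)
    show "keys (e + single G k) \<subseteq> above F"
      unfolding ks using Gb G by (auto simp: above_def)
    fix H K assume H: "H \<in> keys (e + single G k)" and K: "K \<in> keys (e + single G k)"
    have "H = G \<or> H \<in> keys e" "K = G \<or> K \<in> keys e" using H K unfolding ks by auto
    then consider "H = G" "K = G" | "H = G" "G \<subset> K" | "K = G" "G \<subset> H" | "H \<in> keys e" "K \<in> keys e"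
      using Gb(1) by blast
    then show "H \<subseteq> K \<or> K \<subseteq> H"
    proof cases
      case 4 then show ?thesis using assms(2) by (simp add: fy_exps_def)
    qed auto
  next
    fix K H assume K: "K \<in> keys (e + single G k)"
      and H: "H \<in> insert F (keys (e + single G k))" and HK: "H \<subset> K"
    show "lookup (e + single G k) K + rk H < rk K"
    proof (cases "K = G")
      case True
      have "H \<noteq> G" "H \<notin> keys e" using HK True Gb(1)[of H] by auto
      then have "H = F" using H unfolding ks by auto
      then show ?thesis using True assms(4) by (simp add: lm)
    next
      case False
      then have Ke: "K \<in> keys e" using K unfolding ks by auto
      have c: "lookup e K + rk P < rk K" if "P \<in> insert G (keys e)" "P \<subset> K" for P
        using assms(2) Ke that by (auto simp: fy_exps_def)
      have "rk F \<le> rk G" by (rule rank_mono) (use G in auto)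
      then have "lookup e K + rk H < rk K"
        using c[of G] c[of H] H HK Gb(1)[OF Ke] unfolding ks by fastforce
      then show ?thesis using False by (simp add: lm)
    qed
  qed
qed

text \<open>The exponents are smaller than successive rank differences, so the degree of a monomial other than \<open>1\<close> telescopes to less
  than the corank of \<open>F\<close>. Hence degrees up to \<open>r - 1\<close> exhaust all basis monomials.\<close>
lemma fy_exps_degree: "F \<in> L \<Longrightarrow> m \<in> fy_exps F (above F) \<Longrightarrow> exp_deg m = 0 \<or> exp_deg m + rk F < rk E"
proof (induction "rk E - rk F" arbitrary: F m rule: less_induct)
  case less
  show ?case
  proof (cases "m = 0")
    case True then show ?thesis by (simp add: exp_weight_def)
  next
    case False
    note p = fy_exps_peel[OF less(2,3) False]
    define G where "G = \<Inter>(keys m)"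
    define k where "k = lookup m G"
    define e where "e = m - single G k"
    note p' = p[folded G_def, folded k_def, folded e_def]
    have GL: "G \<in> L" "rk G \<le> rk E" using p'(1) flat_rank_le by (auto simp: above_def)
    then have "rk E - rk G < rk E - rk F" using p'(2,3) by linarith
    from less(1)[OF this GL(1) p'(4)] have "exp_deg e = 0 \<or> exp_deg e + rk G < rk E" .
    moreover have "exp_deg m = exp_deg e + k" by (subst p'(5)) (simp add: exp_weight_add exp_weight_single)
    ultimately show ?thesis using p'(3) GL by linarith
  qed
qed

context
  fixes X :: "'a set set"
  assumes X: "X \<subseteq> L"
begin

definition supported_fy :: "'a set \<Rightarrow> ('a set \<Rightarrow>\<^sub>0 nat) set" where
  "supported_fy F = {m \<in> fy_exps F (above F). keys m \<subseteq> X}"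

lemma finite_supported_fy: assumes "F \<in> L" shows "finite (supported_fy F)"
proof -
  have "supported_fy F \<subseteq> (\<lambda>m. m) ` fy_exps {} nonempty_flats"
  proof
    fix m assume m: "m \<in> supported_fy F"
    have "m \<in> fy_exps {} nonempty_flats" unfolding fy_exps_def mem_Collect_eq
    proof (intro conjI ballI impI)
      show "keys m \<subseteq> nonempty_flats" using m by (auto simp: supported_fy_def fy_exps_def above_def nonempty_flats_def)
      fix H K assume "H \<in> keys m" "K \<in> keys m"
      then show "H \<subseteq> K \<or> K \<subseteq> H" using m by (auto simp: supported_fy_def fy_exps_def)
    next
      fix K H assume K: "K \<in> keys m" and H: "H \<in> insert {} (keys m)" "H \<subset> K"
      have "K \<in> above F" using m K by (auto simp: supported_fy_def fy_exps_def)
      then have "lookup m K + rk F < rk K" using m K by (auto simp: supported_fy_def fy_exps_def above_def)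
      then show "lookup m K + rk H < rk K"
        using H m K by (auto simp: supported_fy_def fy_exps_def rank_empty)
    qed
    then show "m \<in> (\<lambda>m. m) ` fy_exps {} nonempty_flats" by simp
  qed
  then show ?thesis using finite_fy_exps finite_subset by auto
qed

text \<open>The sum of the signs of the basis monomials over \<open>F\<close> that use only flats in \<open>X\<close>. In the application \<open>X\<close>
  consists of the flats fixed by an automorphism.\<close>
definition signed_monomial_count :: "'a set \<Rightarrow> complex" where
  "signed_monomial_count F = (\<Sum>m\<in>supported_fy F. (-1) ^ exp_deg m)"

lemma alternating_powers: "0 < d \<Longrightarrow> (\<Sum>k\<in>{1..<d}. (-1) ^ k) = (if even d then -1 else 0 :: complex)"
proof (induction d)
  case (Suc d)
  show ?case
  proof (cases "d = 0")
    case False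
    then show ?thesis using Suc by (simp add: atLeastLessThanSuc)
  qed simp
qed simp

text \<open>A monomial other than \<open>1\<close> is determined by its least flat, its exponent there and the rest. The alternating sum over the
  exponents leaves only flats at even distance from \<open>F\<close>.\<close>
lemma signed_monomial_count_rec: assumes F: "F \<in> L"
  shows "signed_monomial_count F = 1 - (\<Sum>G\<in>{G \<in> X \<inter> above F. even (rk G - rk F)}. signed_monomial_count G)"
proof -
  have 0: "0 \<in> supported_fy F" by (simp add: supported_fy_def fy_exps_def)
  have finA: "finite (X \<inter> above F)" using finite_above by auto
  have GL: "G \<in> L" "rk F < rk G" if "G \<in> X \<inter> above F" for G
    using that flat_rank_less[OF F] by (auto simp: above_def)
  have "signed_monomial_count F = 1 + (\<Sum>m\<in>supported_fy F - {0}. (-1) ^ exp_deg m)"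
    unfolding signed_monomial_count_def using sum.remove[OF finite_supported_fy[OF F] 0, of "\<lambda>m. (-1) ^ exp_deg m :: complex"] by (simp add: exp_weight_def)
  also have "(\<Sum>m\<in>supported_fy F - {0}. (-1) ^ exp_deg m) =
    (\<Sum>(G, k, e)\<in>(SIGMA G:X \<inter> above F. SIGMA k:{1..<rk G - rk F}. supported_fy G). (-1) ^ k * (-1) ^ exp_deg e :: complex)"
  proof (rule sum.reindex_bij_witness[where i = "\<lambda>(G, k, e). e + single G k"
      and j = "\<lambda>m. (\<Inter>(keys m), lookup m (\<Inter>(keys m)),
        m - single (\<Inter>(keys m)) (lookup m (\<Inter>(keys m))))"])
    fix m assume m: "m \<in> supported_fy F - {0}"
    define G where "G = \<Inter>(keys m)"
    define k where "k = lookup m G"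
    define e where "e = m - single G k"
    have mF: "m \<in> fy_exps F (above F)" "m \<noteq> 0" "keys m \<subseteq> X" using m by (auto simp: supported_fy_def)
    note p = fy_exps_peel[OF F mF(1,2), folded G_def, folded k_def, folded e_def]
    have "keys m = insert G (keys e)"
      by (subst p(5)) (rule keys_add_single[OF p(6,2)])
    then have ks: "keys e \<subseteq> keys m" by auto
    have eX: "e \<in> supported_fy G" using p(4) ks mF by (auto simp: supported_fy_def)
    have d: "exp_deg m = k + exp_deg e" by (subst p(5)) (simp add: exp_weight_add exp_weight_single)
    show "(case (\<Inter>(keys m), lookup m (\<Inter>(keys m)),
        m - single (\<Inter>(keys m)) (lookup m (\<Inter>(keys m))))
       of (G, k, e) \<Rightarrow> e + single G k) = m"
      by (simp add: minus_single_add)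
    show "(\<Inter>(keys m), lookup m (\<Inter>(keys m)),
        m - single (\<Inter>(keys m)) (lookup m (\<Inter>(keys m))))
      \<in> (SIGMA G:X \<inter> above F. SIGMA k:{1..<rk G - rk F}. supported_fy G)"
      unfolding G_def[symmetric] k_def[symmetric] e_def[symmetric] using p eX mF by auto
    show "(case (\<Inter>(keys m), lookup m (\<Inter>(keys m)),
        m - single (\<Inter>(keys m)) (lookup m (\<Inter>(keys m))))
      of (G, k, e) \<Rightarrow> (-1) ^ k * (-1) ^ exp_deg e) = ((-1) ^ exp_deg m :: complex)"
      unfolding G_def[symmetric] k_def[symmetric] e_def[symmetric] by (simp only: prod.case d power_add)
  next
    fix b assume "b \<in> (SIGMA G:X \<inter> above F. SIGMA k:{1..<rk G - rk F}. supported_fy G)"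
    then obtain G k e where b: "b = (G, k, e)" "G \<in> X" "G \<in> above F" "0 < k" "k < rk G - rk F" "e \<in> supported_fy G"
      by auto
    have ee: "e \<in> fy_exps G (above G)" "keys e \<subseteq> X" "k + rk F < rk G" using b by (auto simp: supported_fy_def)
    note x = fy_exps_extend[OF b(3) ee(1) b(4) ee(3)]
    note ks = keys_add_single[OF x(2) b(4)]
    have "lookup (e + single G k) G = k" using x(2) by (simp add: Poly_Mapping.lookup_add)
    then show "(case case b of (G, k, e) \<Rightarrow> e + single G k of m \<Rightarrow> (\<Inter>(keys m), lookup m (\<Inter>(keys m)),
        m - single (\<Inter>(keys m)) (lookup m (\<Inter>(keys m))))) = b"
      by (simp add: b x(3))
    have "e + single G k \<noteq> 0" using ks by (metis insert_not_empty keys_zero)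
    then show "(case b of (G, k, e) \<Rightarrow> e + single G k) \<in> supported_fy F - {0}"
      using x(1) ks ee(2) b by (auto simp: supported_fy_def)
  qed
  also have "\<dots> = (\<Sum>G\<in>X \<inter> above F. \<Sum>k\<in>{1..<rk G - rk F}. \<Sum>e\<in>supported_fy G. (-1) ^ k * (-1) ^ exp_deg e)"
  proof -
    have fG: "finite (supported_fy G)" if "G \<in> X \<inter> above F" for G by (rule finite_supported_fy[OF GL(1)[OF that]])
    have "(\<Sum>G\<in>X \<inter> above F. \<Sum>k\<in>{1..<rk G - rk F}. \<Sum>e\<in>supported_fy G. (-1) ^ k * (-1) ^ exp_deg e :: complex) =
      (\<Sum>G\<in>X \<inter> above F. \<Sum>(k, e)\<in>(SIGMA k:{1..<rk G - rk F}. supported_fy G). (-1) ^ k * (-1) ^ exp_deg e)"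
      by (intro sum.cong refl sum.Sigma ballI fG finite_atLeastLessThan)
    also have "\<dots> = (\<Sum>(G, k, e)\<in>(SIGMA G:X \<inter> above F. SIGMA k:{1..<rk G - rk F}. supported_fy G). (-1) ^ k * (-1) ^ exp_deg e)"
      by (rule sum.Sigma) (use finA fG in \<open>auto intro!: finite_SigmaI\<close>)
    finally show ?thesis ..
  qed
  also have "\<dots> = (\<Sum>G\<in>X \<inter> above F. (\<Sum>k\<in>{1..<rk G - rk F}. (-1) ^ k) * signed_monomial_count G)"
    by (simp only: signed_monomial_count_def sum_product)
  also have "\<dots> = (\<Sum>G\<in>X \<inter> above F. if even (rk G - rk F) then - signed_monomial_count G else 0)"
  proof (intro sum.cong refl)
    fix G assume "G \<in> X \<inter> above F"
    then have "0 < rk G - rk F" using GL(2) by simp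
    from alternating_powers[OF this]
    show "(\<Sum>k\<in>{1..<rk G - rk F}. (-1) ^ k) * signed_monomial_count G = (if even (rk G - rk F) then - signed_monomial_count G else 0)" by simp
  qed
  also have "\<dots> = (\<Sum>G\<in>{G \<in> X \<inter> above F. even (rk G - rk F)}. - signed_monomial_count G)"
    by (rule sum.inter_filter[OF finA, symmetric])
  finally show ?thesis by (simp add: sum_negf)
qed

text \<open>Only the ranks of the members are required to be even; for a base flat of even rank this agrees with even rank
  differences.\<close>
definition even_chains :: "'a set \<Rightarrow> 'a set list set" where
  "even_chains F = {xs. set xs \<subseteq> {K \<in> X \<inter> above F. even (rk K)} \<and> sorted_wrt (<) xs}"

definition signed_chain_count :: "'a set \<Rightarrow> complex" where "signed_chain_count F = (\<Sum>xs\<in>even_chains F. (-1) ^ length xs)"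

lemma finite_even_chains: "finite (even_chains F)"
proof (rule finite_subset)
  show "even_chains F \<subseteq> {xs. set xs \<subseteq> above F \<and> distinct xs}" using sorted_wrt_less_distinct by (auto simp: even_chains_def)
  show "finite {xs. set xs \<subseteq> above F \<and> distinct xs}" by (rule finite_subset_distinct[OF finite_above])
qed

text \<open>Chains are grouped by their first flat.\<close>
lemma signed_chain_count_rec: "signed_chain_count F = 1 - (\<Sum>G\<in>{G \<in> X \<inter> above F. even (rk G)}. signed_chain_count G)"
proof -
  let ?A = "{G \<in> X \<inter> above F. even (rk G)}"
  have finA: "finite ?A" using finite_above by auto
  have "even_chains F = insert [] (\<Union>G\<in>?A. (#) G ` even_chains G)"
  proof (intro subset_antisym subsetI)
    fix xs assume xs: "xs \<in> even_chains F"
    show "xs \<in> insert [] (\<Union>G\<in>?A. (#) G ` even_chains G)"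
    proof (cases xs)
      case (Cons G ys)
      then have "G \<in> ?A" "ys \<in> even_chains G" using xs X by (auto simp: even_chains_def above_def)
      then show ?thesis using Cons by auto
    qed simp
  next
    fix xs assume "xs \<in> insert [] (\<Union>G\<in>?A. (#) G ` even_chains G)"
    then show "xs \<in> even_chains F" by (fastforce simp: even_chains_def above_def)
  qed
  then have "signed_chain_count F = (\<Sum>xs\<in>insert [] (\<Union>G\<in>?A. (#) G ` even_chains G). (-1) ^ length xs)" by (simp add: signed_chain_count_def)
  also have "\<dots> = 1 + (\<Sum>xs\<in>(\<Union>G\<in>?A. (#) G ` even_chains G). (-1) ^ length xs)"
    using finA finite_even_chains by (subst sum.insert) auto
  also have "(\<Sum>xs\<in>(\<Union>G\<in>?A. (#) G ` even_chains G). (-1) ^ length xs :: complex) = (\<Sum>G\<in>?A. \<Sum>xs\<in>(#) G ` even_chains G. (-1) ^ length xs)"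
    by (rule sum.UNION_disjoint) (use finA finite_even_chains in auto)
  also have "\<dots> = (\<Sum>G\<in>?A. - signed_chain_count G)"
    by (intro sum.cong refl) (simp add: signed_chain_count_def sum.reindex sum_negf)
  finally show ?thesis by (simp add: sum_negf)
qed

lemma signed_monomial_count_eq_signed_chain_count: "F \<in> L \<Longrightarrow> even (rk F) \<Longrightarrow> signed_monomial_count F = signed_chain_count F"
proof (induction "rk E - rk F" arbitrary: F rule: less_induct)
  case less
  have e: "{G \<in> X \<inter> above F. even (rk G - rk F)} = {G \<in> X \<inter> above F. even (rk G)}"
  proof -
    have "even (rk G - rk F) \<longleftrightarrow> even (rk G)" if "G \<in> above F" for G
    proof -
      have "rk F < rk G" using that flat_rank_less[OF less.prems(1)] by (auto simp: above_def)
      then show ?thesis using less.prems(2) by (simp add: even_diff_nat)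
    qed
    then show ?thesis by blast
  qed
  have "signed_monomial_count G = signed_chain_count G" if "G \<in> {G \<in> X \<inter> above F. even (rk G)}" for G
  proof -
    have "G \<in> L" "rk F < rk G" "rk G \<le> rk E" using that flat_rank_less[OF less.prems(1)] flat_rank_le by (auto simp: above_def)
    then show ?thesis using less.hyps[of G] that by auto
  qed
  then show ?case unfolding signed_monomial_count_rec[OF less.prems(1)] signed_chain_count_rec[of F] e by simp
qed

text \<open>The cancellation of chains with and without the ground set, in recursive form: below the ground set only the empty chain and
  the chain consisting of the ground set contribute.\<close>
lemma signed_chain_count_even_rank:
  assumes "E \<in> X" "even (rk E)"
  shows "F \<in> L \<Longrightarrow> signed_chain_count F = (if F = E then 1 else 0)"
proof (induction "rk E - rk F" arbitrary: F rule: less_induct)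
  case less
  show ?case
  proof (cases "F = E")
    case True
    have "above E = {}" using flat_sub_E by (auto simp: above_def)
    then show ?thesis using True by (simp add: signed_chain_count_rec[of E])
  next
    case False
    let ?A = "{G \<in> X \<inter> above F. even (rk G)}"
    have EA: "E \<in> ?A" using assms False flat_sub_E[OF less.prems] E_flat by (auto simp: above_def)
    have "signed_chain_count G = (if G = E then 1 else 0)" if "G \<in> ?A" for G
    proof -
      have "G \<in> L" "rk F < rk G" "rk G \<le> rk E" using that flat_rank_less[OF less.prems] flat_rank_le by (auto simp: above_def)
      then show ?thesis using less.hyps[of G] by auto
    qed
    then have "(\<Sum>G\<in>?A. signed_chain_count G) = (\<Sum>G\<in>?A. if G = E then 1 else 0)" by simp
    also have "\<dots> = 1" using EA finite_above by (subst sum.delta) auto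
    finally show ?thesis using False by (simp add: signed_chain_count_rec[of F])
  qed
qed

end

lemma alternating_trace:
  assumes \<sigma>: "automorphism \<sigma>" and r: "0 < rk E"
  defines "X \<equiv> {F \<in> L. \<sigma> ` F = F}"
  shows "(\<Sum>i=0..rk E - 1. (-1) ^ i * of_nat (card {m \<in> fy_exps_deg i. \<forall>F\<in>keys m. \<sigma> ` F = F})) = signed_chain_count X {}"
proof -
  have XL: "X \<subseteq> L" by (auto simp: X_def)
  have F: "supported_fy X {} = {m \<in> fy_exps {} nonempty_flats. \<forall>F\<in>keys m. \<sigma> ` F = F}"
  proof -
    have "keys m \<subseteq> X \<longleftrightarrow> (\<forall>F\<in>keys m. \<sigma> ` F = F)" if "m \<in> fy_exps {} nonempty_flats" for m
    proof -
      have "keys m \<subseteq> L" using that nonempty_flats_L by (auto simp: fy_exps_def)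
      then show ?thesis unfolding X_def by blast
    qed
    then show ?thesis unfolding supported_fy_def[OF XL] nonempty_flats_above[symmetric] by blast
  qed
  have fin: "finite (supported_fy X {})" by (rule finite_supported_fy[OF XL empty_flat])
  have deg: "exp_deg m \<in> {0..rk E - 1}" if "m \<in> supported_fy X {}" for m
    using fy_exps_degree[OF empty_flat, of m] that r by (auto simp: supported_fy_def[OF XL] rank_empty)
  have "signed_monomial_count X {} = (\<Sum>i\<in>{0..rk E - 1}. \<Sum>m\<in>{m \<in> supported_fy X {}. exp_deg m = i}. (-1) ^ exp_deg m)"
    unfolding signed_monomial_count_def[OF XL] by (rule sum.group[symmetric]) (use fin deg in auto)
  also have "\<dots> = (\<Sum>i=0..rk E - 1. (-1) ^ i * of_nat (card {m \<in> fy_exps_deg i. \<forall>F\<in>keys m. \<sigma> ` F = F}))"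
  proof (intro sum.cong refl)
    fix i
    have e: "{m \<in> supported_fy X {}. exp_deg m = i} = {m \<in> fy_exps_deg i. \<forall>F\<in>keys m. \<sigma> ` F = F}"
      by (auto simp: F fy_exps_deg_def)
    have "(\<Sum>m\<in>{m \<in> supported_fy X {}. exp_deg m = i}. (-1) ^ exp_deg m :: complex) = (\<Sum>m\<in>{m \<in> supported_fy X {}. exp_deg m = i}. (-1) ^ i)"
      by (rule sum.cong) (auto simp del: One_nat_def)
    then show "(\<Sum>m\<in>{m \<in> supported_fy X {}. exp_deg m = i}. (-1) ^ exp_deg m :: complex) = (-1) ^ i * of_nat (card {m \<in> fy_exps_deg i. \<forall>F\<in>keys m. \<sigma> ` F = F})"
      unfolding e by (simp only: sum_constant mult.commute)
  qed
  finally show ?thesis using signed_monomial_count_eq_signed_chain_count[OF XL empty_flat] by (simp add: rank_empty)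
qed

end

section \<open>The signed count of fixed chains\<close>

definition simplicial_map :: "('a \<Rightarrow> 'b) \<Rightarrow> ('a list \<Rightarrow>\<^sub>0 complex) \<Rightarrow> ('b list \<Rightarrow>\<^sub>0 complex)" where
  "simplicial_map f = lin_ext (\<lambda>xs. single (map f xs) 1)"

lemma simplicial_map_single: "simplicial_map f (single xs z) = single (map f xs) z"
  by (simp add: simplicial_map_def lin_ext_single single_conv_cscale[symmetric])

lemma simplicial_map_sum: "simplicial_map f (\<Sum>i\<in>I. c i) = (\<Sum>i\<in>I. simplicial_map f (c i))"
  by (simp add: simplicial_map_def lin_ext_sum)

lemma face_map: "face i (map f xs) = map f (face i xs)"
  by (simp add: face_def take_map drop_map)

lemma simplicial_map_boundary: "boundary (simplicial_map f c) = simplicial_map f (boundary c)"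
proof -
  have s: "boundary (simplicial_map f (single xs z)) = simplicial_map f (boundary (single xs z))" for xs z
    by (simp add: simplicial_map_single boundary_single_face simplicial_map_sum face_map)
  have b: "boundary (\<Sum>i\<in>I. g i) = (\<Sum>i\<in>I. boundary (g i))" for I and g :: "'c list \<Rightarrow> ('d list \<Rightarrow>\<^sub>0 complex)"
    by (simp add: boundary_def lin_ext_sum)
  have "boundary (simplicial_map f c) = (\<Sum>x\<in>keys c. boundary (simplicial_map f (single x (lookup c x))))"
    by (subst (1) sum_single_keys[of c, symmetric]) (simp add: simplicial_map_sum boundary_def lin_ext_sum)
  also have "\<dots> = (\<Sum>x\<in>keys c. simplicial_map f (boundary (single x (lookup c x))))"
    by (simp only: s)
  also have "\<dots> = simplicial_map f (boundary c)"
    by (subst (3) sum_single_keys[of c, symmetric]) (simp add: simplicial_map_sum boundary_def lin_ext_sum)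
  finally show ?thesis .
qed

lemma simplicial_map_simplicial_map: "simplicial_map f (simplicial_map g c) = simplicial_map (f \<circ> g) c"
proof -
  have "simplicial_map f (simplicial_map g c) = (\<Sum>x\<in>keys c. simplicial_map f (simplicial_map g (single x (lookup c x))))"
    by (subst (1) sum_single_keys[of c, symmetric]) (simp add: simplicial_map_sum)
  also have "\<dots> = (\<Sum>x\<in>keys c. simplicial_map (f \<circ> g) (single x (lookup c x)))"
    by (simp add: simplicial_map_single)
  also have "\<dots> = simplicial_map (f \<circ> g) c"
    by (subst (3) sum_single_keys[of c, symmetric]) (simp add: simplicial_map_sum)
  finally show ?thesis .
qed

lemma simplicial_map_id: "simplicial_map id c = c"
proof -
  have "simplicial_map id c = (\<Sum>x\<in>keys c. simplicial_map id (single x (lookup c x)))"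
    by (subst (1) sum_single_keys[of c, symmetric]) (simp add: simplicial_map_sum)
  then show ?thesis by (simp add: simplicial_map_single sum_single_keys)
qed

context ordered_loopless_matroid
begin

lemma finite_chains: "finite (chains S l)"
proof (rule finite_subset)
  show "chains S l \<subseteq> {xs. set xs \<subseteq> L \<and> length xs \<le> l}" by (auto simp: chains_def selected_def)
  show "finite {xs. set xs \<subseteq> L \<and> length xs \<le> l}" by (rule finite_lists_length_le[OF finite_flats])
qed

definition cycles :: "nat set \<Rightarrow> nat \<Rightarrow> ('a set list \<Rightarrow>\<^sub>0 complex) set" where
  "cycles S l = {c \<in> chain_space S l. boundary c = 0}"

lemma cycles_subspace: "free.subspace (cycles S l)"
  unfolding free.subspace_def cycles_def
  using chain_space_subspace[of S l]
  by (auto simp: free.subspace_def boundary_0 boundary_add boundary_cscale)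

lemma boundary_chain_space: "c \<in> chain_space S (Suc l) \<Longrightarrow> boundary c \<in> chain_space S l"
proof -
  assume c: "c \<in> chain_space S (Suc l)"
  have "boundary c = (\<Sum>x\<in>keys c. boundary (single x (lookup c x)))"
    by (subst (1) sum_single_keys[of c, symmetric]) (simp add: boundary_def lin_ext_sum)
  also have "\<dots> \<in> chain_space S l"
  proof (rule free.subspace_sum[OF chain_space_subspace])
    fix x assume "x \<in> keys c"
    then have x: "x \<in> chains S (Suc l)" using c by (auto simp: chain_space_def)
    show "boundary (single x (lookup c x)) \<in> chain_space S l"
      unfolding boundary_single_face
    proof (rule free.subspace_sum[OF chain_space_subspace])
      fix i assume "i \<in> {..<length x}"
      then have "face i x \<in> chains S l" using chains_face[OF x, of i] x by (simp add: chains_def)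
      then show "single (face i x) ((- 1) ^ i * lookup c x) \<in> chain_space S l"
        by (simp add: chain_space_def)
    qed
  qed
  finally show ?thesis .
qed

text \<open>Exactness, in terms of the number \<open>l\<close> of elements of a chain.\<close>
lemma boundary_image:
  assumes S: "S \<subseteq> {1..<rk E}" and pos: "0 < rk E" and l: "l < card S"
  shows "boundary ` chain_space S (Suc l) = cycles S l"
proof
  show "boundary ` chain_space S (Suc l) \<subseteq> cycles S l"
    using boundary_chain_space by (auto simp: cycles_def boundary_boundary)
  show "cycles S l \<subseteq> boundary ` chain_space S (Suc l)"
    using cycle_is_boundary[OF S pos l] by (fastforce simp: cycles_def)
qed

lemma chains_empty: assumes S: "finite S" and l: "card S < l" shows "chains S l = {}"
proof (rule ccontr)
  assume "chains S l \<noteq> {}"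
  then obtain c where c: "c \<in> chains S l" by auto
  have "sorted_wrt (<) c" using c by (simp add: chains_def)
  then have d: "distinct c" by (rule sorted_wrt_less_distinct)
  have "inj_on rk (set c)" by (rule inj_onI) (rule chains_rank_inj[OF c])
  then have "card (rk ` set c) = l" using d c by (simp add: card_image distinct_card chains_def)
  moreover have "rk ` set c \<subseteq> S" using c by (auto simp: chains_def selected_def)
  ultimately show False using card_mono[OF S, of "rk ` set c"] l by linarith
qed

context
  fixes \<sigma> assumes \<sigma>: "automorphism \<sigma>"
begin

abbreviation "img \<equiv> (\<lambda>F. \<sigma> ` F)"

lemma map_chains: "c \<in> chains S l \<Longrightarrow> map img c \<in> chains S l"
proof -
  assume c: "c \<in> chains S l"
  have "set (map img c) \<subseteq> selected S"
    using c aut_flat[OF \<sigma>] aut_rk[OF \<sigma>] by (auto simp: chains_def selected_def)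
  moreover have "sorted_wrt (<) (map img c)"
    using c aut_psubset[OF \<sigma>] by (auto simp: chains_def sorted_wrt_map)
  ultimately show ?thesis using c by (simp add: chains_def)
qed

lemma simplicial_map_endo: "quotient_endo (chain_space S l) {0} (simplicial_map img)"
  unfolding simplicial_map_def chain_space_def by (rule trace_permuted_basis(1)[OF finite_chains map_chains])

lemma simplicial_map_trace: "trace_mod (chain_space S l) {0} (simplicial_map img) = of_nat (card {c \<in> chains S l. map img c = c})"
  unfolding simplicial_map_def chain_space_def by (rule trace_permuted_basis(2)[OF finite_chains map_chains])

lemma simplicial_map_cycles_endo: "quotient_endo (cycles S l) {0} (simplicial_map img)"
proof -
  interpret q: quotient_endo "chain_space S l" "{0}" "simplicial_map img" by (rule simplicial_map_endo)
  show ?thesis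
  proof
    show "simplicial_map img x \<in> cycles S l" if "x \<in> cycles S l" for x
      using that q.T_U[of x] simplicial_map_boundary[of img x] by (auto simp: cycles_def q.T_0)
  qed (use cycles_subspace q.T_add q.T_scale q.T_W subspace_zero_set in auto)
qed

lemma trace_cycles_rec:
  assumes S: "S \<subseteq> {1..<rk E}" and pos: "0 < rk E" and l: "l < card S"
  shows "trace_mod (chain_space S (Suc l)) {0} (simplicial_map img) =
    trace_mod (cycles S (Suc l)) {0} (simplicial_map img) + trace_mod (cycles S l) {0} (simplicial_map img)"
proof -
  have b: "boundary ` chain_space S (Suc l) = cycles S l" by (rule boundary_image[OF assms])
  have e1: "\<exists>B. basis_mod (cycles S (Suc l)) {0} B"
    by (rule basis_mod_exists[OF cycles_subspace finite_chains]) (auto simp: cycles_def chain_space_def)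
  have e2: "\<exists>B. basis_mod (cycles S l) {0} B"
    by (rule basis_mod_exists[OF cycles_subspace finite_chains]) (auto simp: cycles_def chain_space_def)
  obtain B1 B2 where B: "basis_mod (cycles S (Suc l)) {0} B1" "basis_mod (cycles S l) {0} B2" using e1 e2 by blast
  have "trace_mod (chain_space S (Suc l)) {0} (simplicial_map img) =
    trace_mod {u \<in> chain_space S (Suc l). boundary u = 0} {0} (simplicial_map img) + trace_mod (boundary ` chain_space S (Suc l)) {0} (simplicial_map img)"
  proof (rule trace_kernel_image)
    show "quotient_endo (chain_space S (Suc l)) {0} (simplicial_map img)" by (rule simplicial_map_endo)
    show "quotient_endo (boundary ` chain_space S (Suc l)) {0} (simplicial_map img)" unfolding b by (rule simplicial_map_cycles_endo)
    show "basis_mod {u \<in> chain_space S (Suc l). boundary u = 0} {0} B1" using B(1) by (simp add: cycles_def)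
    show "basis_mod (boundary ` chain_space S (Suc l)) {0} B2" unfolding b by (rule B(2))
  qed (auto simp: boundary_add boundary_cscale simplicial_map_boundary)
  then show ?thesis unfolding b by (simp add: cycles_def)
qed

lemma cycles_0: "cycles S 0 = chain_space S 0"
proof -
  have "boundary c = 0" if "c \<in> chain_space S 0" for c
  proof -
    have "boundary c = (\<Sum>x\<in>keys c. boundary (single x (lookup c x)))"
      by (subst (1) sum_single_keys[of c, symmetric]) (simp add: boundary_def lin_ext_sum)
    also have "\<dots> = 0" by (rule sum.neutral) (use that in \<open>auto simp: chain_space_def chains_def boundary_single\<close>)
    finally show ?thesis .
  qed
  then show ?thesis by (auto simp: cycles_def)
qed

text \<open>On each chain space the trace counts fixed chains, and it splits into the traces on the cycles of two consecutive degrees; the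
  alternating sum telescopes.\<close>
lemma hopf_trace:
  assumes S: "S \<subseteq> {1..<rk E}" and pos: "0 < rk E"
  shows "l \<le> card S \<Longrightarrow> (\<Sum>j\<le>l. (-1) ^ j * of_nat (card {c \<in> chains S j. map img c = c})) =
    (-1) ^ l * trace_mod (cycles S l) {0} (simplicial_map img)"
proof (induction l)
  case 0 show ?case using simplicial_map_trace[of S 0] by (simp add: cycles_0)
next
  case (Suc l)
  then show ?case using trace_cycles_rec[OF S pos, of l] simplicial_map_trace[of S "Suc l"] by (simp add: algebra_simps)
qed

text \<open>For odd rank the even-rank flats other than the empty one are exactly the selected ones, since the ground set has odd rank.\<close>
lemma alternating_chains:
  assumes r: "odd (rk E)"
  defines "S \<equiv> Even (rk E - 1)"
  shows "signed_chain_count {F \<in> L. \<sigma> ` F = F} {} = (-1) ^ card S * trace_mod (cycles S (card S)) {0} (simplicial_map img)"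
proof -
  have pos: "0 < rk E" using r by (cases "rk E") auto
  have S: "S \<subseteq> {1..<rk E}" using pos by (auto simp: S_def Even_def)
  have finS: "finite S" using S finite_subset by blast
  define X where "X = {F \<in> L. \<sigma> ` F = F}"
  have XL: "X \<subseteq> L" by (auto simp: X_def)
  have pivot_rank: "{K \<in> X \<inter> above {}. even (rk K)} = {K \<in> selected S. \<sigma> ` K = K}"
  proof (intro subset_antisym subsetI)
    fix K assume K: "K \<in> {K \<in> X \<inter> above {}. even (rk K)}"
    then have "K \<in> L" "K \<noteq> {}" by (auto simp: above_def)
    then have "K \<in> L" "0 < rk K" "rk K \<le> rk E" using flat_rank_pos flat_rank_le by auto
    moreover have "rk K \<noteq> rk E" using K r by auto
    moreover have "2 \<le> rk K" using K \<open>0 < rk K\<close> by (auto elim!: evenE)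
    ultimately show "K \<in> {K \<in> selected S. \<sigma> ` K = K}" using K by (auto simp: selected_def S_def Even_def X_def)
  next
    fix K assume K: "K \<in> {K \<in> selected S. \<sigma> ` K = K}"
    then have "K \<noteq> {}" by (auto simp: selected_def S_def Even_def rank_empty)
    then show "K \<in> {K \<in> X \<inter> above {}. even (rk K)}"
      using K by (auto simp: selected_def S_def Even_def X_def above_def)
  qed
  have mapid: "map img c = c \<longleftrightarrow> (\<forall>K\<in>set c. \<sigma> ` K = K)" for c :: "'a set list"
    by (induction c) auto
  have even_chains: "even_chains X {} = {c. \<exists>j. c \<in> chains S j \<and> map img c = c}"
    unfolding even_chains_def[OF XL] pivot_rank mapid chains_def by auto
  have len: "length c \<in> {..card S}" if "c \<in> even_chains X {}" for c
  proof (rule ccontr)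
    assume "length c \<notin> {..card S}"
    moreover have "c \<in> chains S (length c)" using that unfolding even_chains by (auto simp: chains_def)
    ultimately show False using chains_empty[OF finS] by auto
  qed
  have "signed_chain_count X {} = (\<Sum>j\<in>{..card S}. \<Sum>c\<in>{c \<in> even_chains X {}. length c = j}. (-1) ^ length c)"
    unfolding signed_chain_count_def[OF XL] by (rule sum.group[symmetric]) (use finite_even_chains[OF XL] len in auto)
  also have "\<dots> = (\<Sum>j\<le>card S. (-1) ^ j * of_nat (card {c \<in> chains S j. map img c = c}))"
  proof (intro sum.cong refl)
    fix j
    have e: "{c \<in> even_chains X {}. length c = j} = {c \<in> chains S j. map img c = c}"
      unfolding even_chains by (auto simp: chains_def)
    have "(\<Sum>c\<in>{c \<in> even_chains X {}. length c = j}. (-1) ^ length c :: complex) = (\<Sum>c\<in>{c \<in> even_chains X {}. length c = j}. (-1) ^ j)"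
      by (rule sum.cong) auto
    then show "(\<Sum>c\<in>{c \<in> even_chains X {}. length c = j}. (-1) ^ length c :: complex) = (-1) ^ j * of_nat (card {c \<in> chains S j. map img c = c})"
      unfolding e by (simp only: sum_constant mult.commute)
  qed
  also have "\<dots> = (-1) ^ card S * trace_mod (cycles S (card S)) {0} (simplicial_map img)"
    by (rule hopf_trace[OF S pos order_refl])
  finally show ?thesis by (simp add: X_def)
qed

end

end

section \<open>The equivariant Charney-Davis quantity\<close>

context loopless_matroid
begin

lemma aut_comp: assumes "automorphism \<sigma>" "automorphism \<tau>" shows "automorphism (\<sigma> \<circ> \<tau>)"
  unfolding automorphism_def
proof (intro conjI allI impI)
  show "\<sigma> \<circ> \<tau> permutes E" using assms by (auto simp: automorphism_def intro: permutes_compose)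
  fix X assume X: "X \<subseteq> E"
  have "\<tau> ` X \<subseteq> E" using image_mono[OF X, of \<tau>] permutes_image[of \<tau> E] assms by (auto simp: automorphism_def)
  then have "rk (\<sigma> ` \<tau> ` X) = rk X" using assms X unfolding automorphism_def by presburger
  then show "rk ((\<sigma> \<circ> \<tau>) ` X) = rk X" by (simp only: image_comp)
qed

lemma aut_group: "Group.group (aut_group M)"
proof (rule groupI)
  fix \<sigma> assume s: "\<sigma> \<in> carrier (aut_group M)"
  then have a: "automorphism \<sigma>" by (simp add: aut_carrier)
  have "inv_perm \<sigma> \<circ> \<sigma> = id" using permutes_inv_o(2)[of \<sigma> E] a by (simp add: automorphism_def)
  then show "\<exists>y\<in>carrier (aut_group M). y \<otimes>\<^bsub>aut_group M\<^esub> \<sigma> = \<one>\<^bsub>aut_group M\<^esub>"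
    using aut_inv[OF a] by (intro bexI[of _ "inv_perm \<sigma>"]) (simp_all add: aut_carrier, simp add: aut_group_def)
next
  fix \<sigma> \<tau> assume "\<sigma> \<in> carrier (aut_group M)" "\<tau> \<in> carrier (aut_group M)"
  then have "automorphism (\<sigma> \<circ> \<tau>)" by (simp add: aut_carrier aut_comp)
  then show "\<sigma> \<otimes>\<^bsub>aut_group M\<^esub> \<tau> \<in> carrier (aut_group M)" unfolding aut_carrier by (simp add: aut_group_def)
next
  show "\<one>\<^bsub>aut_group M\<^esub> \<in> carrier (aut_group M)" by (simp add: aut_group_def permutes_id)
qed (simp_all add: aut_group_def comp_assoc)

end

context ordered_loopless_matroid
begin

text \<open>The homology in question is in the top dimension, so there are no boundaries and it is the space of top cycles. A chain with \<open>s\<close>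
  elements has dimension \<open>s - 1 = (r - 3) / 2\<close>.\<close>
lemma character_red_homology:
  assumes r: "odd (rk E)" and \<sigma>: "automorphism \<sigma>"
  defines "P \<equiv> rank_selected L rk (Even (rk E - 1))"
  defines "RH \<equiv> red_homology P (\<lambda>\<sigma> F. \<sigma> ` F) ((int (rk E) - 3) div 2)"
  shows "elems RH = cycles (Even (rk E - 1)) ((rk E - 1) div 2)" "rels RH = {0}" "act RH \<sigma> = simplicial_map (\<lambda>F. \<sigma> ` F)"
    "card (Even (rk E - 1)) = (rk E - 1) div 2"
proof -
  define S where "S = Even (rk E - 1)"
  define s where "s = (rk E - 1) div 2"
  have rs: "rk E = 2 * s + 1" using r unfolding s_def by (auto elim!: oddE)
  have S: "S \<subseteq> {1..<rk E}" using rs by (auto simp: S_def Even_def)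
  have "S = (\<lambda>i. 2 * i) ` {1..s}"
    by (auto simp: S_def Even_def rs elim!: evenE)
  then have "card S = s" by (simp add: card_image inj_on_def)
  then show "card (Even (rk E - 1)) = (rk E - 1) div 2" by (simp add: S_def s_def)
  have b1: "poset_bounds L = {{}, E}"
    using empty_flat E_flat flat_sub_E by (auto simp: poset_bounds_def)
  have P: "P = selected S \<union> {{}, E}" by (simp add: P_def rank_selected_def b1 S_def selected_def)
  have b2: "poset_bounds P = {{}, E}"
    using flat_sub_E by (auto simp: P poset_bounds_def selected_def)
  have ne: "{} \<notin> selected S" "E \<notin> selected S" using S by (auto simp: selected_def rank_empty)
  have Q: "P - poset_bounds P = selected S" unfolding b2 using P ne by auto
  have k: "(int (rk E) - 3) div 2 = int s - 1" by (simp add: rs)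
  have sim: "simplices (selected S) (int s - 1) = chains S s" "simplices (selected S) (int s - 1 + 1) = chains S (Suc s)"
    by (auto simp: simplices_def chains_def)
  show "elems RH = cycles (Even (rk E - 1)) ((rk E - 1) div 2)"
    unfolding S_def[symmetric] s_def[symmetric] RH_def red_homology_def Let_def Q k sim cycles_def chain_space_def
    by simp
  have "chains S (Suc s) = {}" by (rule chains_empty) (use S \<open>card S = s\<close> finite_subset in auto)
  then have z: "{c :: 'a set list \<Rightarrow>\<^sub>0 complex. keys c \<subseteq> chains S (Suc s)} = {0}" by auto
  have "rels RH = boundary ` {c. keys c \<subseteq> chains S (Suc s)}"
    unfolding RH_def red_homology_def Let_def Q k sim by simp
  then show "rels RH = {0}" unfolding z by (simp add: boundary_0)
  show "act RH \<sigma> = simplicial_map (\<lambda>F. \<sigma> ` F)" by (simp add: RH_def red_homology_def Let_def simplicial_map_def)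
qed

end

theorem theorem1p10:
  fixes n r :: nat and M :: "nat matroid" and H :: "(nat \<Rightarrow> nat) set"
    and G :: "(nat \<Rightarrow> nat) monoid"
  assumes "n \<ge> 1"
    and "matroid M" and "ground M = {1..n}" and "loopless M"
    and "r = rank M (ground M)"
    and "subgroup H (aut_group M)"
    and "G = (aut_group M)\<lparr>carrier := H\<rparr>"
  shows "((\<Sum>i=0..r - 1. (-1) ^ i * character G (chow_piece_C M i)) =
           (if even r then 0
            else (-1) ^ ((r - 1) div 2) *
              character G (red_homology (rank_selected (flats M) (rank M) (Even (r - 1)))
                (\<lambda>\<sigma> F. \<sigma> ` F) ((int r - 3) div 2)))) \<and>
         genuine G (CD G (chow_piece_C M) (r - 1))"
proof -
  interpret ordered_loopless_matroid M by unfold_locales (fact assms)+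
  have pos: "0 < r"
  proof -
    have "1 \<in> ground M" using assms(1,3) by simp
    then have "E \<noteq> {}" by auto
    then show ?thesis using flat_rank_pos[OF E_flat] assms(5) by simp
  qed
  interpret AG: Group.group "aut_group M" by (rule aut_group)
  have G: "Group.group G" unfolding assms(7) by (rule subgroup.subgroup_is_group[OF assms(6) AG.group_axioms])
  have cG: "carrier G = H" by (simp add: assms(7))
  have aut: "automorphism \<sigma>" if "\<sigma> \<in> carrier G" for \<sigma>
    using subgroup.subset[OF assms(6)] that aut_carrier cG by auto
  define s where "s = (r - 1) div 2"
  define S where "S = Even (r - 1)"
  define RH where "RH = red_homology (rank_selected L rk (Even (r - 1))) (\<lambda>(\<sigma> :: nat \<Rightarrow> nat) F. \<sigma> ` F) ((int r - 3) div 2)"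
  \<comment> \<open>the signs in the statement are constant class functions\<close>
  have neg1: "((-1) ^ i * \<chi>) \<sigma> = (-1) ^ i * \<chi> \<sigma>" for i and \<chi> :: "(nat \<Rightarrow> nat) \<Rightarrow> complex" and \<sigma>
  proof -
    have "((-1) ^ i :: (nat \<Rightarrow> nat) \<Rightarrow> complex) \<sigma> = (-1) ^ i" by (induction i) auto
    then show ?thesis by simp
  qed
  have sum_fun: "(\<Sum>i\<in>I. h i) \<sigma> = (\<Sum>i\<in>I. h i \<sigma>)" for I :: "nat set" and h :: "nat \<Rightarrow> (nat \<Rightarrow> nat) \<Rightarrow> complex" and \<sigma>
    by (induction I rule: infinite_finite_induct) auto
  define A where "A = (\<Sum>i=0..r - 1. (-1) ^ i * character G (chow_piece_C M i))"
  have A: "A \<sigma> = (if \<sigma> \<in> carrier G then signed_chain_count {F \<in> L. \<sigma> ` F = F} {} else 0)" for \<sigma>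
  proof (cases "\<sigma> \<in> carrier G")
    case True
    have "A \<sigma> = (\<Sum>i=0..r - 1. (-1) ^ i * of_nat (card {m \<in> fy_exps_deg i. \<forall>F\<in>keys m. \<sigma> ` F = F}))"
      unfolding A_def sum_fun neg1 using True by (simp add: character_def chow_trace[OF aut[OF True]])
    then show ?thesis using alternating_trace[OF aut[OF True]] pos assms(5) True by simp
  next
    case False then show ?thesis by (simp add: A_def sum_fun neg1 character_def)
  qed
  have main: "A = (if even r then 0 else (-1) ^ s * character G RH)"
  proof (rule ext)
    fix \<sigma>
    show "A \<sigma> = (if even r then 0 else (-1) ^ s * character G RH) \<sigma>"
    proof (cases "\<sigma> \<in> carrier G")
      case False then show ?thesis using neg1 by (simp add: A character_def)
    next
      case True
      note a = aut[OF True]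
      show ?thesis
      proof (cases "even r")
        case e: True
        have "\<sigma> ` E = E" using permutes_image[of \<sigma> E] a by (simp add: automorphism_def)
        then have "E \<in> {F \<in> L. \<sigma> ` F = F}" using E_flat by simp
        then have "signed_chain_count {F \<in> L. \<sigma> ` F = F} {} = (if {} = E then 1 else 0)"
          by (intro signed_chain_count_even_rank empty_flat) (use e assms(5) in auto)
        moreover have "{} \<noteq> E" using pos assms(5) rank_empty by auto
        ultimately show ?thesis using True e by (simp add: A)
      next
        case o: False
        have r: "odd (rk E)" using o assms(5) by simp
        note h = character_red_homology[OF r a, folded assms(5), folded RH_def S_def s_def]
        have "signed_chain_count {F \<in> L. \<sigma> ` F = F} {} = (-1) ^ s * trace_mod (cycles S s) {0} (simplicial_map (\<lambda>F. \<sigma> ` F))"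
          using alternating_chains[OF a r, folded assms(5), folded S_def] unfolding h(4) .
        also have "\<dots> = (-1) ^ s * character G RH \<sigma>" using True by (simp add: character_def h)
        finally show ?thesis using True o by (simp only: A neg1 if_True if_False)
      qed
    qed
  qed
  have pH: "poly (Hilb G (chow_piece_C M) (r - 1)) (-1) = A"
    unfolding Hilb_def A_def poly_sum poly_monom by (simp add: mult.commute)
  have "genuine G (CD G (chow_piece_C M) (r - 1))"
  proof (cases "even r")
    case True
    then have "CD G (chow_piece_C M) (r - 1) = 0" using pos main by (simp add: CD_def pH del: One_nat_def)
    then show ?thesis by (simp add: genuine_zero)
  next
    case o: False
    then have "even (r - 1)" by simp
    then have "CD G (chow_piece_C M) (r - 1) = (-1) ^ s * ((-1) ^ s * character G RH)"
      using o main by (simp add: CD_def pH s_def del: One_nat_def)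
    also have "\<dots> = character G RH"
      by (rule ext) (simp only: neg1 mult.assoc[symmetric] power_add[symmetric] mult_2[symmetric] power_mult power2_minus power_one one_power2 mult_1)
    finally have cd: "CD G (chow_piece_C M) (r - 1) = character G RH" .
    have r: "odd (rk E)" using o assms(5) by simp
    note h = character_red_homology[OF r, folded assms(5), folded RH_def S_def s_def]
    have "automorphism id" by (simp add: automorphism_def permutes_id)
    note h0 = h[OF this]
    have ch: "character G RH = (\<lambda>g. if g \<in> carrier G then trace_mod (cycles S s) {0} (simplicial_map (\<lambda>F. g ` F)) else 0)"
      by (rule ext) (simp add: character_def h(3)[OF aut] h0(1,2))
    have "\<exists>B. basis_mod (cycles S s) {0} B"
      by (rule basis_mod_exists[OF cycles_subspace finite_chains]) (auto simp: cycles_def chain_space_def)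
    then obtain B where B: "basis_mod (cycles S s) {0} B" by blast
    have "genuine G (\<lambda>g. if g \<in> carrier G then trace_mod (cycles S s) {0} (simplicial_map (\<lambda>F. g ` F)) else 0)"
    proof (rule genuine_trace[OF G _ _ _ B])
      show "quotient_endo (cycles S s) {0} (simplicial_map (\<lambda>F. g ` F))" if "g \<in> carrier G" for g
        by (rule simplicial_map_cycles_endo[OF aut[OF that]])
      show "simplicial_map (\<lambda>F. (g \<otimes>\<^bsub>G\<^esub> h) ` F) u = simplicial_map (\<lambda>F. g ` F) (simplicial_map (\<lambda>F. h ` F) u)" for g h u
        by (simp add: simplicial_map_simplicial_map assms(7) aut_group_def comp_def image_comp)
      show "simplicial_map (\<lambda>F. \<one>\<^bsub>G\<^esub> ` F) u = u" for u
        using simplicial_map_id[of u] by (simp add: assms(7) aut_group_def id_def)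
    qed
    then show ?thesis unfolding cd ch .
  qed
  then show ?thesis using main unfolding A_def RH_def s_def by blast
qed

end
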